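(* Let $\ell$ be a line and let $S_1,S_2$ be distinct spheres in $\mathbb{R}^3$ that have infinitely many common real tangent lines. Let $\tau\subset\mathbb{G}$ be the algebraic set (with multiplicities) of lines in $\mathbb{P}^3$ that meet $\ell$ and are tangent to both $S_1$ and $S_2$. Then $\tau$ is a curve of degree $8$ that determines the spheres $S_1$ and $S_2$.
   Context: $\mathbb{G}\subset\mathbb{P}^5$ is the Grassmannian of lines in complex projective space $\mathbb{P}^3\supset\mathbb{R}^3$, a quadric in Plücker space $\mathbb{P}^5$. The lines meeting $\ell$ are cut out on $\mathbb{G}$ by a hyperplane $\Lambda_\ell\subset\mathbb{P}^5$. A line with Plücker vector $p$ is tangent to the quadric with symmetric $4\times4$ matrix $Q$ if and only if $p^{T}(\wedge^2Q)p=0$, where $\wedge^2 Q$ is the $6\times 6$ matrix of $2\times2$ minors of $Q$. $\tau$ is the subscheme of $\mathbb{G}$ defined by the linear equation of $\Lambda_\ell$ and the two quadratic equations for tangency to $S_1$ and $S_2$, so it retains algebraic multiplicities; its degree is counted with multiplicity. "$\tau$ determines the spheres" means: for fixed $\ell$, the unordered pair $\{S_1,S_2\}$ is uniquely determined by $\tau$. *)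

theory Defs
  imports
    "HOL-Analysis.Analysis"
    "HOL-Library.Poly_Mapping"
    "HOL-Computational_Algebra.Polynomial"
begin

section \<open>The homogeneous coordinate ring of Pluecker space\<close>

text \<open>The index \<open>Pij\<close> stands for the Pluecker coordinate
  \<open>x\<^sub>i y\<^sub>j - x\<^sub>j y\<^sub>i\<close> of the line through the points \<open>x\<close> and \<open>y\<close> of
  projective 3-space.\<close>

datatype plucker = P12 | P13 | P14 | P23 | P24 | P34

lemma UNIV_plucker: "UNIV = {P12, P13, P14, P23, P24, P34}"
  using plucker.exhaust by auto

instance plucker :: finite
  by standard (simp add: UNIV_plucker)

fun row1 :: "plucker \<Rightarrow> 4" where
  "row1 P12 = 1" | "row1 P13 = 1" | "row1 P14 = 1"
| "row1 P23 = 2" | "row1 P24 = 2" | "row1 P34 = 3"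

fun row2 :: "plucker \<Rightarrow> 4" where
  "row2 P12 = 2" | "row2 P13 = 3" | "row2 P14 = 4"
| "row2 P23 = 3" | "row2 P24 = 4" | "row2 P34 = 4"

text \<open>Polynomials in six variables with complex coefficients, as finitely
  supported functions on exponent vectors.\<close>

type_synonym plucker_poly = "(plucker \<Rightarrow>\<^sub>0 nat) \<Rightarrow>\<^sub>0 complex"

definition Const :: "complex \<Rightarrow> plucker_poly" where
  "Const c = Poly_Mapping.single 0 c"

definition Var :: "plucker \<Rightarrow> plucker_poly" where
  "Var \<alpha> = Poly_Mapping.single (Poly_Mapping.single \<alpha> 1) 1"

global_interpretation poly_vs: vector_space "\<lambda>c f. Const c * f"
  by standard
    (simp_all add: Const_def algebra_simps single_add mult_single flip: mult.assoc)

definition homogeneous_part :: "nat \<Rightarrow> plucker_poly set" where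
  "homogeneous_part d =
     {f. \<forall>t \<in> Poly_Mapping.keys f. (\<Sum>\<alpha>\<in>UNIV. Poly_Mapping.lookup t \<alpha>) = d}"

section \<open>Subschemes of Pluecker space, dimension and degree\<close>

text \<open>A closed subscheme of projective 5-space is represented by its saturated
  homogeneous ideal. This is a bijection, so equality of saturated ideals is
  equality of subschemes, and multiplicities are retained.\<close>

definition ideal_generated :: "plucker_poly set \<Rightarrow> plucker_poly set" where
  "ideal_generated G = module.span (*) G"

definition saturation :: "plucker_poly set \<Rightarrow> plucker_poly set" where
  "saturation I = {f. \<forall>\<alpha>. \<exists>n. Var \<alpha> ^ n * f \<in> I}"

definition subscheme :: "plucker_poly set \<Rightarrow> plucker_poly set" where
  "subscheme G = saturation (ideal_generated G)"

text \<open>The dimension over the complex numbers of the degree \<open>d\<close> part of the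
  homogeneous coordinate ring, i.e. of the quotient by the ideal.\<close>

definition hilbert_function :: "plucker_poly set \<Rightarrow> nat \<Rightarrow> nat" where
  "hilbert_function X d =
     poly_vs.dim (homogeneous_part d) - poly_vs.dim (X \<inter> homogeneous_part d)"

definition is_hilbert_polynomial :: "plucker_poly set \<Rightarrow> real poly \<Rightarrow> bool" where
  "is_hilbert_polynomial X P \<longleftrightarrow>
     (\<forall>\<^sub>F d in sequentially. real (hilbert_function X d) = poly P (real d))"

text \<open>A nonempty subscheme whose Hilbert polynomial has degree \<open>m\<close> and leading
  coefficient \<open>c\<close> has dimension \<open>m\<close> and degree \<open>m! c\<close>.\<close>

definition has_dim_and_degree :: "plucker_poly set \<Rightarrow> nat \<Rightarrow> nat \<Rightarrow> bool" where
  "has_dim_and_degree X m n \<longleftrightarrow>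
     (\<exists>P. is_hilbert_polynomial X P \<and> P \<noteq> 0 \<and> degree P = m \<and>
          fact m * lead_coeff P = real n)"

definition is_curve_of_degree :: "plucker_poly set \<Rightarrow> nat \<Rightarrow> bool" where
  "is_curve_of_degree X n \<longleftrightarrow> has_dim_and_degree X 1 n"

section \<open>Lines meeting a line and tangent to quadrics\<close>

definition homogenize :: "real^3 \<Rightarrow> complex^4" where
  "homogenize x =
     vector [complex_of_real (x$1), complex_of_real (x$2), complex_of_real (x$3), 1]"

definition plucker_vector :: "complex^4 \<Rightarrow> complex^4 \<Rightarrow> complex^plucker" where
  "plucker_vector x y = (\<chi> \<alpha>. x$row1 \<alpha> * y$row2 \<alpha> - x$row2 \<alpha> * y$row1 \<alpha>)"

definition plucker_relation :: plucker_poly where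
  "plucker_relation = Var P12 * Var P34 - Var P13 * Var P24 + Var P14 * Var P23"

text \<open>The linear form of the hyperplane that cuts out the lines meeting the line
  with Pluecker vector \<open>p\<close>. For \<open>p = plucker_vector a b\<close> and \<open>q = plucker_vector x y\<close>
  its value at \<open>q\<close> is the determinant of the matrix with rows \<open>a, b, x, y\<close>.\<close>

definition meeting_form :: "complex^plucker \<Rightarrow> plucker_poly" where
  "meeting_form p =
     Const (p$P12) * Var P34 - Const (p$P13) * Var P24 + Const (p$P14) * Var P23 +
     Const (p$P23) * Var P14 - Const (p$P24) * Var P13 + Const (p$P34) * Var P12"

definition wedge2 :: "complex^4^4 \<Rightarrow> complex^plucker^plucker" where
  "wedge2 Q = (\<chi> \<alpha> \<beta>. Q$row1 \<alpha>$row1 \<beta> * Q$row2 \<alpha>$row2 \<beta> -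
                       Q$row1 \<alpha>$row2 \<beta> * Q$row2 \<alpha>$row1 \<beta>)"

definition tangency_form :: "complex^4^4 \<Rightarrow> plucker_poly" where
  "tangency_form Q =
     (\<Sum>\<alpha>\<in>UNIV. \<Sum>\<beta>\<in>UNIV. Const (wedge2 Q$\<alpha>$\<beta>) * Var \<alpha> * Var \<beta>)"

definition sphere_matrix :: "real^3 \<Rightarrow> real \<Rightarrow> complex^4^4" where
  "sphere_matrix c r = map_matrix complex_of_real (vector
     [vector [      1,       0,       0,               - (c$1)],
      vector [      0,       1,       0,               - (c$2)],
      vector [      0,       0,       1,               - (c$3)],
      vector [- (c$1), - (c$2), - (c$3), (norm c)\<^sup>2 - r\<^sup>2]])"

lemma vector_4 [simp]:
  "(vector [x, y, z, w] :: 'a::zero^4)$1 = x"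
  "(vector [x, y, z, w] :: 'a::zero^4)$2 = y"
  "(vector [x, y, z, w] :: 'a::zero^4)$3 = z"
  "(vector [x, y, z, w] :: 'a::zero^4)$4 = w"
  unfolding vector_def by simp_all

text \<open>The quadric of this matrix is the sphere.\<close>

lemma sphere_matrix_quadratic_form:
  "(\<Sum>i\<in>UNIV. \<Sum>j\<in>UNIV. sphere_matrix c r$i$j * homogenize x$i * homogenize x$j) =
     complex_of_real ((dist x c)\<^sup>2 - r\<^sup>2)"
  by (simp add: sphere_matrix_def homogenize_def map_matrix_def sum_4 dist_norm
      power2_norm_eq_inner inner_vec_def sum_3 algebra_simps)

text \<open>The subscheme of lines in complex projective 3-space that meet the line
  through the points \<open>a\<close> and \<open>b\<close> and are tangent to the spheres with centres
  \<open>c1\<close>, \<open>c2\<close> and radii \<open>r1\<close>, \<open>r2\<close>.\<close>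

definition tangent_scheme ::
    "real^3 \<Rightarrow> real^3 \<Rightarrow> real^3 \<Rightarrow> real \<Rightarrow> real^3 \<Rightarrow> real \<Rightarrow> plucker_poly set" where
  "tangent_scheme a b c1 r1 c2 r2 = subscheme
     {plucker_relation,
      meeting_form (plucker_vector (homogenize a) (homogenize b)),
      tangency_form (sphere_matrix c1 r1),
      tangency_form (sphere_matrix c2 r2)}"

section \<open>Real tangent lines\<close>

definition is_line :: "(real^3) set \<Rightarrow> bool" where
  "is_line L \<longleftrightarrow> affine L \<and> aff_dim L = 1"

text \<open>A real line is tangent to a sphere iff it meets the sphere in exactly one point.\<close>

definition tangent_to_sphere :: "(real^3) set \<Rightarrow> (real^3) set \<Rightarrow> bool" where
  "tangent_to_sphere L S \<longleftrightarrow> is_line L \<and> (\<exists>p. L \<inter> S = {p})"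

end

theory Submission
  imports Defs "HOL-Computational_Algebra.Polynomial_Factorial" "HOL-Computational_Algebra.Field_as_Ring"
begin

text \<open>In an orthonormal frame along the line, the lines meeting it are parametrised by
  \<open>w A \<and> D + (\<sigma> A + \<tau> D) \<and> (u U + v V)\<close>. Substituting this identifies the coordinate ring of the
  hyperplane section of the Grassmannian with the polynomials in \<open>w, \<sigma>, \<tau>, u, v\<close> whose degrees in
  \<open>(w, \<sigma>, \<tau>)\<close> and \<open>(w, u, v)\<close> agree. The tangency condition of a sphere becomes an irreducible form
  \<open>n s\<^sup>2 + 2 k s w + \<rho> w\<^sup>2 + \<sigma>\<^sup>2 (\<rho> n - k\<^sup>2)\<close> which determines the sphere. Hence two distinct spheres give a
  regular sequence, so the Hilbert function of the ideal they generate is \<open>8 d - 4\<close>. This ideal is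
  saturated: a sphere form is still a nonzerodivisor modulo \<open>(w\<^sup>N, (\<sigma> v)\<^sup>N)\<close>, as its leading monomial is
  \<open>\<tau>\<^sup>2 u\<^sup>2\<close>. So a third sphere with the same tangent scheme has a form \<open>\<alpha> S\<^sub>1 + \<beta> S\<^sub>2\<close>, and comparing
  coefficients makes \<open>\<alpha> \<beta>\<close> times the rank one matrix \<open>(c\<^sub>1 - c\<^sub>2)(c\<^sub>1 - c\<^sub>2)\<^sup>T\<close> a multiple of the
  identity, which forces \<open>\<alpha> \<beta> = 0\<close> because spheres with a common real tangent are not concentric.\<close>

section \<open>Substitution homomorphisms\<close>

text \<open>The lines meeting the given line form a cone over P1 x P1 (a point of the line together
  with a plane through it) with the line itself as vertex, a quadric in a projective 4-space. The
  curve is a complete intersection of three quadrics there: this is the origin of the degree 2 * 2 *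
  2 and, with arithmetic genus 5, of the Hilbert polynomial 8 d + 1 - 5. The balanced polynomials
  are the coordinate ring of that cone. It is not factorial, because
  \<open>p14 p23 = p13 p24\<close>. Passing to the parameters embeds it into a polynomial ring,
  where irreducible sphere forms are prime; the grading then brings quotients back into the balanced
  ring. A rival pair of spheres might consist of two equal spheres. There is no regular sequence in
  that case, and it is excluded by divisibility instead.\<close>

locale ring_morphism =
  fixes h :: "'a::comm_ring_1 \<Rightarrow> 'b::comm_ring_1"
  assumes add: "h (x + y) = h x + h y"
    and mult: "h (x * y) = h x * h y"
    and one: "h 1 = 1"
begin

lemma zero: "h 0 = 0"
  using add[of 0 0] by simp

lemma uminus: "h (- x) = - h x"
  using add[of x "- x"] zero by (simp add: eq_neg_iff_add_eq_0 add.commute)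

lemma diff: "h (x - y) = h x - h y"
  using add[of x "- y"] by (simp add: uminus)

lemma power: "h (x ^ n) = h x ^ n"
  by (induction n) (simp_all add: one mult)

lemma sum: "h (sum f A) = (\<Sum>x\<in>A. h (f x))"
  by (induction A rule: infinite_finite_induct) (simp_all add: zero add)

lemma prod: "h (prod f A) = (\<Prod>x\<in>A. h (f x))"
  by (induction A rule: infinite_finite_induct) (simp_all add: one mult)

lemma numeral: "h (numeral n) = numeral n"
proof -
  have "h (of_nat k) = of_nat k" for k
    by (induction k) (simp_all add: zero one add)
  from this[of "numeral n"] show ?thesis by simp
qed

lemmas hom_simps = add mult one zero uminus diff power sum prod numeral

end

lemma ring_morphism_comp:
  assumes "ring_morphism f" "ring_morphism g"
  shows "ring_morphism (\<lambda>x. g (f x))"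
proof -
  interpret f: ring_morphism f by fact
  interpret g: ring_morphism g by fact
  show ?thesis by standard (simp_all add: f.hom_simps g.hom_simps)
qed

lemma ring_morphism_id: "ring_morphism (\<lambda>x. x)"
  by standard simp_all

interpretation Const: ring_morphism Const
  by standard (simp_all add: Const_def single_add mult_single)

abbreviation monomial :: "(plucker \<Rightarrow>\<^sub>0 nat) \<Rightarrow> plucker_poly" where
  "monomial t \<equiv> Poly_Mapping.single t 1"

abbreviation expo :: "(plucker \<Rightarrow>\<^sub>0 nat) \<Rightarrow> plucker \<Rightarrow> nat" where
  "expo \<equiv> Poly_Mapping.lookup"

lemma single_eq_Const_monomial: "Poly_Mapping.single t c = Const c * monomial t"
  by (simp add: Const_def mult_single)

lemma lookup_Const_mult: "Poly_Mapping.lookup (Const c * f) t = c * Poly_Mapping.lookup f t"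
proof -
  have "Const c * f = Poly_Mapping.map ((*) c) f"
    by (simp add: Const_def mult_map_scale_conv_mult)
  then show ?thesis by (simp add: Poly_Mapping.map.rep_eq when_def)
qed

lemma poly_mapping_expand: "f = (\<Sum>t\<in>Poly_Mapping.keys f. Poly_Mapping.single t (Poly_Mapping.lookup f t))"
proof (rule poly_mapping_eqI)
  fix k
  show "Poly_Mapping.lookup f k = Poly_Mapping.lookup (\<Sum>t\<in>Poly_Mapping.keys f. Poly_Mapping.single t (Poly_Mapping.lookup f t)) k"
    by (cases "k \<in> Poly_Mapping.keys f")
      (simp_all add: lookup_sum lookup_single when_def sum.delta' in_keys_iff)
qed

lemma poly_expand: "f = (\<Sum>t\<in>Poly_Mapping.keys f. Const (Poly_Mapping.lookup f t) * monomial t)"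
  using poly_mapping_expand[of f] by (subst (asm) single_eq_Const_monomial)

lemma plucker_poly_induct [case_names monom plus]:
  assumes "\<And>t c. P (Const c * monomial t)" "\<And>f g. P f \<Longrightarrow> P g \<Longrightarrow> P (f + g)"
  shows "P f"
proof -
  have zero: "P 0" using assms(1)[of 0] by (simp add: Const.zero)
  have "P (\<Sum>t\<in>A. Const (Poly_Mapping.lookup f t) * monomial t)" for A
    by (induction A rule: infinite_finite_induct) (simp_all add: zero assms)
  then show ?thesis by (subst poly_expand)
qed

text \<open>Linear extension of a map given on monomials. It is kept apart from \<open>subst\<close>
  because straightening, defined below, is linear but not multiplicative.\<close>

definition lin :: "(complex \<Rightarrow> 'b::comm_ring_1) \<Rightarrow> ((plucker \<Rightarrow>\<^sub>0 nat) \<Rightarrow> 'b) \<Rightarrow> plucker_poly \<Rightarrow> 'b" where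
  "lin emb h f = (\<Sum>t\<in>Poly_Mapping.keys f. emb (Poly_Mapping.lookup f t) * h t)"

context
  fixes emb :: "complex \<Rightarrow> 'b::comm_ring_1"
  assumes emb: "ring_morphism emb"
begin

interpretation emb: ring_morphism emb by (rule emb)

lemma lin_superset:
  assumes "finite A" "Poly_Mapping.keys f \<subseteq> A"
  shows "lin emb h f = (\<Sum>t\<in>A. emb (Poly_Mapping.lookup f t) * h t)"
  unfolding lin_def
  by (rule sum.mono_neutral_left) (use assms in \<open>auto simp: in_keys_iff emb.zero\<close>)

lemma lin_add: "lin emb h (f + g) = lin emb h f + lin emb h g"
proof -
  let ?A = "Poly_Mapping.keys f \<union> Poly_Mapping.keys g"
  have "lin emb h (f + g) = (\<Sum>t\<in>?A. emb (Poly_Mapping.lookup (f + g) t) * h t)"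
    by (rule lin_superset) (use keys_add[of f g] in auto)
  moreover have "lin emb h f = (\<Sum>t\<in>?A. emb (Poly_Mapping.lookup f t) * h t)"
    by (rule lin_superset) auto
  moreover have "lin emb h g = (\<Sum>t\<in>?A. emb (Poly_Mapping.lookup g t) * h t)"
    by (rule lin_superset) auto
  ultimately show ?thesis
    by (simp add: lookup_add emb.add algebra_simps sum.distrib)
qed

lemma lin_single: "lin emb h (Poly_Mapping.single t c) = emb c * h t"
  by (simp add: lin_def emb.zero)

lemma lin_term: "lin emb h (Const c * monomial t) = emb c * h t"
  by (simp add: lin_single flip: single_eq_Const_monomial)

end

definition subst :: "(complex \<Rightarrow> 'b::comm_ring_1) \<Rightarrow> (plucker \<Rightarrow> 'b) \<Rightarrow> plucker_poly \<Rightarrow> 'b" where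
  "subst emb g = lin emb (\<lambda>t. \<Prod>\<alpha>\<in>UNIV. g \<alpha> ^ expo t \<alpha>)"

lemma monomial_eq_prod_Var: "monomial t = (\<Prod>\<alpha>\<in>UNIV. Var \<alpha> ^ expo t \<alpha>)"
proof -
  have Var_power: "Var \<alpha> ^ n = monomial (Poly_Mapping.single \<alpha> n)" for \<alpha> n
    by (induction n) (simp_all add: Var_def mult_single flip: single_add)
  have "(\<Prod>\<alpha>\<in>A. Var \<alpha> ^ expo t \<alpha>) = monomial (\<Sum>\<alpha>\<in>A. Poly_Mapping.single \<alpha> (expo t \<alpha>))" for A
    by (induction A rule: infinite_finite_induct) (simp_all add: Var_power mult_single)
  moreover have "(\<Sum>\<alpha>\<in>UNIV. Poly_Mapping.single \<alpha> (expo t \<alpha>)) = t"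
    by (rule poly_mapping_eqI) (simp add: lookup_sum lookup_single when_def sum.delta')
  ultimately show ?thesis by simp
qed

lemma subst_monomial:
  assumes "ring_morphism emb"
  shows "subst emb g (monomial t) = (\<Prod>\<alpha>\<in>UNIV. g \<alpha> ^ expo t \<alpha>)"
  using lin_single[OF assms, of _ t 1] ring_morphism.one[OF assms] by (simp add: subst_def)

lemma subst_Const:
  assumes "ring_morphism emb"
  shows "subst emb g (Const c) = emb c"
  using lin_single[OF assms, of _ 0 c] by (simp add: subst_def Const_def)

lemma subst_Var:
  assumes "ring_morphism emb"
  shows "subst emb g (Var \<alpha>) = g \<alpha>"
proof -
  have "(\<Prod>\<beta>\<in>UNIV. g \<beta> ^ expo (Poly_Mapping.single \<alpha> 1) \<beta>) = (\<Prod>\<beta>\<in>UNIV. if \<beta> = \<alpha> then g \<beta> else 1)"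
    by (rule prod.cong) (auto simp: lookup_single)
  then show ?thesis
    using subst_monomial[OF assms, of g "Poly_Mapping.single \<alpha> 1"] by (simp add: Var_def)
qed

lemma ring_morphism_subst:
  assumes "ring_morphism emb"
  shows "ring_morphism (subst emb g)"
proof
  interpret emb: ring_morphism emb by fact
  show add: "subst emb g (x + y) = subst emb g x + subst emb g y" for x y
    unfolding subst_def by (rule lin_add[OF assms])
  show "subst emb g 1 = 1"
    using subst_Const[OF assms, of g 1] by (simp add: Const.one emb.one)
  have tm: "subst emb g (Poly_Mapping.single t c) = emb c * (\<Prod>\<alpha>\<in>UNIV. g \<alpha> ^ expo t \<alpha>)" for t c
    unfolding subst_def by (rule lin_single[OF assms])
  show "subst emb g (x * y) = subst emb g x * subst emb g y" for x y
  proof (induction x rule: plucker_poly_induct)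
    case (monom t c)
    show ?case
    proof (induction y rule: plucker_poly_induct)
      case (monom t' c')
      show ?case
        by (simp add: tm mult_single emb.mult lookup_add power_add prod.distrib ac_simps
            flip: single_eq_Const_monomial)
    qed (simp add: distrib_left add)
  qed (simp add: distrib_right add)
qed

lemma ring_morphism_plucker_poly_eqI:
  assumes "ring_morphism f" "ring_morphism g"
    and "\<And>c. f (Const c) = g (Const c)" "\<And>\<alpha>. f (Var \<alpha>) = g (Var \<alpha>)"
  shows "f p = g p"
proof -
  interpret f: ring_morphism f by fact
  interpret g: ring_morphism g by fact
  show ?thesis
    by (induction p rule: plucker_poly_induct)
      (simp_all add: f.hom_simps g.hom_simps assms(3,4) monomial_eq_prod_Var)
qed

section \<open>Gradings\<close>

lift_definition restrict_keys :: "('k \<Rightarrow> bool) \<Rightarrow> ('k \<Rightarrow>\<^sub>0 'b::zero) \<Rightarrow> 'k \<Rightarrow>\<^sub>0 'b"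
  is "\<lambda>P f k. if P k then f k else 0"
  by (rule finite_subset) auto

lemma keys_restrict_keys: "Poly_Mapping.keys (restrict_keys P f) = {k \<in> Poly_Mapping.keys f. P k}"
  by (auto simp: in_keys_iff restrict_keys.rep_eq split: if_splits)

lemma restrict_keys_add: "restrict_keys P (f + g) = restrict_keys P f + restrict_keys P (g :: _ \<Rightarrow>\<^sub>0 'b::comm_monoid_add)"
  by (rule poly_mapping_eqI) (simp add: restrict_keys.rep_eq lookup_add)

lemma restrict_keys_id: "(\<And>k. k \<in> Poly_Mapping.keys f \<Longrightarrow> P k) \<Longrightarrow> restrict_keys P f = f"
  by (rule poly_mapping_eqI) (auto simp: restrict_keys.rep_eq in_keys_iff)

lemma restrict_keys_0: "(\<And>k. k \<in> Poly_Mapping.keys f \<Longrightarrow> \<not> P k) \<Longrightarrow> restrict_keys P f = 0"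
  by (rule poly_mapping_eqI) (auto simp: restrict_keys.rep_eq in_keys_iff)

lemma restrict_keys_compl: "restrict_keys P f + restrict_keys (\<lambda>k. \<not> P k) f = (f :: _ \<Rightarrow>\<^sub>0 'b::comm_monoid_add)"
  by (rule poly_mapping_eqI) (auto simp: restrict_keys.rep_eq lookup_add)

lemma keys_mult_elim:
  assumes "k \<in> Poly_Mapping.keys (f * g)"
  obtains a b where "k = a + b" "a \<in> Poly_Mapping.keys f" "b \<in> Poly_Mapping.keys g"
  using keys_mult[of f g] assms by blast

text \<open>Split \<open>g\<close> into its component of weight \<open>d\<close> and the rest: as
  weights cancel, products of \<open>f\<close> with the rest have no term of weight
  \<open>e + d\<close>.\<close>

lemma restrict_keys_mult:
  fixes \<omega> :: "(plucker \<Rightarrow>\<^sub>0 nat) \<Rightarrow> 'g::cancel_comm_monoid_add" and f g :: plucker_poly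
  assumes \<omega>: "\<And>s t. \<omega> (s + t) = \<omega> s + \<omega> t"
    and f: "\<And>s. s \<in> Poly_Mapping.keys f \<Longrightarrow> \<omega> s = e"
  shows "restrict_keys (\<lambda>t. \<omega> t = e + d) (f * g) = f * restrict_keys (\<lambda>t. \<omega> t = d) g"
proof -
  let ?g = "restrict_keys (\<lambda>t. \<omega> t = d) g" and ?g' = "restrict_keys (\<lambda>t. \<omega> t \<noteq> d) g"
  have "f * g = f * ?g + f * ?g'"
    by (simp flip: distrib_left add: restrict_keys_compl)
  moreover have "restrict_keys (\<lambda>t. \<omega> t = e + d) (f * ?g) = f * ?g"
    by (rule restrict_keys_id) (auto elim!: keys_mult_elim simp: keys_restrict_keys \<omega> f)
  moreover have "restrict_keys (\<lambda>t. \<omega> t = e + d) (f * ?g') = 0"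
    by (rule restrict_keys_0) (auto elim!: keys_mult_elim simp: keys_restrict_keys \<omega> f)
  ultimately show ?thesis by (simp add: restrict_keys_add)
qed

lemma divide_monomial:
  assumes "\<And>t \<alpha>. t \<in> Poly_Mapping.keys f \<Longrightarrow> expo s \<alpha> \<le> expo t \<alpha>"
  obtains g where "f = monomial s * g"
proof -
  have t: "monomial t = monomial s * monomial (t - s)" if "t \<in> Poly_Mapping.keys f" for t
  proof -
    have "t = s + (t - s)"
      using assms[OF that] by (intro poly_mapping_eqI) (simp add: lookup_add lookup_minus)
    then show ?thesis by (simp add: mult_single)
  qed
  have "f = (\<Sum>t\<in>Poly_Mapping.keys f. Const (Poly_Mapping.lookup f t) * monomial t)" by (rule poly_expand)
  also have "\<dots> = (\<Sum>t\<in>Poly_Mapping.keys f. monomial s * (Const (Poly_Mapping.lookup f t) * monomial (t - s)))"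
    by (rule sum.cong) (simp_all only: t mult.left_commute)
  also have "\<dots> = monomial s * (\<Sum>t\<in>Poly_Mapping.keys f. Const (Poly_Mapping.lookup f t) * monomial (t - s))"
    by (rule sum_distrib_left[symmetric])
  finally show thesis by (rule that)
qed

section \<open>Irreducibility of the tangency forms\<close>

text \<open>A factor of degree 0 divides all three coefficients, and linear factors
  \<open>a X + b\<close> and \<open>a' X + b'\<close> make the discriminant the square of
  \<open>a b' - b a'\<close>. The argument works over any integral domain, so the coefficients may
  themselves be polynomials.\<close>

lemma irreducible_quadratic:
  fixes t0 t1 t2 :: "'a::idom"
  assumes "t2 \<noteq> 0"
    and content: "\<And>p. p dvd t0 \<Longrightarrow> p dvd t1 \<Longrightarrow> p dvd t2 \<Longrightarrow> p dvd 1"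
    and discriminant: "\<And>q. q\<^sup>2 \<noteq> t1\<^sup>2 - 4 * t0 * t2"
  shows "irreducible [:t0, t1, t2:]"
proof (rule irreducibleI)
  show "[:t0, t1, t2:] \<noteq> 0" using assms(1) by simp
  have deg: "degree [:t0, t1, t2:] = 2" using assms(1) by simp
  show "\<not> [:t0, t1, t2:] dvd 1"
    using deg by (auto simp: is_unit_poly_iff assms(1))
  have const: "f dvd 1" if fg: "[:t0, t1, t2:] = f * g" and "degree f = 0" for f g :: "'a poly"
  proof -
    obtain p where p: "f = [:p:]" using \<open>degree f = 0\<close> degree_eq_zeroE by blast
    have "[:p:] dvd [:t0, t1, t2:]" unfolding fg p by (rule dvd_triv_left)
    then have *: "p dvd coeff [:t0, t1, t2:] n" for n by (simp add: const_poly_dvd_iff)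
    have "p dvd 1" using *[of 0] *[of 1] *[of 2] by (intro content) (simp_all add: numeral_2_eq_2)
    then show ?thesis unfolding p by (simp add: is_unit_const_poly_iff)
  qed
  fix f g assume fg: "[:t0, t1, t2:] = f * g"
  have "f \<noteq> 0" "g \<noteq> 0" using fg assms(1) by auto
  then have "degree f + degree g = 2" using fg deg by (metis degree_mult_eq)
  then consider "degree f = 0" | "degree g = 0" | "degree f = 1" "degree g = 1" by linarith
  then show "f dvd 1 \<or> g dvd 1"
  proof cases
    case 3
    obtain b a where f: "f = [:b, a:]" using 3(1) degree1_coeffs by blast
    obtain b' a' where g: "g = [:b', a':]" using 3(2) degree1_coeffs by blast
    have "t0 = b * b'" "t1 = a * b' + b * a'" "t2 = a * a'"
      using fg unfolding f g by (simp_all add: algebra_simps)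
    then have "(a * b' - b * a')\<^sup>2 = t1\<^sup>2 - 4 * t0 * t2" by algebra
    then show ?thesis using discriminant by blast
  qed (use const[OF fg] const[of g f] fg in \<open>simp_all add: mult.commute\<close>)
qed

lemma degree_le_1_coeffs:
  assumes "degree p \<le> 1"
  obtains a b where "p = [:a, b:]"
proof
  show "p = [:coeff p 0, coeff p 1:]"
    using assms by (intro poly_eqI) (auto simp: coeff_pCons coeff_eq_0 split: nat.split)
qed

type_synonym cpoly4 = "complex poly poly poly poly"
type_synonym cpoly6 = "cpoly4 poly poly"

abbreviation const4 :: "complex \<Rightarrow> cpoly4" where
  "const4 c \<equiv> [:[:[:[:c:]:]:]:]"

text \<open>With \<open>u\<close>, \<open>\<sigma>\<close>, \<open>\<tau>\<close> the second, third and fourth variable from the inside, and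
  \<open>w\<close>, \<open>v\<close> the two outermost ones, this is
  \<open>n s\<^sup>2 + 2 k s w + \<rho> w\<^sup>2 + \<sigma>\<^sup>2 (\<rho> n - k\<^sup>2)\<close> for \<open>s = \<tau> - g1 \<sigma>\<close>, \<open>n = u\<^sup>2 + v\<^sup>2\<close>, \<open>k = g2 u + g3 v\<close>,
  \<open>\<rho> = g2\<^sup>2 + g3\<^sup>2 - r2\<close>.\<close>

definition nested_form :: "complex \<Rightarrow> complex \<Rightarrow> complex \<Rightarrow> complex \<Rightarrow> cpoly6" where
  "nested_form g1 g2 g3 r2 =
    (let u = [:[:[:0, 1:]:]:]; \<sigma> = [:[:0, 1:]:]; \<tau> = [:0, 1:]; s = \<tau> - const4 g1 * \<sigma> in
     [:[:u\<^sup>2 * s\<^sup>2 + const4 (g3\<^sup>2 - r2) * u\<^sup>2 * \<sigma>\<^sup>2, 2 * const4 g2 * u * s, const4 (g2\<^sup>2 + g3\<^sup>2 - r2):],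
       [:- 2 * const4 (g2 * g3) * u * \<sigma>\<^sup>2, 2 * const4 g3 * s:],
       [:s\<^sup>2 + const4 (g2\<^sup>2 - r2) * \<sigma>\<^sup>2:]:])"

text \<open>The form is regarded as a quadratic in \<open>v\<close>. If \<rho> is nonzero, it is a
  unit among the coefficients; otherwise \<open>s\<close> is eliminated to bound a common divisor.
  The discriminant is no square because at a suitable point it is a quadratic in \<open>w\<close>
  whose own discriminant is a nonzero multiple of \<open>r2\<close>.\<close>

lemma irreducible_nested_form:
  assumes "r2 \<noteq> 0"
  shows "irreducible (nested_form g1 g2 g3 r2)"
proof -
  define u :: cpoly4 where "u = [:[:[:0, 1:]:]:]"
  define \<sigma> :: cpoly4 where "\<sigma> = [:[:0, 1:]:]"
  define s :: cpoly4 where "s = [:0, 1:] - const4 g1 * \<sigma>"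
  define a where "a = s\<^sup>2 + const4 (g2\<^sup>2 - r2) * \<sigma>\<^sup>2"
  define b where "b = u\<^sup>2 * s\<^sup>2 + const4 (g3\<^sup>2 - r2) * u\<^sup>2 * \<sigma>\<^sup>2"
  define b1 where "b1 = 2 * const4 g2 * u * s"
  define b2 where "b2 = const4 (g2\<^sup>2 + g3\<^sup>2 - r2)"
  define d0 where "d0 = - 2 * const4 (g2 * g3) * u * \<sigma>\<^sup>2"
  define d1 where "d1 = 2 * const4 g3 * s"
  have form: "nested_form g1 g2 g3 r2 = [:[:b, b1, b2:], [:d0, d1:], [:a:]:]"
    unfolding nested_form_def Let_def a_def b_def b1_def b2_def d0_def d1_def s_def u_def \<sigma>_def ..
  have c2: "coeff a 2 = 1"
    unfolding a_def s_def \<sigma>_def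
    by (simp add: power2_eq_square numeral_2_eq_2 one_pCons)
  have a0: "a \<noteq> 0" using c2 by auto
  \<comment> \<open>\<open>a\<close> is monic in \<tau> and the other polynomial is constant in
    \<tau>, so a common divisor is free of \<tau> and divides the leading coefficient 1.\<close>
  have unit_if: "p dvd 1" if p: "p dvd a" "p dvd const4 c * u\<^sup>2 * \<sigma>\<^sup>2" "c \<noteq> 0" for p c
  proof -
    have "const4 c * u\<^sup>2 * \<sigma>\<^sup>2 \<noteq> 0" "degree (const4 c * u\<^sup>2 * \<sigma>\<^sup>2) = 0"
      using p(3) by (simp_all add: u_def \<sigma>_def power2_eq_square)
    then have "degree p = 0" using dvd_imp_degree_le[OF p(2)] by (metis le_zero_eq)
    then obtain p0 where p0: "p = [:p0:]" using degree_eq_zeroE by blast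
    have "p0 dvd coeff a 2" using p(1) unfolding p0 by (simp only: const_poly_dvd_iff)
    then show ?thesis unfolding c2 p0 by (simp add: is_unit_const_poly_iff)
  qed
  show ?thesis unfolding form
  proof (rule irreducible_quadratic)
    show "[:a:] \<noteq> 0" using a0 by simp
  next
    fix p assume p: "p dvd [:b, b1, b2:]" "p dvd [:d0, d1:]" "p dvd [:a:]"
    have "degree p = 0" using p(3) dvd_imp_degree_le[of p "[:a:]"] a0 by simp
    then obtain q where q: "p = [:q:]" using degree_eq_zeroE by blast
    have q1: "q dvd coeff [:b, b1, b2:] i" for i using p(1) unfolding q by (simp only: const_poly_dvd_iff)
    have q2: "q dvd coeff [:d0, d1:] i" for i using p(2) unfolding q by (simp only: const_poly_dvd_iff)
    have q3: "q dvd coeff [:a:] i" for i using p(3) unfolding q by (simp only: const_poly_dvd_iff)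
    have qs: "q dvd b" "q dvd b1" "q dvd b2" "q dvd d0" "q dvd d1" "q dvd a"
      using q1[of 0] q1[of 1] q1[of 2] q2[of 0] q2[of 1] q3[of 0] by (simp_all add: numeral_2_eq_2)
    have "q dvd 1"
    proof (cases "g2\<^sup>2 + g3\<^sup>2 - r2 = 0")
      case False
      then have "b2 dvd 1" unfolding b2_def by (simp add: is_unit_const_poly_iff dvd_field_iff)
      then show ?thesis using qs(3) dvd_trans by blast
    next
      case True
      have emb: "const4 (x * y) = const4 x * const4 y" "const4 (x + y) = const4 x + const4 y"
        "const4 (x - y) = const4 x - const4 y" "const4 (x\<^sup>2) = (const4 x)\<^sup>2"
        "const4 2 = 2" "const4 0 = 0" for x y
        by (simp_all add: power2_eq_square numeral_poly)
      have r2: "r2 = g2\<^sup>2 + g3\<^sup>2" using True by simp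
      define G2 G3 where "G2 = const4 g2" and "G3 = const4 g3"
      have e: "const4 (g2\<^sup>2 - r2) = - G3\<^sup>2" "const4 (g3\<^sup>2 - r2) = - G2\<^sup>2"
        unfolding r2 G2_def G3_def by (simp_all add: power2_eq_square)
      have "a = s\<^sup>2 - G3\<^sup>2 * \<sigma>\<^sup>2" "b = u\<^sup>2 * s\<^sup>2 - G2\<^sup>2 * u\<^sup>2 * \<sigma>\<^sup>2" "b1 = 2 * G2 * u * s" "d1 = 2 * G3 * s"
        unfolding a_def b_def b1_def d1_def e by (simp_all add: G2_def G3_def)
      \<comment> \<open>A combination of the coefficients in which \<open>s\<close> cancels; here
        \<open>G2\<^sup>2 + G3\<^sup>2\<close> is the constant \<open>r2\<close>, which is
        nonzero.\<close>
      then have "(G2\<^sup>2 + G3\<^sup>2)\<^sup>2 * u\<^sup>2 * \<sigma>\<^sup>2 =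
          G2 * u * s * b1 + G3 * u\<^sup>2 * s * d1 - (G2\<^sup>2 + G3\<^sup>2) * b - (G2\<^sup>2 + G3\<^sup>2) * u\<^sup>2 * a"
        by algebra
      moreover have "(G2\<^sup>2 + G3\<^sup>2)\<^sup>2 = const4 (r2\<^sup>2)"
        unfolding r2 G2_def G3_def by (simp only: emb)
      moreover have "q dvd G2 * u * s * b1 + G3 * u\<^sup>2 * s * d1 - (G2\<^sup>2 + G3\<^sup>2) * b - (G2\<^sup>2 + G3\<^sup>2) * u\<^sup>2 * a"
        using qs by (intro dvd_diff dvd_add dvd_mult) auto
      ultimately have "q dvd const4 (r2\<^sup>2) * u\<^sup>2 * \<sigma>\<^sup>2" by (simp only:)
      then show ?thesis using unit_if qs(6) assms by simp
    qed
    then show "p dvd 1" unfolding q by (simp add: is_unit_const_poly_iff)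
  next
    fix Q show "Q\<^sup>2 \<noteq> [:d0, d1:]\<^sup>2 - 4 * [:b, b1, b2:] * [:a:]"
    proof
      assume Q: "Q\<^sup>2 = [:d0, d1:]\<^sup>2 - 4 * [:b, b1, b2:] * [:a:]"
      \<comment> \<open>The point \<tau> = 1, \<sigma> = 0, u = 1, where also s = 1. There the
        discriminant becomes \<open>- 4 - 8 g2 w + 4 (r2 - g2\<^sup>2) w\<^sup>2\<close>, which is a
        square in \<open>w\<close> only for \<open>r2 = 0\<close>.\<close>
      define ev :: "cpoly4 \<Rightarrow> complex" where "ev f = poly (poly (poly (poly f 1) 0) 1) 0" for f
      interpret ev: ring_morphism ev by standard (simp_all add: ev_def)
      have rhs: "[:d0, d1:]\<^sup>2 - 4 * [:b, b1, b2:] * [:a:] = [:d0\<^sup>2 - 4 * a * b, 2 * d0 * d1 - 4 * a * b1, d1\<^sup>2 - 4 * a * b2:]"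
        by (simp add: power2_eq_square algebra_simps numeral_poly)
      have "degree (Q\<^sup>2) \<le> 2" unfolding Q rhs by (simp add: degree_pCons_le le_trans)
      then have "degree Q \<le> 1" by (cases "Q = 0") (simp_all add: power2_eq_square degree_mult_eq)
      then obtain q0 q1 where q: "Q = [:q0, q1:]"
        using degree_le_1_coeffs by blast
      have "q0\<^sup>2 = d0\<^sup>2 - 4 * a * b" "2 * q0 * q1 = 2 * d0 * d1 - 4 * a * b1" "q1\<^sup>2 = d1\<^sup>2 - 4 * a * b2"
        using Q unfolding rhs q by (simp_all add: power2_eq_square algebra_simps)
      then have "ev (q0\<^sup>2) = ev (d0\<^sup>2 - 4 * a * b)" "ev (2 * q0 * q1) = ev (2 * d0 * d1 - 4 * a * b1)"
        "ev (q1\<^sup>2) = ev (d1\<^sup>2 - 4 * a * b2)" by (simp_all only:)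
      then have eqs: "(ev q0)\<^sup>2 = (ev d0)\<^sup>2 - 4 * ev a * ev b"
        "2 * ev q0 * ev q1 = 2 * ev d0 * ev d1 - 4 * ev a * ev b1"
        "(ev q1)\<^sup>2 = (ev d1)\<^sup>2 - 4 * ev a * ev b2"
        by (simp_all only: ev.hom_simps)
      have ev0: "ev u = 1" "ev \<sigma> = 0" "ev (const4 c) = c" "ev [:0, 1:] = 1" for c
        by (simp_all add: ev_def u_def \<sigma>_def)
      have evs: "ev s = 1" by (simp add: s_def ev.hom_simps ev0 del: mult_pCons_left mult_pCons_right)
      have eva: "ev a = 1" "ev b = 1" "ev b1 = 2 * g2" "ev b2 = g2\<^sup>2 + g3\<^sup>2 - r2" "ev d0 = 0" "ev d1 = 2 * g3"
        unfolding a_def b_def b1_def b2_def d0_def d1_def by (simp_all only: ev.hom_simps ev0 evs) simp_all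
      have "(ev q0)\<^sup>2 = - 4" "2 * ev q0 * ev q1 = - 8 * g2" "(ev q1)\<^sup>2 = 4 * (r2 - g2\<^sup>2)"
        using eqs by (simp_all add: eva)
      then have "r2 = 0" by algebra
      then show False using assms by simp
    qed
  qed
qed

section \<open>The six-variable ring inside an iterated univariate polynomial ring\<close>

definition lift_poly :: "('a::comm_ring_1 \<Rightarrow> 'b::comm_ring_1) \<Rightarrow> 'b \<Rightarrow> 'a poly \<Rightarrow> 'b" where
  "lift_poly h t p = poly (map_poly h p) t"

context
  fixes h :: "'a::comm_ring_1 \<Rightarrow> 'b::comm_ring_1"
  assumes h: "ring_morphism h"
begin

interpretation h: ring_morphism h by (rule h)

lemma lift_poly_0: "lift_poly h t 0 = 0"
  by (simp add: lift_poly_def)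

lemma lift_poly_pCons: "lift_poly h t (pCons c p) = h c + t * lift_poly h t p"
  by (simp add: lift_poly_def map_poly_pCons h.zero)

lemma ring_morphism_lift_poly: "ring_morphism (lift_poly h t)"
proof
  show add: "lift_poly h t (p + q) = lift_poly h t p + lift_poly h t q" for p q
    by (induction p q rule: poly_induct2) (simp_all add: lift_poly_0 lift_poly_pCons h.add algebra_simps)
  have smult: "lift_poly h t (smult a q) = h a * lift_poly h t q" for a q
    by (induction q) (simp_all add: lift_poly_0 lift_poly_pCons h.mult algebra_simps)
  show "lift_poly h t (p * q) = lift_poly h t p * lift_poly h t q" for p q
    by (induction p) (simp_all add: lift_poly_0 lift_poly_pCons add smult h.zero algebra_simps)
  show "lift_poly h t 1 = 1"
    by (simp add: one_pCons lift_poly_pCons lift_poly_0 h.one)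
qed

end

definition const6 :: "complex \<Rightarrow> cpoly6" where
  "const6 c = [:[:const4 c:]:]"

text \<open>\<open>v\<close> is outermost and \<open>w\<close> next, so that a sphere form becomes a
  quadratic in \<open>v\<close> over polynomials in \<open>w\<close>; then comes \<tau>, in which
  its leading coefficient is monic.\<close>

fun var6 :: "plucker \<Rightarrow> cpoly6" where
  "var6 P34 = [:[:[:[:[:[:0, 1:]:]:]:]:]:]"
| "var6 P23 = [:[:[:[:[:0, 1:]:]:]:]:]"
| "var6 P13 = [:[:[:[:0, 1:]:]:]:]"
| "var6 P14 = [:[:[:0, 1:]:]:]"
| "var6 P12 = [:[:0, 1:]:]"
| "var6 P24 = [:0, 1:]"

definition to_nested :: "plucker_poly \<Rightarrow> cpoly6" where
  "to_nested = subst const6 var6"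

definition from_nested :: "cpoly6 \<Rightarrow> plucker_poly" where
  "from_nested = lift_poly (lift_poly (lift_poly (lift_poly (lift_poly (lift_poly Const
     (Var P34)) (Var P23)) (Var P13)) (Var P14)) (Var P12)) (Var P24)"

lemma ring_morphism_const6: "ring_morphism const6"
  by standard (simp_all add: const6_def one_pCons)

lemma ring_morphism_to_nested: "ring_morphism to_nested"
  unfolding to_nested_def by (rule ring_morphism_subst[OF ring_morphism_const6])

lemmas lift_morphisms = Const.ring_morphism_axioms ring_morphism_lift_poly

lemma ring_morphism_from_nested: "ring_morphism from_nested"
  unfolding from_nested_def by (intro lift_morphisms)

text \<open>The composite is a ring morphism that fixes constants and variables. This one-sided
  inverse is enough to pull zero products, divisibility and polynomial identities back from the
  nested ring.\<close>

lemma from_nested_to_nested: "from_nested (to_nested f) = f"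
proof (rule ring_morphism_plucker_poly_eqI[where f = "\<lambda>f. from_nested (to_nested f)" and g = "\<lambda>f. f"])
  show "ring_morphism (\<lambda>f. from_nested (to_nested f))"
    by (rule ring_morphism_comp[OF ring_morphism_to_nested ring_morphism_from_nested])
  note lift_simps = lift_poly_pCons[OF lift_morphisms(1)] lift_poly_pCons[OF ring_morphism_lift_poly]
    lift_poly_0[OF lift_morphisms(1)] lift_poly_0[OF ring_morphism_lift_poly] lift_morphisms
    ring_morphism.zero[OF ring_morphism_lift_poly] ring_morphism.one[OF ring_morphism_lift_poly]
    Const.zero Const.one
  show "from_nested (to_nested (Const c)) = Const c" for c
    by (simp add: to_nested_def subst_Const[OF ring_morphism_const6] const6_def from_nested_def lift_simps)
  show "from_nested (to_nested (Var \<alpha>)) = Var \<alpha>" for \<alpha>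
    by (cases \<alpha>) (simp_all add: to_nested_def subst_Var[OF ring_morphism_const6] from_nested_def lift_simps)
qed (rule ring_morphism_id)

interpretation to_nested: ring_morphism to_nested by (rule ring_morphism_to_nested)
interpretation from_nested: ring_morphism from_nested by (rule ring_morphism_from_nested)

lemma plucker_poly_no_zero_divisors:
  fixes f g :: plucker_poly
  assumes "f * g = 0"
  shows "f = 0 \<or> g = 0"
proof -
  have "to_nested f * to_nested g = 0" using assms by (simp flip: to_nested.mult add: to_nested.zero)
  then have "to_nested f = 0 \<or> to_nested g = 0" by simp
  then show ?thesis by (metis from_nested_to_nested from_nested.zero)
qed

lemma plucker_poly_mult_cancel:
  fixes f g h :: plucker_poly
  assumes "f * g = f * h" "f \<noteq> 0"
  shows "g = h"
  using plucker_poly_no_zero_divisors[of f "g - h"] assms by (simp add: algebra_simps)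

text \<open>With \<open>w, \<sigma>, \<tau>, u, v\<close> for the variables, the lines that meet the line through \<open>A\<close> and \<open>D\<close> are parametrised as
  \<open>w A \<and> D + (\<sigma> A + \<tau> D) \<and> (u U + v V)\<close>. For an orthonormal frame \<open>D, U, V\<close> of directions in which
  \<open>g\<close> is the vector from \<open>A\<close> to the centre of a sphere of squared radius \<open>r2\<close>, this is the tangency
  form in these parameters.\<close>

definition sphere_form :: "complex \<Rightarrow> complex \<Rightarrow> complex \<Rightarrow> complex \<Rightarrow> plucker_poly" where
  "sphere_form g1 g2 g3 r2 =
    (let w = Var P12; \<sigma> = Var P13; \<tau> = Var P14; u = Var P23; v = Var P24;
       s = \<tau> - Const g1 * \<sigma>; n = u\<^sup>2 + v\<^sup>2; k = Const g2 * u + Const g3 * v; \<rho> = Const (g2\<^sup>2 + g3\<^sup>2 - r2)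
     in n * s\<^sup>2 + 2 * k * s * w + \<rho> * w\<^sup>2 + \<sigma>\<^sup>2 * (\<rho> * n - k\<^sup>2))"

lemma to_nested_sphere_form: "to_nested (sphere_form g1 g2 g3 r2) = nested_form g1 g2 g3 r2"
proof -
  define e :: "cpoly4 \<Rightarrow> cpoly6" where "e x = [:[:x:]:]" for x
  interpret e: ring_morphism e by standard (simp_all add: e_def one_pCons)
  define K where "K c = const4 c" for c
  interpret K: ring_morphism K by standard (simp_all add: K_def one_pCons)
  define u :: cpoly4 where "u = [:[:[:0, 1:]:]:]"
  define \<sigma> :: cpoly4 where "\<sigma> = [:[:0, 1:]:]"
  define \<tau> :: cpoly4 where "\<tau> = [:0, 1:]"
  define v :: cpoly6 where "v = [:0, 1:]"
  define w :: cpoly6 where "w = [:[:0, 1:]:]"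
  have expand: "[:[:b0, b1, b2:], [:d0, d1:], [:a:]:] = e b0 + e b1 * w + e b2 * w\<^sup>2 + (e d0 + e d1 * w) * v + e a * v\<^sup>2"
    for b0 b1 b2 d0 d1 a
    by (simp add: e_def w_def v_def power2_eq_square)
  have vars: "to_nested (Var P12) = w" "to_nested (Var P13) = e \<sigma>" "to_nested (Var P14) = e \<tau>"
    "to_nested (Var P23) = e u" "to_nested (Var P24) = v" "to_nested (Const c) = e (K c)" for c
    by (simp_all add: to_nested_def subst_Var[OF ring_morphism_const6] subst_Const[OF ring_morphism_const6]
        const6_def e_def K_def u_def \<sigma>_def \<tau>_def v_def w_def)
  show ?thesis
    unfolding nested_form_def sphere_form_def Let_def u_def[symmetric] \<sigma>_def[symmetric] \<tau>_def[symmetric]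
      K_def[symmetric] expand
    by (simp add: to_nested.hom_simps vars e.hom_simps K.hom_simps power2_eq_square algebra_simps)
qed

text \<open>In the nested ring irreducible elements are prime, and the quotient found there is
  mapped back by \<open>from_nested\<close>.\<close>

lemma sphere_form_dvd_mult:
  assumes "r2 \<noteq> 0" "sphere_form g1 g2 g3 r2 dvd f * g"
  shows "sphere_form g1 g2 g3 r2 dvd f \<or> sphere_form g1 g2 g3 r2 dvd g"
proof -
  let ?T = "sphere_form g1 g2 g3 r2"
  have "prime_elem (to_nested ?T)"
    unfolding to_nested_sphere_form using irreducible_nested_form[OF assms(1)]
    by (simp only: prime_elem_iff_irreducible)
  moreover have "to_nested ?T dvd to_nested f * to_nested g"
    using assms(2) by (metis dvd_def to_nested.mult)
  ultimately have "to_nested ?T dvd to_nested f \<or> to_nested ?T dvd to_nested g"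
    by (rule prime_elem_dvd_multD)
  then show ?thesis
    by (metis dvd_def from_nested.mult from_nested_to_nested)
qed

section \<open>Weights and graded pieces\<close>

definition graded :: "((plucker \<Rightarrow>\<^sub>0 nat) \<Rightarrow> 'g) \<Rightarrow> 'g \<Rightarrow> plucker_poly set" where
  "graded \<omega> d = {f. \<forall>t\<in>Poly_Mapping.keys f. \<omega> t = d}"

lemma graded_zero: "0 \<in> graded \<omega> d"
  by (simp add: graded_def)

lemma graded_add: "f \<in> graded \<omega> d \<Longrightarrow> g \<in> graded \<omega> d \<Longrightarrow> f + g \<in> graded \<omega> d"
  using keys_add[of f g] by (auto simp: graded_def)

lemma graded_uminus: "f \<in> graded \<omega> d \<Longrightarrow> - f \<in> graded \<omega> d"
  by (simp add: graded_def in_keys_iff)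

lemma graded_diff: "f \<in> graded \<omega> d \<Longrightarrow> g \<in> graded \<omega> d \<Longrightarrow> f - g \<in> graded \<omega> d"
  using graded_add[OF _ graded_uminus, of f \<omega> d g] by simp

lemma graded_sum: "(\<And>x. x \<in> A \<Longrightarrow> f x \<in> graded \<omega> d) \<Longrightarrow> sum f A \<in> graded \<omega> d"
  by (induction A rule: infinite_finite_induct) (simp_all add: graded_zero graded_add)

lemma graded_monomial: "\<omega> t = d \<Longrightarrow> monomial t \<in> graded \<omega> d"
  by (simp add: graded_def)

lemma restrict_graded: "restrict_keys (\<lambda>t. \<omega> t = d) f \<in> graded \<omega> d"
  by (simp add: graded_def keys_restrict_keys)

lemma restrict_graded_id: "f \<in> graded \<omega> d \<Longrightarrow> restrict_keys (\<lambda>t. \<omega> t = d) f = f"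
  by (rule restrict_keys_id) (simp add: graded_def)

locale weight =
  fixes \<omega> :: "(plucker \<Rightarrow>\<^sub>0 nat) \<Rightarrow> 'g::cancel_comm_monoid_add"
  assumes weight_zero: "\<omega> 0 = 0"
    and weight_add: "\<omega> (s + t) = \<omega> s + \<omega> t"
begin

lemma graded_Const: "Const c \<in> graded \<omega> 0"
  by (simp add: graded_def Const_def weight_zero)

lemma graded_mult: "f \<in> graded \<omega> d \<Longrightarrow> g \<in> graded \<omega> e \<Longrightarrow> f * g \<in> graded \<omega> (d + e)"
  by (auto simp: graded_def weight_add elim!: keys_mult_elim)

lemma graded_mult_Const: "f \<in> graded \<omega> d \<Longrightarrow> Const c * f \<in> graded \<omega> d"
  using graded_mult[OF graded_Const] by fastforce

lemma graded_power2: "f \<in> graded \<omega> d \<Longrightarrow> f\<^sup>2 \<in> graded \<omega> (d + d)"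
  by (simp add: power2_eq_square graded_mult)

lemma restrict_graded_mult:
  assumes "f \<in> graded \<omega> e"
  shows "restrict_keys (\<lambda>t. \<omega> t = e + d) (f * g) = f * restrict_keys (\<lambda>t. \<omega> t = d) g"
  using assms by (intro restrict_keys_mult) (auto simp: weight_add graded_def)

end

definition total_degree :: "(plucker \<Rightarrow>\<^sub>0 nat) \<Rightarrow> nat" where
  "total_degree t = (\<Sum>\<alpha>\<in>UNIV. expo t \<alpha>)"

lemma sum_plucker: "sum f UNIV = f P12 + f P13 + f P14 + f P23 + f P24 + f P34"
  by (simp add: UNIV_plucker add.assoc)

lemma homogeneous_part_eq_graded: "homogeneous_part d = graded total_degree d"
  by (simp add: homogeneous_part_def graded_def total_degree_def)

interpretation total_degree: weight total_degree
  by standard (simp_all add: total_degree_def lookup_add sum.distrib)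

text \<open>The degrees in \<open>(w, \<sigma>, \<tau>)\<close>, in \<open>(w, u, v)\<close>, and in the sixth variable, which no parametrised form
  involves.\<close>

definition tridegree :: "(plucker \<Rightarrow>\<^sub>0 nat) \<Rightarrow> nat \<times> nat \<times> nat" where
  "tridegree t = (expo t P12 + expo t P13 + expo t P14, expo t P12 + expo t P23 + expo t P24, expo t P34)"

interpretation tridegree: weight tridegree
  by standard (simp_all add: tridegree_def lookup_add zero_prod_def)

abbreviation balanced :: "nat \<Rightarrow> plucker_poly set" where
  "balanced d \<equiv> graded tridegree (d, d, 0)"

lemma balanced_mult: "f \<in> balanced d \<Longrightarrow> g \<in> balanced e \<Longrightarrow> f * g \<in> balanced (d + e)"
  using tridegree.graded_mult[of f "(d, d, 0)" g "(e, e, 0)"] by simp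

lemma sphere_form_balanced: "sphere_form g1 g2 g3 r2 \<in> balanced 2"
proof -
  have vars: "Var P12 \<in> graded tridegree (1, 1, 0)" "Var P13 \<in> graded tridegree (1, 0, 0)"
    "Var P14 \<in> graded tridegree (1, 0, 0)" "Var P23 \<in> graded tridegree (0, 1, 0)"
    "Var P24 \<in> graded tridegree (0, 1, 0)"
    by (simp_all add: graded_def Var_def tridegree_def lookup_single)
  note rules = graded_add graded_diff tridegree.graded_mult_Const
  have s: "Var P14 - Const g1 * Var P13 \<in> graded tridegree (1, 0, 0)"
    by (intro rules vars)
  have n: "(Var P23)\<^sup>2 + (Var P24)\<^sup>2 \<in> graded tridegree (0, 2, 0)"
    using tridegree.graded_power2[OF vars(4)] tridegree.graded_power2[OF vars(5)]
    by (simp add: graded_add numeral_2_eq_2)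
  have k: "Const g2 * Var P23 + Const g3 * Var P24 \<in> graded tridegree (0, 1, 0)"
    by (intro rules vars)
  have k2: "(Const g2 * Var P23 + Const g3 * Var P24)\<^sup>2 \<in> graded tridegree (0, 2, 0)"
    using tridegree.graded_power2[OF k] by (simp add: numeral_2_eq_2)
  have "((Var P23)\<^sup>2 + (Var P24)\<^sup>2) * (Var P14 - Const g1 * Var P13)\<^sup>2 \<in> balanced 2"
    using tridegree.graded_mult[OF n tridegree.graded_power2[OF s]] by (simp add: numeral_2_eq_2)
  moreover have "2 * (Const g2 * Var P23 + Const g3 * Var P24) * (Var P14 - Const g1 * Var P13) * Var P12 \<in> balanced 2"
    using tridegree.graded_mult_Const[OF tridegree.graded_mult[OF tridegree.graded_mult[OF k s] vars(1)], of 2]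
    by (simp add: numeral_2_eq_2 Const.numeral mult.assoc del: distrib_left_numeral)
  moreover have "Const (g2\<^sup>2 + g3\<^sup>2 - r2) * (Var P12)\<^sup>2 \<in> balanced 2"
    using tridegree.graded_mult_Const[OF tridegree.graded_power2[OF vars(1)]] by (simp add: numeral_2_eq_2)
  moreover have "(Var P13)\<^sup>2 * (Const (g2\<^sup>2 + g3\<^sup>2 - r2) * ((Var P23)\<^sup>2 + (Var P24)\<^sup>2)
      - (Const g2 * Var P23 + Const g3 * Var P24)\<^sup>2) \<in> balanced 2"
    using tridegree.graded_mult[OF tridegree.graded_power2[OF vars(2)] graded_diff[OF tridegree.graded_mult_Const[OF n] k2]]
    by (simp add: numeral_2_eq_2)
  ultimately show ?thesis
    unfolding sphere_form_def Let_def by (intro graded_add)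
qed

lemma value_sphere_form:
  "subst (\<lambda>c. c) p (sphere_form g1 g2 g3 r2) =
    ((p P23)\<^sup>2 + (p P24)\<^sup>2) * (p P14 - g1 * p P13)\<^sup>2
    + 2 * (g2 * p P23 + g3 * p P24) * (p P14 - g1 * p P13) * p P12 + (g2\<^sup>2 + g3\<^sup>2 - r2) * (p P12)\<^sup>2
    + (p P13)\<^sup>2 * ((g2\<^sup>2 + g3\<^sup>2 - r2) * ((p P23)\<^sup>2 + (p P24)\<^sup>2) - (g2 * p P23 + g3 * p P24)\<^sup>2)"
proof -
  interpret ring_morphism "subst (\<lambda>c. c) p" by (intro ring_morphism_subst ring_morphism_id)
  show ?thesis
    unfolding sphere_form_def Let_def
    by (simp add: hom_simps subst_Var[OF ring_morphism_id] subst_Const[OF ring_morphism_id])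
qed

text \<open>Evaluation at points with coordinates 0, 1 and -1 isolates the coefficients; opposite
  values of \<open>w\<close> separate the terms linear in \<open>w\<close>. Concentric spheres are a
  genuine exception: for a fixed centre the form is affine in the squared radius, so they combine to
  further spheres.\<close>

lemma sphere_form_combination:
  assumes "sphere_form g1 g2 g3 r = Const a * sphere_form h1 h2 h3 s + Const b * sphere_form k1 k2 k3 t"
  shows "a + b = 1"
    and "b = 0 \<and> g1 = h1 \<and> g2 = h2 \<and> g3 = h3 \<and> r = s \<or> a = 0 \<and> g1 = k1 \<and> g2 = k2 \<and> g3 = k3 \<and> r = t \<or>
         h1 = k1 \<and> h2 = k2 \<and> h3 = k3"
proof -
  define val where "val w \<sigma> \<tau> u v g1 g2 g3 r2 =
    (u\<^sup>2 + v\<^sup>2) * (\<tau> - g1 * \<sigma>)\<^sup>2 + 2 * (g2 * u + g3 * v) * (\<tau> - g1 * \<sigma>) * w + (g2\<^sup>2 + g3\<^sup>2 - r2) * w\<^sup>2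
    + \<sigma>\<^sup>2 * ((g2\<^sup>2 + g3\<^sup>2 - r2) * (u\<^sup>2 + v\<^sup>2) - (g2 * u + g3 * v)\<^sup>2)"
    for w \<sigma> \<tau> u v g1 g2 g3 r2 :: complex
  have v: "val w \<sigma> \<tau> u v g1 g2 g3 r = a * val w \<sigma> \<tau> u v h1 h2 h3 s + b * val w \<sigma> \<tau> u v k1 k2 k3 t" for w \<sigma> \<tau> u v
  proof -
    define p where "p \<alpha> = (case \<alpha> of P12 \<Rightarrow> w | P13 \<Rightarrow> \<sigma> | P14 \<Rightarrow> \<tau> | P23 \<Rightarrow> u | P24 \<Rightarrow> v | P34 \<Rightarrow> 0)" for \<alpha>
    interpret ring_morphism "subst (\<lambda>c. c) p" by (intro ring_morphism_subst ring_morphism_id)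
    have "subst (\<lambda>c. c) p (sphere_form g1 g2 g3 r) =
        a * subst (\<lambda>c. c) p (sphere_form h1 h2 h3 s) + b * subst (\<lambda>c. c) p (sphere_form k1 k2 k3 t)"
      unfolding assms by (simp add: hom_simps subst_Const[OF ring_morphism_id])
    then show ?thesis by (simp add: value_sphere_form p_def val_def)
  qed
  note expand = val_def power2_eq_square
  show ab: "a + b = 1" using v[of 0 0 1 1 0] by (simp add: expand)
  have g1: "g1 = a * h1 + b * k1"
    using v[of 0 1 1 1 0, unfolded val_def, simplified] v[of 0 1 0 1 0, unfolded val_def, simplified] ab by algebra
  have g2: "g2 = a * h2 + b * k2"
    using v[of 1 0 1 1 0, unfolded val_def, simplified] v[of "- 1" 0 1 1 0, unfolded val_def, simplified] ab by algebra
  have g3: "g3 = a * h3 + b * k3"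
    using v[of 1 0 1 0 1, unfolded val_def, simplified] v[of "- 1" 0 1 0 1, unfolded val_def, simplified] ab by algebra
  have rho: "g2\<^sup>2 + g3\<^sup>2 - r = a * (h2\<^sup>2 + h3\<^sup>2 - s) + b * (k2\<^sup>2 + k3\<^sup>2 - t)"
    using v[of 1 0 0 0 0, unfolded val_def, simplified] by (simp add: power2_eq_square)
  \<comment> \<open>Together with the mixed products below, these differences give the matrix of
    products of the centre coordinates up to a multiple of the identity.\<close>
  have q: "g1\<^sup>2 - g2\<^sup>2 = a * (h1\<^sup>2 - h2\<^sup>2) + b * (k1\<^sup>2 - k2\<^sup>2)"
    "g1\<^sup>2 - g3\<^sup>2 = a * (h1\<^sup>2 - h3\<^sup>2) + b * (k1\<^sup>2 - k3\<^sup>2)"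
    using v[of 0 1 0 1 0, unfolded val_def, simplified] v[of 0 1 0 0 1, unfolded val_def, simplified] rho by algebra+
  have q23: "g2 * g3 = a * (h2 * h3) + b * (k2 * k3)"
    using v[of 0 1 0 1 1, unfolded val_def, simplified] v[of 0 1 0 1 0, unfolded val_def, simplified] v[of 0 1 0 0 1, unfolded val_def, simplified] by algebra
  have q12: "g1 * g2 = a * (h1 * h2) + b * (k1 * k2)"
    using v[of 1 1 0 1 0, unfolded val_def, simplified] v[of "- 1" 1 0 1 0, unfolded val_def, simplified] by algebra
  have q13: "g1 * g3 = a * (h1 * h3) + b * (k1 * k3)"
    using v[of 1 1 0 0 1, unfolded val_def, simplified] v[of "- 1" 1 0 0 1, unfolded val_def, simplified] by algebra
  text \<open>The centre is an affine combination, so these are the entries of a rank one matrix that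
    has to be a multiple of the identity.\<close>
  have "a * b * ((h1 - k1)\<^sup>2 - (h2 - k2)\<^sup>2) = 0" "a * b * ((h1 - k1)\<^sup>2 - (h3 - k3)\<^sup>2) = 0"
    "a * b * ((h2 - k2) * (h3 - k3)) = 0" "a * b * ((h1 - k1) * (h2 - k2)) = 0"
    "a * b * ((h1 - k1) * (h3 - k3)) = 0"
    using q q23 q12 q13 ab unfolding g1 g2 g3 by algebra+
  \<comment> \<open>If \<open>a * b\<close> is nonzero, the vanishing products kill two of the three
    coordinate differences, and equality of the squares kills the third.\<close>
  then consider "a = 0" | "b = 0" | "h1 = k1 \<and> h2 = k2 \<and> h3 = k3"
    by fastforce
  then show "b = 0 \<and> g1 = h1 \<and> g2 = h2 \<and> g3 = h3 \<and> r = s \<or> a = 0 \<and> g1 = k1 \<and> g2 = k2 \<and> g3 = k3 \<and> r = t \<or>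
         h1 = k1 \<and> h2 = k2 \<and> h3 = k3"
    using ab g1 g2 g3 rho by cases auto
qed

lemma sphere_form_eq_iff:
  "sphere_form g1 g2 g3 r = sphere_form h1 h2 h3 s \<longleftrightarrow> g1 = h1 \<and> g2 = h2 \<and> g3 = h3 \<and> r = s"
proof
  assume "sphere_form g1 g2 g3 r = sphere_form h1 h2 h3 s"
  \<comment> \<open>The second centre is shifted to exclude the concentric alternative; its
    coefficient is 0.\<close>
  then have "sphere_form g1 g2 g3 r = Const 1 * sphere_form h1 h2 h3 s + Const 0 * sphere_form (h1 + 1) h2 h3 s"
    by (simp add: Const.one Const.zero)
  from sphere_form_combination(2)[OF this]
  show "g1 = h1 \<and> g2 = h2 \<and> g3 = h3 \<and> r = s" by simp
qed simp

section \<open>Two sphere forms generate a saturated ideal\<close>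

lemma balanced_0_Const:
  assumes "f \<in> balanced 0"
  obtains c where "f = Const c"
proof
  have "t = 0" if "t \<in> Poly_Mapping.keys f" for t
  proof (rule poly_mapping_eqI)
    show "expo t \<alpha> = expo 0 \<alpha>" for \<alpha>
      using that assms by (cases \<alpha>) (auto simp: graded_def tridegree_def)
  qed
  then show "f = Const (Poly_Mapping.lookup f 0)"
    unfolding Const_def
    by (intro poly_mapping_eqI) (auto simp: lookup_single when_def in_keys_iff)
qed

text \<open>A vanishing form would be a combination of sphere forms with coefficients 0 and 0, but
  the coefficients sum to 1.\<close>

lemma sphere_form_nonzero: "sphere_form g1 g2 g3 r2 \<noteq> 0"
proof
  assume "sphere_form g1 g2 g3 r2 = 0"
  then have "sphere_form g1 g2 g3 r2 = Const 0 * sphere_form g1 g2 g3 r2 + Const 0 * sphere_form g1 g2 g3 r2"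
    by (simp add: Const.zero)
  from sphere_form_combination(1)[OF this] show False by simp
qed

text \<open>Both forms are balanced of degree 2, so the quotient can be replaced by its component of
  degree 0, a constant. Comparing the terms \<open>\<tau>\<^sup>2 u\<^sup>2\<close> shows that it is
  1.\<close>

lemma sphere_form_dvd_sphere_form:
  assumes "sphere_form g1 g2 g3 r dvd sphere_form h1 h2 h3 s"
  shows "sphere_form g1 g2 g3 r = sphere_form h1 h2 h3 s"
proof -
  obtain q where q: "sphere_form h1 h2 h3 s = sphere_form g1 g2 g3 r * q" using assms by (rule dvdE)
  define q0 where "q0 = restrict_keys (\<lambda>t. tridegree t = (0, 0, 0)) q"
  have "restrict_keys (\<lambda>t. tridegree t = (2, 2, 0) + (0, 0, 0)) (sphere_form g1 g2 g3 r * q) = sphere_form g1 g2 g3 r * q0"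
    unfolding q0_def by (rule tridegree.restrict_graded_mult[OF sphere_form_balanced])
  then have "sphere_form h1 h2 h3 s = sphere_form g1 g2 g3 r * q0"
    using restrict_graded_id[OF sphere_form_balanced[of h1 h2 h3 s]] by (simp add: q)
  moreover have "q0 \<in> balanced 0"
    unfolding q0_def by (rule restrict_graded)
  then obtain c where "q0 = Const c" by (rule balanced_0_Const)
  ultimately have h: "sphere_form h1 h2 h3 s = Const c * sphere_form g1 g2 g3 r" by (simp add: mult.commute)
  then have "sphere_form h1 h2 h3 s = Const c * sphere_form g1 g2 g3 r + Const 0 * sphere_form g1 g2 g3 r"
    by (simp add: Const.zero)
  from sphere_form_combination(1)[OF this] h show ?thesis by (simp add: Const.one)
qed

section \<open>Leading monomials and a monomial ideal\<close>

lemma Var_power: "Var \<alpha> ^ N = monomial (Poly_Mapping.single \<alpha> N)"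
  by (induction N) (simp_all add: Var_def mult_single flip: single_add)

lemma lookup_monomial_mult: "Poly_Mapping.lookup (monomial s * f) (s + t) = Poly_Mapping.lookup f t"
  by (induction f rule: plucker_poly_induct)
    (simp_all add: distrib_left lookup_add lookup_single mult_single when_def flip: single_eq_Const_monomial)

lemma keys_diffD: "t \<in> Poly_Mapping.keys (f - g) \<Longrightarrow> t \<in> Poly_Mapping.keys f \<or> t \<in> Poly_Mapping.keys (g :: plucker_poly)"
  by (auto simp: in_keys_iff lookup_minus)

text \<open>Only the degree in \<tau> and \<open>u\<close> is bounded, the two variables of the
  leading monomial; neither occurs in the generators of the monomial ideal below.\<close>

definition filtered :: "nat \<Rightarrow> plucker_poly set" where
  "filtered n = {f. \<forall>t\<in>Poly_Mapping.keys f. expo t P14 + expo t P23 \<le> n}"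

lemma filtered_add: "f \<in> filtered n \<Longrightarrow> g \<in> filtered n \<Longrightarrow> f + g \<in> filtered n"
  using keys_add[of f g] by (auto simp: filtered_def)

lemma filtered_diff: "f \<in> filtered n \<Longrightarrow> g \<in> filtered n \<Longrightarrow> f - g \<in> filtered n"
  unfolding filtered_def by (blast dest: keys_diffD)

lemma filtered_mult: "f \<in> filtered m \<Longrightarrow> g \<in> filtered n \<Longrightarrow> f * g \<in> filtered (m + n)"
  unfolding filtered_def
proof (intro CollectI ballI)
  fix t assume fg: "f \<in> {f. \<forall>t\<in>Poly_Mapping.keys f. expo t P14 + expo t P23 \<le> m}"
    "g \<in> {f. \<forall>t\<in>Poly_Mapping.keys f. expo t P14 + expo t P23 \<le> n}" and "t \<in> Poly_Mapping.keys (f * g)"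
  from this(3) obtain a b where t: "t = a + b" and ab: "a \<in> Poly_Mapping.keys f" "b \<in> Poly_Mapping.keys g"
    by (rule keys_mult_elim)
  have "expo a P14 + expo a P23 \<le> m" "expo b P14 + expo b P23 \<le> n" using fg ab by auto
  then show "expo t P14 + expo t P23 \<le> m + n" by (simp add: t lookup_add)
qed

lemma filtered_mono: "f \<in> filtered m \<Longrightarrow> m \<le> n \<Longrightarrow> f \<in> filtered n"
  unfolding filtered_def by (blast intro: order_trans)

lemma filtered_Const: "Const c \<in> filtered 0"
  by (simp add: filtered_def Const_def)

lemma filtered_Var:
  "Var P12 \<in> filtered 0" "Var P13 \<in> filtered 0" "Var P14 \<in> filtered 1" "Var P23 \<in> filtered 1" "Var P24 \<in> filtered 0"
  by (simp_all add: filtered_def Var_def lookup_single)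

lemma sphere_form_leading_term: "sphere_form g1 g2 g3 r2 - (Var P14)\<^sup>2 * (Var P23)\<^sup>2 \<in> filtered 3"
proof -
  define w \<sigma> \<tau> u v where vars: "w = Var P12" "\<sigma> = Var P13" "\<tau> = Var P14" "u = Var P23" "v = Var P24"
  define s k where sk: "s = \<tau> - Const g1 * \<sigma>" "k = Const g2 * u + Const g3 * v"
  have F0: "Const c * p \<in> filtered n" if "p \<in> filtered n" for c n p
    using filtered_mult[OF filtered_Const that] by simp
  have V: "w \<in> filtered 0" "\<sigma> \<in> filtered 0" "\<tau> \<in> filtered 1" "u \<in> filtered 1" "v \<in> filtered 0"
    unfolding vars by (rule filtered_Var)+
  have V1: "\<sigma> \<in> filtered 1" "v \<in> filtered 1" using V filtered_mono by auto
  have s: "s \<in> filtered 1" unfolding sk by (intro filtered_diff F0 V V1)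
  have k: "k \<in> filtered 1" unfolding sk by (intro filtered_add F0 V V1)
  have F: "p * q \<in> filtered l" if "p \<in> filtered m" "q \<in> filtered n" "m + n \<le> l" for p q m n l
    using filtered_mult[OF that(1,2)] that(3) filtered_mono by blast
  \<comment> \<open>After the leading term is removed,
    \<open>u\<^sup>2 (s\<^sup>2 - \<tau>\<^sup>2)\<close> is rewritten with a factor \<sigma>, so
    that the bound 3 can be read off each summand.\<close>
  have expand: "(u\<^sup>2 + v\<^sup>2) * (t - G * z)\<^sup>2 + 2 * k * (t - G * z) * w + R * w\<^sup>2 + z\<^sup>2 * (R * (u\<^sup>2 + v\<^sup>2) - k\<^sup>2) - t\<^sup>2 * u\<^sup>2
      = v * v * ((t - G * z) * (t - G * z)) + u * u * (z * (G * G * z - 2 * G * t)) + 2 * (k * ((t - G * z) * w))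
        + R * (w * w) + z * z * (R * (u * u + v * v) - k * k)"
    for u v t z G k w R :: plucker_poly
    by (simp add: algebra_simps power2_eq_square)
  have "sphere_form g1 g2 g3 r2 - \<tau>\<^sup>2 * u\<^sup>2 =
      v * v * (s * s) + u * u * (\<sigma> * (Const (g1 * g1) * \<sigma> - Const (2 * g1) * \<tau>)) + Const 2 * (k * (s * w))
      + Const (g2\<^sup>2 + g3\<^sup>2 - r2) * (w * w) + \<sigma> * \<sigma> * (Const (g2\<^sup>2 + g3\<^sup>2 - r2) * (u * u + v * v) - k * k)"
    unfolding sphere_form_def Let_def vars[symmetric] sk(1) sk(2)[symmetric] Const.mult Const.numeral
    using expand by simp
  also have "\<dots> \<in> filtered 3"
  proof (intro filtered_add F0)
    show "v * v * (s * s) \<in> filtered 3"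
      by (rule F[OF F[OF V(5) V(5) order.refl] F[OF s s order.refl]]) simp
    have "Const (g1 * g1) * \<sigma> - Const (2 * g1) * \<tau> \<in> filtered 1"
      by (intro filtered_diff F0 V V1)
    then show "u * u * (\<sigma> * (Const (g1 * g1) * \<sigma> - Const (2 * g1) * \<tau>)) \<in> filtered 3"
      by (rule F[OF F[OF V(4) V(4) order.refl] F[OF V(2) _ order.refl]]) simp
    show "k * (s * w) \<in> filtered 3"
      by (rule F[OF k F[OF s V(1) order.refl]]) simp
    show "w * w \<in> filtered 3"
      by (rule F[OF V(1) V(1)]) simp
    have "Const (g2\<^sup>2 + g3\<^sup>2 - r2) * (u * u + v * v) - k * k \<in> filtered 2"
      by (intro filtered_diff F0 filtered_add) (rule F[OF V(4) V(4)] F[OF V1(2) V1(2)] F[OF k k]; simp)+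
    then show "\<sigma> * \<sigma> * (Const (g2\<^sup>2 + g3\<^sup>2 - r2) * (u * u + v * v) - k * k) \<in> filtered 3"
      by (rule F[OF F[OF V(2) V(2) order.refl]]) simp
  qed
  finally show ?thesis unfolding vars .
qed

text \<open>The ideal generated by \<open>w\<^sup>N\<close> and \<open>(\<sigma> v)\<^sup>N\<close>,
  described term by term so that terms inside it can simply be discarded.\<close>

definition monomial_ideal :: "nat \<Rightarrow> plucker_poly set" where
  "monomial_ideal N = {f. \<forall>t\<in>Poly_Mapping.keys f. N \<le> expo t P12 \<or> N \<le> expo t P13 \<and> N \<le> expo t P24}"

lemma monomial_ideal_diff: "f \<in> monomial_ideal N \<Longrightarrow> g \<in> monomial_ideal N \<Longrightarrow> f - g \<in> monomial_ideal N"
  unfolding monomial_ideal_def by (blast dest: keys_diffD)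

lemma monomial_ideal_mult: "g \<in> monomial_ideal N \<Longrightarrow> f * g \<in> monomial_ideal N"
  unfolding monomial_ideal_def
proof (intro CollectI ballI)
  let ?J = "\<lambda>t. N \<le> expo t P12 \<or> N \<le> expo t P13 \<and> N \<le> expo t P24"
  fix t assume g: "g \<in> {f. \<forall>t\<in>Poly_Mapping.keys f. ?J t}" and "t \<in> Poly_Mapping.keys (f * g)"
  from this(2) obtain a b where "t = a + b" "b \<in> Poly_Mapping.keys g" by (rule keys_mult_elim)
  then show "?J t" using g by (auto simp: lookup_add)
qed

text \<open>A top component of \<open>k\<close> outside the ideal would be multiplied by the leading monomial
  \<open>\<tau>\<^sup>2 u\<^sup>2\<close>, which involves none of the variables in the ideal.\<close>

lemma sphere_form_nonzerodivisor_mod_monomial_ideal: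
  assumes "sphere_form g1 g2 g3 r2 * k \<in> monomial_ideal N"
  shows "k \<in> monomial_ideal N"
proof (rule ccontr)
  assume not: "k \<notin> monomial_ideal N"
  let ?T = "sphere_form g1 g2 g3 r2"
  define J where "J t \<longleftrightarrow> N \<le> expo t P12 \<or> N \<le> expo t P13 \<and> N \<le> expo t P24" for t
  define lev :: "(plucker \<Rightarrow>\<^sub>0 nat) \<Rightarrow> nat" where "lev t = expo t P14 + expo t P23" for t
  interpret lev: weight lev by standard (simp_all add: lev_def lookup_add)
  \<comment> \<open>All terms of \<open>k\<close> that lie in the ideal are dropped, so any single
    surviving term that is forced into the ideal gives a contradiction.\<close>
  define k' where "k' = restrict_keys (\<lambda>t. \<not> J t) k"
  have "k - k' = restrict_keys J k" using restrict_keys_compl[of J k] by (simp add: k'_def algebra_simps)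
  then have "k - k' \<in> monomial_ideal N" by (simp add: monomial_ideal_def keys_restrict_keys J_def)
  then have "?T * k - ?T * (k - k') \<in> monomial_ideal N"
    by (intro monomial_ideal_diff[OF assms] monomial_ideal_mult)
  then have Tk': "?T * k' \<in> monomial_ideal N" by (simp add: right_diff_distrib)
  have "Poly_Mapping.keys k' \<noteq> {}"
    using not by (auto simp: k'_def keys_restrict_keys monomial_ideal_def J_def)
  define m where "m = Max (lev ` Poly_Mapping.keys k')"
  have "m \<in> lev ` Poly_Mapping.keys k'" unfolding m_def using \<open>Poly_Mapping.keys k' \<noteq> {}\<close> by (intro Max_in) auto
  then obtain t where t: "t \<in> Poly_Mapping.keys k'" "lev t = m" by auto
  have m: "lev t' \<le> m" if "t' \<in> Poly_Mapping.keys k'" for t' unfolding m_def using that by (intro Max_ge) auto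
  define s where "s = Poly_Mapping.single P14 2 + Poly_Mapping.single P23 (2::nat)"
  have lead: "(Var P14)\<^sup>2 * (Var P23)\<^sup>2 = monomial s"
    by (simp add: s_def Var_power mult_single)
  define L where "L = ?T - monomial s"
  have L: "L \<in> filtered 3" using sphere_form_leading_term unfolding L_def lead by blast
  \<comment> \<open>The level of \<open>s + t\<close> is \<open>4 + m\<close>, whereas terms of
    \<open>L * k'\<close> have level at most \<open>3 + m\<close>.\<close>
  have "s + t \<notin> Poly_Mapping.keys (L * k')"
  proof
    assume "s + t \<in> Poly_Mapping.keys (L * k')"
    then obtain a b where ab: "s + t = a + b" "a \<in> Poly_Mapping.keys L" "b \<in> Poly_Mapping.keys k'"
      by (rule keys_mult_elim)
    have "lev s + lev t = lev a + lev b" using ab(1) by (metis lev.weight_add)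
    moreover have "lev a \<le> 3" using L ab(2) by (simp add: filtered_def lev_def)
    moreover have "lev s = 4" by (simp add: lev_def s_def lookup_add lookup_single)
    ultimately show False using m[OF ab(3)] t(2) by simp
  qed
  then have "Poly_Mapping.lookup (?T * k') (s + t) = Poly_Mapping.lookup (monomial s * k') (s + t)"
    using L_def by (simp add: algebra_simps lookup_minus in_keys_iff)
  then have "s + t \<in> Poly_Mapping.keys (?T * k')"
    using t(1) by (simp add: lookup_monomial_mult in_keys_iff)
  then have "J (s + t)" using Tk' by (auto simp: monomial_ideal_def J_def)
  then have "J t" by (simp add: J_def s_def lookup_add lookup_single)
  then show False using t(1) by (simp add: k'_def keys_restrict_keys)
qed

lemma monomial_ideal_iff:
  "f \<in> monomial_ideal N \<longleftrightarrow> (\<exists>g h. f = Var P12 ^ N * g + (Var P13 * Var P24) ^ N * h)"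
proof -
  define x where "x = Poly_Mapping.single P12 N"
  define y where "y = Poly_Mapping.single P13 N + Poly_Mapping.single P24 N"
  have xy: "Var P12 ^ N = monomial x" "(Var P13 * Var P24) ^ N = monomial y"
    by (simp_all add: Var_power power_mult_distrib mult_single x_def y_def)
  have x: "expo x \<alpha> \<le> expo t \<alpha>" if "N \<le> expo t P12" for t \<alpha>
    using that by (simp add: x_def lookup_single when_def)
  have y: "expo y \<alpha> \<le> expo t \<alpha>" if "N \<le> expo t P13" "N \<le> expo t P24" for t \<alpha>
    using that by (simp add: y_def lookup_add lookup_single when_def)
  show ?thesis unfolding xy
  proof
    assume f: "f \<in> monomial_ideal N"
    let ?P = "\<lambda>t. N \<le> expo t P12"
    obtain g where g: "restrict_keys ?P f = monomial x * g"
      by (rule divide_monomial[of "restrict_keys ?P f" x]) (simp add: keys_restrict_keys x)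
    have "expo y \<alpha> \<le> expo t \<alpha>" if "t \<in> Poly_Mapping.keys (restrict_keys (\<lambda>t. \<not> ?P t) f)" for t \<alpha>
    proof (rule y)
      show "N \<le> expo t P13" "N \<le> expo t P24"
        using f that by (auto simp: monomial_ideal_def keys_restrict_keys)
    qed
    then obtain h where h: "restrict_keys (\<lambda>t. \<not> ?P t) f = monomial y * h"
      by (rule divide_monomial)
    show "\<exists>g h. f = monomial x * g + monomial y * h"
      using restrict_keys_compl[of ?P f] g h by metis
  next
    assume "\<exists>g h. f = monomial x * g + monomial y * h"
    then obtain g h where f: "f = monomial x * g + monomial y * h" by blast
    show "f \<in> monomial_ideal N"
      unfolding monomial_ideal_def
    proof (intro CollectI ballI)
      fix t assume "t \<in> Poly_Mapping.keys f"
      then consider "t \<in> Poly_Mapping.keys (monomial x * g)" | "t \<in> Poly_Mapping.keys (monomial y * h)"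
        unfolding f using keys_add[of "monomial x * g" "monomial y * h"] by blast
      then show "N \<le> expo t P12 \<or> N \<le> expo t P13 \<and> N \<le> expo t P24"
      proof cases
        case 1
        then obtain b where "t = x + b" by (rule keys_mult_elim) simp
        then show ?thesis by (simp add: x_def lookup_add)
      next
        case 2
        then obtain b where "t = y + b" by (rule keys_mult_elim) simp
        then show ?thesis by (simp add: y_def lookup_add)
      qed
    qed
  qed
qed

text \<open>\<open>(\<sigma> v)\<^sup>N\<close> contributes no \<open>w\<close>, so every term of
  \<open>g\<close> must itself carry the factor \<open>w\<^sup>N\<close>.\<close>

lemma coprime_monomials:
  assumes "Var P12 ^ N * f = (Var P13 * Var P24) ^ N * g"
  obtains h where "g = Var P12 ^ N * h"
proof -
  define x where "x = Poly_Mapping.single P12 N"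
  define y where "y = Poly_Mapping.single P13 N + Poly_Mapping.single P24 N"
  have xy: "Var P12 ^ N = monomial x" "(Var P13 * Var P24) ^ N = monomial y"
    by (simp_all add: Var_power power_mult_distrib mult_single x_def y_def)
  have "expo x \<alpha> \<le> expo t \<alpha>" if "t \<in> Poly_Mapping.keys g" for t \<alpha>
  proof -
    have "y + t \<in> Poly_Mapping.keys (monomial x * f)"
      using that assms unfolding xy by (simp add: in_keys_iff lookup_monomial_mult)
    then obtain b where "y + t = x + b" by (rule keys_mult_elim) simp
    then have "expo y P12 + expo t P12 = expo x P12 + expo b P12" by (metis lookup_add)
    then show ?thesis by (simp add: x_def y_def lookup_add lookup_single when_def)
  qed
  then obtain h where "g = monomial x * h" by (rule divide_monomial)
  then show thesis using that by (simp add: xy)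
qed

text \<open>The Koszul relations of the regular sequence formed by the two forms, combined with those of
  \<open>x = w\<^sup>N\<close> and \<open>y = (\<sigma> v)\<^sup>N\<close>, express \<open>f\<close> through the two forms.\<close>

lemma sphere_forms_saturated:
  fixes f :: plucker_poly
  defines "x N \<equiv> Var P12 ^ N" and "y N \<equiv> (Var P13 * Var P24) ^ N"
  assumes T: "T1 = sphere_form g1 g2 g3 r" "T2 = sphere_form h1 h2 h3 s" "T1 \<noteq> T2" "s \<noteq> 0"
    and x: "x N * f = T1 * a1 + T2 * b1" and y: "y N * f = T1 * a2 + T2 * b2"
  shows "\<exists>a b. f = T1 * a + T2 * b"
proof -
  let ?x = "x N" and ?y = "y N"
  have "?x * (T1 * a2 + T2 * b2) = ?y * (T1 * a1 + T2 * b1)"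
    unfolding x[symmetric] y[symmetric] by (simp add: ac_simps)
  then have rel: "T1 * (?x * a2 - ?y * a1) = T2 * (?y * b1 - ?x * b2)"
    by (simp add: algebra_simps)
  have "T2 dvd T1 * (?x * a2 - ?y * a1)" unfolding rel by simp
  moreover have "\<not> T2 dvd T1" using T sphere_form_dvd_sphere_form by metis
  ultimately have "T2 dvd ?x * a2 - ?y * a1" using sphere_form_dvd_mult[OF T(4)] T(2) by blast
  then obtain k where k: "?x * a2 - ?y * a1 = T2 * k" by (rule dvdE)
  have "T2 \<noteq> 0" unfolding T(2) by (rule sphere_form_nonzero)
  moreover have "T2 * (?y * b1 - ?x * b2) = T2 * (T1 * k)" using rel unfolding k by (simp add: ac_simps)
  ultimately have k': "?y * b1 - ?x * b2 = T1 * k" by (rule plucker_poly_mult_cancel[rotated])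
  have "T2 * k = Var P12 ^ N * a2 + (Var P13 * Var P24) ^ N * (- a1)" unfolding k[symmetric] x_def y_def by simp
  then have "T2 * k \<in> monomial_ideal N" unfolding monomial_ideal_iff by blast
  then have "k \<in> monomial_ideal N" unfolding T(2) by (rule sphere_form_nonzerodivisor_mod_monomial_ideal)
  then obtain k1 k2 where k12: "k = ?x * k1 + ?y * k2" unfolding monomial_ideal_iff x_def y_def by blast
  \<comment> \<open>Correcting \<open>a1\<close> and \<open>b1\<close> by multiples of
    \<open>k2\<close> leaves \<open>T1 * a1 + T2 * b1\<close> unchanged and makes both coefficients
    divisible by \<open>x N\<close>, which then cancels.\<close>
  have "?x * (a2 - T2 * k1) = ?y * (a1 + T2 * k2)" using k unfolding k12 by (simp add: algebra_simps)
  then obtain j where j: "a1 + T2 * k2 = ?x * j" unfolding x_def y_def by (rule coprime_monomials)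
  have "?x * (b2 + T1 * k1) = ?y * (b1 - T1 * k2)" using k' unfolding k12 by (simp add: algebra_simps)
  then obtain j' where j': "b1 - T1 * k2 = ?x * j'" unfolding x_def y_def by (rule coprime_monomials)
  have "?x * f = T1 * (a1 + T2 * k2) + T2 * (b1 - T1 * k2)" unfolding x by (simp add: algebra_simps)
  then have "?x * f = ?x * (T1 * j + T2 * j')" unfolding j j' by (simp add: algebra_simps)
  moreover have "?x \<noteq> 0" unfolding x_def Var_power by (metis lookup_single_eq lookup_zero zero_neq_one)
  ultimately have "f = T1 * j + T2 * j'" by (rule plucker_poly_mult_cancel)
  then show ?thesis by blast
qed

section \<open>Dimension counts\<close>

context vector_space
begin

lemma independent_span_disjoint:
  assumes "independent D" "C \<subseteq> D" "x \<in> span C" "x \<in> span (D - C)"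
  shows "x = 0"
proof -
  have *: "representation D x = representation C x"
    by (rule representation_extend[OF assms(1,3,2)])
  have **: "representation D x = representation (D - C) x"
    by (rule representation_extend[OF assms(1,4)]) auto
  have "representation D x b = 0" for b
  proof (rule ccontr)
    assume b: "representation D x b \<noteq> 0"
    have "b \<in> C" using b unfolding * by (rule representation_ne_zero)
    moreover have "b \<in> D - C" using b unfolding ** by (rule representation_ne_zero)
    ultimately show False by simp
  qed
  moreover have "x \<in> span D" using span_mono[OF assms(2)] assms(3) by (rule subsetD)
  ultimately show ?thesis
    using sum_nonzero_representation_eq[OF assms(1), of x] by simp
qed

text \<open>The polynomial ring is infinite-dimensional, so finiteness is imposed on
  \<open>V\<close> through the finite spanning set \<open>F\<close>. A basis of the kernel is
  extended to a basis of \<open>V\<close>, and \<open>f\<close> is injective on the span of the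
  added vectors.\<close>

lemma rank_nullity:
  assumes f: "Vector_Spaces.linear scale scale f" and V: "subspace V" "V \<subseteq> span F" "finite F"
  shows "dim V = dim (f ` V) + dim {x \<in> V. f x = 0}"
proof -
  interpret f: Vector_Spaces.linear scale scale f by (rule f)
  interpret vector_space_pair scale scale by unfold_locales
  let ?K = "{x \<in> V. f x = 0}"
  obtain C where C: "C \<subseteq> ?K" "independent C" "?K \<subseteq> span C" "card C = dim ?K"
    by (rule basis_exists)
  have "C \<subseteq> V" using C(1) by auto
  then obtain D where D: "C \<subseteq> D" "D \<subseteq> V" "independent D" "V \<subseteq> span D"
    using maximal_independent_subset_extend[OF _ C(2)] by blast
  have "finite D"
    using independent_span_bound[OF V(3) D(3)] D(2) V(2) by blast
  have inj: "inj_on f (span (D - C))"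
  proof (rule inj_onI)
    fix x y assume xy: "x \<in> span (D - C)" "y \<in> span (D - C)" "f x = f y"
    then have diff: "x - y \<in> span (D - C)" "f (x - y) = 0"
      by (simp_all add: span_diff f.diff)
    moreover have "span (D - C) \<subseteq> V"
      using D(2) by (intro span_minimal V) auto
    ultimately have "x - y \<in> span C" using C(3) by blast
    then have "x - y = 0" by (rule independent_span_disjoint[OF D(3,1) _ diff(1)])
    then show "x = y" by simp
  qed
  have "independent (D - C)" by (rule independent_mono[OF D(3)]) auto
  then have "independent (f ` (D - C))"
    using inj by (rule f.independent_injective_image)
  moreover have "span (f ` (D - C)) = span (f ` V)"
  proof (rule antisym)
    show "span (f ` (D - C)) \<subseteq> span (f ` V)" using D(2) by (intro span_mono) auto
    have "f x \<in> span (f ` (D - C))" if "x \<in> D" for x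
      using that C(1) span_zero by (cases "x \<in> C") (auto intro: span_base)
    then have "span (f ` D) \<subseteq> span (f ` (D - C))"
      by (intro span_minimal) auto
    moreover have "f ` V \<subseteq> span (f ` D)"
      using image_mono[OF D(4), of f] by (simp add: f.span_image)
    ultimately show "span (f ` V) \<subseteq> span (f ` (D - C))" by (intro span_minimal) auto
  qed
  ultimately have "dim (f ` V) = card (f ` (D - C))"
    by (metis dim_span dim_eq_card_independent)
  also have "\<dots> = card (D - C)"
    using inj span_superset inj_on_subset by (intro card_image) blast
  finally have "dim (f ` V) = card D - card C"
    using \<open>finite D\<close> D(1) by (simp add: card_Diff_subset finite_subset)
  moreover have "card C \<le> card D" using \<open>finite D\<close> D(1) by (rule card_mono)
  ultimately show ?thesis using basis_card_eq_dim[OF D(2,4,3)] C(4) by simp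
qed

text \<open>Rank-nullity for a projection that kills \<open>U\<close>, on the sum and on \<open>V\<close>.\<close>

lemma dim_subspace_sum:
  assumes U: "subspace U" and V: "subspace V" and F: "U \<subseteq> span F" "V \<subseteq> span F" "finite F"
  shows "dim {x + y |x y. x \<in> U \<and> y \<in> V} + dim (U \<inter> V) = dim U + dim V"
proof -
  define S where "S = {x + y |x y. x \<in> U \<and> y \<in> V}"
  interpret vector_space_pair scale scale by unfold_locales
  have S: "subspace S" unfolding S_def by (rule subspace_sums[OF U V])
  have SF: "S \<subseteq> span F" unfolding S_def using F by (auto intro: span_add)
  have US: "U \<subseteq> S" unfolding S_def using subspace_0[OF V] by force
  have VS: "V \<subseteq> S" unfolding S_def using subspace_0[OF U] by force
  obtain C where C: "C \<subseteq> U" "independent C" "U \<subseteq> span C" by (rule basis_exists)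
  have "C \<subseteq> S" using C(1) US by (rule subset_trans)
  then obtain D where D: "C \<subseteq> D" "D \<subseteq> S" "independent D" "S \<subseteq> span D"
    by (rule maximal_independent_subset_extend[OF _ C(2)])
  obtain f where f: "Vector_Spaces.linear scale scale f \<and> (\<forall>x\<in>D. f x = (if x \<in> C then 0 else x))"
    using linear_independent_extend[OF D(3), of "\<lambda>x. if x \<in> C then 0 else x"] by (elim exE) (rule that)
  note f = conjunct1[OF f] bspec[OF conjunct2[OF f]]
  interpret f: Vector_Spaces.linear scale scale f by (rule f(1))
  have fC: "f x = 0" if "x \<in> span C" for x
    using that by (induction rule: span_induct_alt) (use f(2) D(1) in \<open>auto simp: f.add f.scale f.zero\<close>)
  have fD: "f x = x" if "x \<in> span (D - C)" for x
    using that by (induction rule: span_induct_alt) (use f(2) in \<open>auto simp: f.add f.scale f.zero\<close>)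
  have ker: "f x = 0 \<longleftrightarrow> x \<in> U" if "x \<in> S" for x
  proof
    assume "f x = 0"
    have "x \<in> span (C \<union> (D - C))" using that D(1,4) by (auto simp: Un_absorb1)
    then obtain y z where yz: "x = y + z" "y \<in> span C" "z \<in> span (D - C)"
      unfolding span_Un by (elim CollectE exE conjE) (rule that)
    then have "z = 0" using \<open>f x = 0\<close> by (simp add: f.add fC fD)
    then show "x \<in> U" using yz span_minimal[OF C(1) U] by auto
  qed (use C(3) fC in auto)
  have "f ` S = f ` V"
  proof
    show "f ` S \<subseteq> f ` V"
    proof
      fix z assume "z \<in> f ` S"
      then obtain x y where "z = f (x + y)" "x \<in> U" "y \<in> V" unfolding S_def by blast
      then show "z \<in> f ` V" using ker[of x] US by (auto simp: f.add)
    qed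
  qed (use VS in auto)
  moreover have "{x \<in> S. f x = 0} = U" using ker US by auto
  moreover have "{x \<in> V. f x = 0} = U \<inter> V" using ker VS by auto
  ultimately show ?thesis
    using rank_nullity[OF f(1) S SF F(3)] rank_nullity[OF f(1) V F(2,3)] unfolding S_def by simp
qed

lemma dim_zero_space: "dim {0} = 0"
  using dim_eq_card_independent[OF independent_empty] dim_span[of "{}"] by simp

end

section \<open>Counting monomials\<close>

definition exponent :: "(plucker \<Rightarrow> nat) \<Rightarrow> plucker \<Rightarrow>\<^sub>0 nat" where
  "exponent g = Poly_Mapping.Abs_poly_mapping g"

lemma expo_exponent [simp]: "expo (exponent g) = g"
  by (simp add: exponent_def)

lemma exponent_expo [simp]: "exponent (expo t) = t"
  by (rule poly_mapping_eqI) simp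

lemma finite_bounded_exponents: "finite {t. \<forall>\<alpha>. expo t \<alpha> \<le> d}"
proof (rule finite_surj)
  show "finite (PiE (UNIV :: plucker set) (\<lambda>_. {..d}))" by (intro finite_PiE) simp_all
  show "{t. \<forall>\<alpha>. expo t \<alpha> \<le> d} \<subseteq> exponent ` PiE UNIV (\<lambda>_. {..d})"
  proof
    fix t assume "t \<in> {t. \<forall>\<alpha>. expo t \<alpha> \<le> d}"
    then have "expo t \<in> PiE UNIV (\<lambda>_. {..d})" by auto
    then show "t \<in> exponent ` PiE UNIV (\<lambda>_. {..d})" by (metis exponent_expo image_eqI)
  qed
qed

lemma subspace_graded: "poly_vs.subspace (graded \<omega> d)"
  by (intro poly_vs.subspaceI) (auto simp: graded_zero graded_add, auto simp: graded_def in_keys_iff lookup_Const_mult)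

lemma graded_subset_span: "graded \<omega> d \<subseteq> poly_vs.span (monomial ` {t. \<omega> t = d})"
proof
  fix f assume "f \<in> graded \<omega> d"
  then have "(\<Sum>t\<in>Poly_Mapping.keys f. Const (Poly_Mapping.lookup f t) * monomial t) \<in> poly_vs.span (monomial ` {t. \<omega> t = d})"
    by (intro poly_vs.span_sum poly_vs.span_scale poly_vs.span_base) (auto simp: graded_def)
  then show "f \<in> poly_vs.span (monomial ` {t. \<omega> t = d})" by (subst poly_expand)
qed

lemma inj_monomial: "inj monomial"
  by (rule injI) (metis keys_single singleton_inject zero_neq_one)

lemma dim_graded:
  assumes "finite {t. \<omega> t = d}"
  shows "poly_vs.dim (graded \<omega> d) = card {t. \<omega> t = d}"
proof (rule poly_vs.dim_unique)
  let ?K = "{t. \<omega> t = d}"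
  show "monomial ` ?K \<subseteq> graded \<omega> d" by (auto simp: graded_def)
  show "graded \<omega> d \<subseteq> poly_vs.span (monomial ` ?K)" by (rule graded_subset_span)
  show "card (monomial ` ?K) = card ?K"
    using inj_monomial by (intro card_image) (auto intro: inj_on_subset)
  show "\<not> poly_vs.dependent (monomial ` ?K)"
  proof (rule poly_vs.independent_if_scalars_zero)
    fix c x assume sum: "(\<Sum>x\<in>monomial ` ?K. Const (c x) * x) = 0" and "x \<in> monomial ` ?K"
    then obtain t where t: "t \<in> ?K" "x = monomial t" by auto
    have "(\<Sum>s\<in>?K. Const (c (monomial s)) * monomial s) = 0"
      using sum by (subst (asm) sum.reindex) (use inj_monomial in \<open>auto intro: inj_on_subset\<close>)
    from arg_cong[OF this, of "\<lambda>f. Poly_Mapping.lookup f t"]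
    have "(\<Sum>s\<in>?K. Poly_Mapping.lookup (Const (c (monomial s)) * monomial s) t) = 0"
      by (simp only: lookup_sum lookup_zero)
    moreover have "(\<Sum>s\<in>?K. Poly_Mapping.lookup (Const (c (monomial s)) * monomial s) t) = (\<Sum>s\<in>?K. if s = t then c x else 0)"
      by (rule sum.cong) (auto simp: lookup_Const_mult lookup_single when_def t(2))
    ultimately show "c x = 0" using t(1) assms by simp
  qed (use assms in auto)
qed

text \<open>Here \<open>d - n\<close> is the exponent of \<open>w\<close>; then \<sigma>, \<tau>
  share the degree \<open>n\<close> in \<open>n + 1\<close> ways, and so do \<open>u\<close>,
  \<open>v\<close>.\<close>

definition balanced_dim :: "nat \<Rightarrow> nat" where
  "balanced_dim d = (\<Sum>n\<le>d. (n + 1)\<^sup>2)"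

lemma finite_tridegree: "finite {t. tridegree t = (d, d, 0)}"
proof (rule finite_subset[OF _ finite_bounded_exponents[of d]], clarify)
  fix t \<alpha> assume "tridegree t = (d, d, 0)"
  then show "expo t \<alpha> \<le> d" by (cases \<alpha>) (auto simp: tridegree_def)
qed

lemma finite_total_degree: "finite {t. total_degree t = d}"
proof (rule finite_subset[OF _ finite_bounded_exponents[of d]], clarify)
  fix t \<alpha> show "expo t \<alpha> \<le> total_degree t"
    unfolding total_degree_def by (rule member_le_sum) auto
qed

lemma card_tridegree: "card {t. tridegree t = (d, d, 0)} = balanced_dim d"
proof -
  define h :: "nat \<times> nat \<times> nat \<Rightarrow> plucker \<Rightarrow>\<^sub>0 nat" where
    "h = (\<lambda>(n, i, k). exponent (\<lambda>\<alpha>. case \<alpha> of P12 \<Rightarrow> d - n | P13 \<Rightarrow> i | P14 \<Rightarrow> n - i | P23 \<Rightarrow> k | P24 \<Rightarrow> n - k | P34 \<Rightarrow> 0))"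
  define A where "A = (SIGMA n:{..d}. {..n} \<times> {..n})"
  have "bij_betw h A {t. tridegree t = (d, d, 0)}"
  proof (rule bij_betw_byWitness[where f' = "\<lambda>t. (d - expo t P12, expo t P13, expo t P23)"])
    show "\<forall>a\<in>A. (d - expo (h a) P12, expo (h a) P13, expo (h a) P23) = a"
      by (auto simp: A_def h_def)
    show "\<forall>t\<in>{t. tridegree t = (d, d, 0)}. h (d - expo t P12, expo t P13, expo t P23) = t"
    proof clarify
      fix t assume t: "tridegree t = (d, d, 0)"
      show "h (d - expo t P12, expo t P13, expo t P23) = t"
      proof (rule poly_mapping_eqI)
        fix \<alpha> show "expo (h (d - expo t P12, expo t P13, expo t P23)) \<alpha> = expo t \<alpha>"
          using t by (cases \<alpha>) (auto simp: h_def tridegree_def)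
      qed
    qed
    show "h ` A \<subseteq> {t. tridegree t = (d, d, 0)}"
      by (auto simp: A_def h_def tridegree_def)
    show "(\<lambda>t. (d - expo t P12, expo t P13, expo t P23)) ` {t. tridegree t = (d, d, 0)} \<subseteq> A"
      by (auto simp: A_def tridegree_def)
  qed
  then have "card {t. tridegree t = (d, d, 0)} = card A" by (simp add: bij_betw_same_card)
  also have "\<dots> = balanced_dim d" by (simp add: A_def balanced_dim_def power2_eq_square)
  finally show ?thesis .
qed

lemma dim_balanced: "poly_vs.dim (balanced d) = balanced_dim d"
  using dim_graded[OF finite_tridegree] card_tridegree by metis

lemma linear_mult: "Vector_Spaces.linear (\<lambda>c f. Const c * f) (\<lambda>c f. Const c * f) ((*) T)"
  unfolding Vector_Spaces.linear_iff using poly_vs.vector_space_axioms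
  by (auto simp: distrib_left mult.left_commute)

lemma dim_mult_balanced:
  assumes "T \<noteq> 0"
  shows "poly_vs.dim ((*) T ` balanced d) = balanced_dim d"
proof -
  have "{x \<in> balanced d. T * x = 0} = {0}"
    using assms by (auto simp: graded_zero dest: plucker_poly_no_zero_divisors)
  then show ?thesis
    using poly_vs.rank_nullity[OF linear_mult subspace_graded graded_subset_span, of tridegree "(d, d, 0)" T]
    by (simp add: finite_tridegree dim_balanced poly_vs.dim_zero_space)
qed

text \<open>The index is the degree of the coefficients: for sphere forms the elements lie in degree
  \<open>d + 2\<close>, and \<open>d = 0\<close> gives the linear pencil spanned by the two
  forms.\<close>

definition pencil :: "plucker_poly \<Rightarrow> plucker_poly \<Rightarrow> nat \<Rightarrow> plucker_poly set" where
  "pencil T1 T2 d = {T1 * a + T2 * b |a b. a \<in> balanced d \<and> b \<in> balanced d}"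

text \<open>The component of \<open>T * k\<close> in the given degree is \<open>T\<close> times a
  component of \<open>k\<close>; cancelling \<open>T\<close> identifies \<open>k\<close> with that
  component.\<close>

lemma balanced_quotient:
  assumes "T \<in> balanced m" "T * k \<in> balanced (m + d)" "T \<noteq> 0"
  shows "k \<in> balanced d"
proof -
  have "T * k = restrict_keys (\<lambda>t. tridegree t = (m + d, m + d, 0)) (T * k)"
    using restrict_graded_id[OF assms(2)] by simp
  also have "\<dots> = T * restrict_keys (\<lambda>t. tridegree t = (d, d, 0)) k"
    using tridegree.restrict_graded_mult[OF assms(1), of "(d, d, 0)" k] by simp
  finally have "k = restrict_keys (\<lambda>t. tridegree t = (d, d, 0)) k"
    using assms(3) by (rule plucker_poly_mult_cancel)
  then show ?thesis using restrict_graded[of tridegree "(d, d, 0)" k] by simp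
qed

text \<open>The multiples of \<open>T1\<close> and those of \<open>T2\<close> intersect in the
  multiples of \<open>T1 * T2\<close>, because \<open>T2\<close> is prime and does not divide
  \<open>T1\<close>. The term \<open>balanced_dim d\<close> accounts for this intersection.\<close>

lemma dim_pencil:
  assumes T: "T1 = sphere_form g1 g2 g3 r" "T2 = sphere_form h1 h2 h3 s" "T1 \<noteq> T2" "s \<noteq> 0"
  shows "poly_vs.dim (pencil T1 T2 (d + 2)) + balanced_dim d = 2 * balanced_dim (d + 2)"
proof -
  let ?B = "balanced (d + 2)"
  have nz: "T1 \<noteq> 0" "T2 \<noteq> 0" unfolding T by (rule sphere_form_nonzero)+
  have T2: "T1 \<in> balanced 2" "T2 \<in> balanced 2" unfolding T by (rule sphere_form_balanced)+
  have int: "(*) T1 ` ?B \<inter> (*) T2 ` ?B = (*) (T1 * T2) ` balanced d"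
  proof
    show "(*) T1 ` ?B \<inter> (*) T2 ` ?B \<subseteq> (*) (T1 * T2) ` balanced d"
    proof
      fix f assume "f \<in> (*) T1 ` ?B \<inter> (*) T2 ` ?B"
      then obtain a b where f: "f = T1 * a" "a \<in> ?B" "T1 * a = T2 * b" by auto
      have "T2 dvd T1 * a" unfolding f(3) by simp
      moreover have "\<not> T2 dvd T1" using T sphere_form_dvd_sphere_form by metis
      ultimately have "T2 dvd a" using sphere_form_dvd_mult[OF T(4)] T(2) by blast
      then obtain k where k: "a = T2 * k" by (rule dvdE)
      have "T2 * k \<in> balanced (2 + d)" using f(2) k by (simp add: add.commute)
      then have "k \<in> balanced d" using balanced_quotient[OF T2(2) _ nz(2)] by blast
      then show "f \<in> (*) (T1 * T2) ` balanced d" using f(1) k by (auto simp: mult.assoc)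
    qed
    show "(*) (T1 * T2) ` balanced d \<subseteq> (*) T1 ` ?B \<inter> (*) T2 ` ?B"
    proof
      fix f assume "f \<in> (*) (T1 * T2) ` balanced d"
      then obtain k where k: "k \<in> balanced d" "f = T1 * T2 * k" by auto
      have "T2 * k \<in> ?B" "T1 * k \<in> ?B" using balanced_mult[OF T2(1) k(1)] balanced_mult[OF T2(2) k(1)]
        by (simp_all add: add.commute)
      moreover have "f = T1 * (T2 * k)" "f = T2 * (T1 * k)" using k(2) by (simp_all add: ac_simps)
      ultimately show "f \<in> (*) T1 ` ?B \<inter> (*) T2 ` ?B" by blast
    qed
  qed
  have sub: "poly_vs.subspace ((*) T ` ?B)" for T
  proof -
    interpret vector_space_pair "\<lambda>c f. Const c * f" "\<lambda>c f. Const c * f" by unfold_locales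
    show ?thesis by (rule linear_subspace_image[OF linear_mult subspace_graded])
  qed
  have span: "(*) T ` ?B \<subseteq> poly_vs.span (monomial ` {t. tridegree t = (d + 4, d + 4, 0)})" if "T \<in> balanced 2" for T
  proof -
    have "2 + (d + 2) = d + 4" by simp
    then have "T * x \<in> balanced (d + 4)" if "x \<in> ?B" for x
      using balanced_mult[OF \<open>T \<in> balanced 2\<close> that] by (simp only:)
    then have "(*) T ` ?B \<subseteq> balanced (d + 4)" by (rule image_subsetI)
    then show ?thesis using graded_subset_span by (rule subset_trans)
  qed
  have nz12: "T1 * T2 \<noteq> 0" using plucker_poly_no_zero_divisors[of T1 T2] nz by blast
  have "pencil T1 T2 (d + 2) = {x + y |x y. x \<in> (*) T1 ` ?B \<and> y \<in> (*) T2 ` ?B}"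
    unfolding pencil_def by blast
  then show ?thesis
    using poly_vs.dim_subspace_sum[OF sub sub span[OF T2(1)] span[OF T2(2)]]
    by (simp only: finite_tridegree finite_imageI int dim_mult_balanced nz nz12 not_False_eq_True)
qed

lemma balanced_dim_Suc: "balanced_dim (Suc d) = balanced_dim d + (d + 2)\<^sup>2"
  by (simp add: balanced_dim_def)

text \<open>\<open>balanced_dim\<close> is a cubic with leading coefficient 1/3, so its second
  difference with step 2 is linear with slope 8. The value is
  \<open>8 * (d + 4) - 4\<close>.\<close>

lemma dim_balanced_mod_pencil:
  assumes "T1 = sphere_form g1 g2 g3 r" "T2 = sphere_form h1 h2 h3 s" "T1 \<noteq> T2" "s \<noteq> 0"
  shows "balanced_dim (d + 4) - poly_vs.dim (pencil T1 T2 (d + 2)) = 8 * d + 28"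
    and "poly_vs.dim (pencil T1 T2 (d + 2)) \<le> balanced_dim (d + 4)"
proof -
  have "balanced_dim (d + 4) + balanced_dim d = 2 * balanced_dim (d + 2) + (8 * d + 28)"
    by (simp add: numeral_eq_Suc balanced_dim_Suc power2_eq_square algebra_simps)
  then show "balanced_dim (d + 4) - poly_vs.dim (pencil T1 T2 (d + 2)) = 8 * d + 28"
    "poly_vs.dim (pencil T1 T2 (d + 2)) \<le> balanced_dim (d + 4)"
    using dim_pencil[OF assms, of d] by linarith+
qed

section \<open>The lines meeting a line in projective coordinates\<close>

interpretation ideal: module "(*) :: plucker_poly \<Rightarrow> plucker_poly \<Rightarrow> plucker_poly"
  by standard (auto simp: algebra_simps)

lemma ideal_generated_eq_span: "ideal_generated = ideal.span"
  unfolding ideal_generated_def ..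

lemma ideal_power_diff:
  assumes "a - b \<in> ideal.span G"
  shows "a ^ n - b ^ n \<in> ideal.span G"
proof (induction n)
  case (Suc n)
  have "a ^ Suc n - b ^ Suc n = a * (a ^ n - b ^ n) + b ^ n * (a - b)"
    by (simp add: algebra_simps)
  then show ?case using Suc assms by (simp add: ideal.span_add ideal.span_scale)
qed (simp add: ideal.span_zero)

lemma total_degree_power:
  "f \<in> graded total_degree d \<Longrightarrow> f ^ n \<in> graded total_degree (n * d)"
  using total_degree.graded_Const[of 1]
  by (induction n) (simp_all add: Const.one total_degree.graded_mult)

lemma total_degree_prod:
  "(\<And>x. x \<in> A \<Longrightarrow> f x \<in> graded total_degree (n x)) \<Longrightarrow> prod f A \<in> graded total_degree (sum n A)"
  using total_degree.graded_Const[of 1]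
  by (induction A rule: infinite_finite_induct) (simp_all add: Const.one total_degree.graded_mult)

lemma Var_homogeneous: "Var \<alpha> \<in> graded total_degree 1"
  by (simp add: graded_def Var_def total_degree_def lookup_single when_def)

lemma tangency_form_homogeneous: "tangency_form Q \<in> homogeneous_part 2"
  unfolding homogeneous_part_eq_graded tangency_form_def
  using total_degree.graded_mult[OF total_degree.graded_mult_Const[OF Var_homogeneous] Var_homogeneous]
  by (intro graded_sum) (simp add: numeral_2_eq_2)

section \<open>The Segre parametrisation of the hyperplane section\<close>

fun segre :: "plucker \<Rightarrow> plucker_poly" where
  "segre P12 = Var P12"
| "segre P13 = Var P13 * Var P23"
| "segre P14 = Var P13 * Var P24"
| "segre P23 = Var P14 * Var P23"
| "segre P24 = Var P14 * Var P24"
| "segre P34 = 0"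

text \<open>The substituted values are the Pluecker coordinates of
  \<open>w A \<and> D + (\<sigma> A + \<tau> D) \<and> (u U + v V)\<close> when \<open>A\<close>,
  \<open>D\<close>, \<open>U\<close>, \<open>V\<close> are the coordinate points; lines meeting
  \<open>A D\<close> are those with \<open>p34 = 0\<close>. The six variables serve twice: as
  Pluecker coordinates before the substitution and as parameters after it.\<close>

definition param :: "plucker_poly \<Rightarrow> plucker_poly" where
  "param = subst Const segre"

lemma ring_morphism_param: "ring_morphism param"
  unfolding param_def by (intro ring_morphism_subst Const.ring_morphism_axioms)

interpretation param: ring_morphism param by (rule ring_morphism_param)

lemma param_Var: "param (Var \<alpha>) = segre \<alpha>" and param_Const: "param (Const c) = Const c"
  by (simp_all add: param_def subst_Var[OF Const.ring_morphism_axioms] subst_Const[OF Const.ring_morphism_axioms])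

definition param_expo :: "(plucker \<Rightarrow>\<^sub>0 nat) \<Rightarrow> plucker \<Rightarrow>\<^sub>0 nat" where
  "param_expo t = exponent (\<lambda>\<alpha>. case \<alpha> of P12 \<Rightarrow> expo t P12 | P13 \<Rightarrow> expo t P13 + expo t P14 |
     P14 \<Rightarrow> expo t P23 + expo t P24 | P23 \<Rightarrow> expo t P13 + expo t P23 | P24 \<Rightarrow> expo t P14 + expo t P24 | P34 \<Rightarrow> 0)"

lemma prod_plucker: "prod f UNIV = f P12 * f P13 * f P14 * f P23 * f P24 * (f P34 :: 'a::comm_monoid_mult)"
  by (simp add: UNIV_plucker mult.assoc)

lemma Var_Var_power: "(Var \<alpha> * Var \<beta>) ^ n = monomial (Poly_Mapping.single \<alpha> n + Poly_Mapping.single \<beta> n)"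
  by (simp add: power_mult_distrib Var_power mult_single)

lemma param_monomial: "param (monomial t) = (if expo t P34 = 0 then monomial (param_expo t) else 0)"
proof -
  have "param (monomial t) = (\<Prod>\<alpha>\<in>UNIV. segre \<alpha> ^ expo t \<alpha>)"
    unfolding param_def by (rule subst_monomial[OF Const.ring_morphism_axioms])
  also have "\<dots> = Var P12 ^ expo t P12 * (Var P13 * Var P23) ^ expo t P13 * (Var P13 * Var P24) ^ expo t P14 *
      (Var P14 * Var P23) ^ expo t P23 * (Var P14 * Var P24) ^ expo t P24 * 0 ^ expo t P34"
    by (simp only: prod_plucker segre.simps)
  also have "\<dots> = monomial (Poly_Mapping.single P12 (expo t P12)
      + (Poly_Mapping.single P13 (expo t P13) + Poly_Mapping.single P23 (expo t P13))
      + (Poly_Mapping.single P13 (expo t P14) + Poly_Mapping.single P24 (expo t P14))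
      + (Poly_Mapping.single P14 (expo t P23) + Poly_Mapping.single P23 (expo t P23))
      + (Poly_Mapping.single P14 (expo t P24) + Poly_Mapping.single P24 (expo t P24))) * 0 ^ expo t P34"
    (is "_ = monomial ?s * _")
    by (simp only: Var_Var_power Var_power mult_single mult_1)
  also have "?s = param_expo t"
  proof (rule poly_mapping_eqI)
    fix \<alpha> show "expo ?s \<alpha> = expo (param_expo t) \<alpha>"
      by (cases \<alpha>) (simp_all add: param_expo_def lookup_add lookup_single)
  qed
  finally show ?thesis by (simp add: power_0_left)
qed

text \<open>The exponent of the standard monomial, without a factor \<open>p\<^sub>1\<^sub>4 p\<^sub>2\<^sub>3\<close> or \<open>p\<^sub>3\<^sub>4\<close>, that parametrises to the
  monomial with exponent \<open>t\<close>.\<close>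

definition standard_expo :: "(plucker \<Rightarrow>\<^sub>0 nat) \<Rightarrow> plucker \<Rightarrow>\<^sub>0 nat" where
  "standard_expo t = exponent (\<lambda>\<alpha>. case \<alpha> of P12 \<Rightarrow> expo t P12 | P13 \<Rightarrow> min (expo t P13) (expo t P23) |
     P14 \<Rightarrow> expo t P13 - expo t P23 | P23 \<Rightarrow> expo t P23 - expo t P13 | P24 \<Rightarrow> min (expo t P14) (expo t P24) | P34 \<Rightarrow> 0)"

definition straighten :: "plucker_poly \<Rightarrow> plucker_poly" where
  "straighten = lin Const (\<lambda>t. monomial (standard_expo t))"

text \<open>Modulo the two generators, each factor \<open>p14 p23\<close> may be exchanged for
  \<open>p13 p24\<close>. The monomial reached when no such factor is left is determined by its
  parametrised exponent.\<close>

lemma straighten_param_monomial: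
  "monomial t - straighten (param (monomial t)) \<in> ideal.span {plucker_relation, Var P34}"
proof (cases "expo t P34 = 0")
  case False
  have "t = Poly_Mapping.single P34 1 + (t - Poly_Mapping.single P34 1)"
    using False by (intro poly_mapping_eqI) (auto simp: lookup_add lookup_minus lookup_single when_def)
  then have "monomial t = monomial (t - Poly_Mapping.single P34 1) * Var P34"
    by (metis Var_def add.commute mult_1 mult_single)
  then have "monomial t \<in> ideal.span {plucker_relation, Var P34}"
    by (metis ideal.span_base ideal.span_scale insert_iff)
  moreover have "straighten (param (monomial t)) = 0"
    using False by (simp add: param_monomial straighten_def lin_def)
  ultimately show ?thesis by simp
next
  case True
  \<comment> \<open>\<open>c\<close> counts the factors \<open>p14 p23\<close> to be exchanged, and
    \<open>R\<close> is the untouched rest.\<close>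
  define c where "c = min (expo t P14) (expo t P23)"
  define \<rho> where "\<rho> = exponent (\<lambda>\<alpha>. case \<alpha> of P14 \<Rightarrow> expo t P14 - c | P23 \<Rightarrow> expo t P23 - c | _ \<Rightarrow> expo t \<alpha>)"
  define R where "R = monomial \<rho>"
  have "t = \<rho> + (Poly_Mapping.single P14 c + Poly_Mapping.single P23 c)"
  proof (rule poly_mapping_eqI)
    fix \<alpha> show "expo t \<alpha> = expo (\<rho> + (Poly_Mapping.single P14 c + Poly_Mapping.single P23 c)) \<alpha>"
      by (cases \<alpha>) (simp_all add: \<rho>_def c_def lookup_add lookup_single)
  qed
  then have t: "monomial t = R * (Var P14 * Var P23) ^ c"
    unfolding R_def Var_Var_power by (simp only: mult_single mult_1)
  have "straighten (param (monomial t)) = monomial (standard_expo (param_expo t))"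
    using True lin_term[OF Const.ring_morphism_axioms, of _ 1 "param_expo t"]
    by (simp add: param_monomial straighten_def Const.one)
  also have "standard_expo (param_expo t) = \<rho> + (Poly_Mapping.single P13 c + Poly_Mapping.single P24 c)"
  proof (rule poly_mapping_eqI)
    fix \<alpha> show "expo (standard_expo (param_expo t)) \<alpha> = expo (\<rho> + (Poly_Mapping.single P13 c + Poly_Mapping.single P24 c)) \<alpha>"
      using True by (cases \<alpha>) (simp_all add: \<rho>_def c_def standard_expo_def param_expo_def lookup_add lookup_single min_def)
  qed
  also have "monomial \<dots> = R * (Var P13 * Var P24) ^ c"
    unfolding R_def Var_Var_power by (simp only: mult_single mult_1)
  finally have n: "straighten (param (monomial t)) = R * (Var P13 * Var P24) ^ c" .
  have "monomial t - straighten (param (monomial t)) = R * ((Var P14 * Var P23) ^ c - (Var P13 * Var P24) ^ c)"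
    unfolding n right_diff_distrib t[symmetric] ..
  \<comment> \<open>Where \<open>p34\<close> vanishes, the Pluecker relation is the equation of the
    Segre surface.\<close>
  moreover have "Var P14 * Var P23 - Var P13 * Var P24 = plucker_relation - Var P12 * Var P34"
    unfolding plucker_relation_def by (simp only: algebra_simps add_diff_cancel_left' diff_add_cancel)
  then have "Var P14 * Var P23 - Var P13 * Var P24 \<in> ideal.span {plucker_relation, Var P34}"
    using ideal.span_diff[OF ideal.span_base ideal.span_scale[OF ideal.span_base]] by fastforce
  then have "(Var P14 * Var P23) ^ c - (Var P13 * Var P24) ^ c \<in> ideal.span {plucker_relation, Var P34}"
    by (rule ideal_power_diff)
  ultimately show ?thesis by (metis ideal.span_scale)
qed

lemma straighten_param: "f - straighten (param f) \<in> ideal.span {plucker_relation, Var P34}"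
proof (induction f rule: plucker_poly_induct)
  case (monom t c)
  have scale: "straighten (Const c * g) = Const c * straighten g" for g
    by (induction g rule: plucker_poly_induct)
      (simp_all add: straighten_def lin_add[OF Const.ring_morphism_axioms] lin_term[OF Const.ring_morphism_axioms]
        distrib_left mult.assoc[symmetric] Const.mult[symmetric])
  then have "Const c * monomial t - straighten (param (Const c * monomial t)) = Const c * (monomial t - straighten (param (monomial t)))"
    by (simp only: param.mult param_Const scale right_diff_distrib)
  then show ?case using straighten_param_monomial[of t] by (simp add: ideal.span_scale)
next
  case (plus f g)
  have "f + g - straighten (param (f + g)) = (f - straighten (param f)) + (g - straighten (param g))"
    by (simp add: param.add straighten_def lin_add[OF Const.ring_morphism_axioms])
  then show ?case using ideal.span_add[OF plus] by (simp only:)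
qed

text \<open>As \<open>straighten\<close> sends 0 to 0, the preceding congruence places
  \<open>f\<close> itself in the ideal.\<close>

lemma param_kernel:
  assumes "param f = 0"
  shows "f \<in> ideal.span {plucker_relation, Var P34}"
  using straighten_param[of f] assms by (simp add: straighten_def lin_def)

text \<open>For surjectivity, each balanced monomial comes from its standard monomial: balance
  forces the degree in \<sigma>, \<tau> to equal that in \<open>u\<close>, \<open>v\<close>, so the
  two kinds of factors can be paired off.\<close>

lemma param_homogeneous_part: "param ` homogeneous_part d = balanced d"
proof
  show "param ` homogeneous_part d \<subseteq> balanced d"
  proof
    fix g assume "g \<in> param ` homogeneous_part d"
    then obtain f where f: "f \<in> graded total_degree d" "g = param f" by (auto simp: homogeneous_part_eq_graded)
    have "g = (\<Sum>t\<in>Poly_Mapping.keys f. Const (Poly_Mapping.lookup f t) * param (monomial t))"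
      unfolding f(2) by (subst poly_expand) (simp add: param.sum param.mult param_Const)
    also have "\<dots> \<in> balanced d"
    proof (intro graded_sum tridegree.graded_mult_Const)
      fix t assume "t \<in> Poly_Mapping.keys f"
      then have "total_degree t = d" using f(1) by (simp add: graded_def)
      then show "param (monomial t) \<in> balanced d"
        by (auto simp: param_monomial graded_zero total_degree_def sum_plucker tridegree_def param_expo_def intro!: graded_monomial)
    qed
    finally show "g \<in> balanced d" .
  qed
  show "balanced d \<subseteq> param ` homogeneous_part d"
  proof
    fix g assume g: "g \<in> balanced d"
    have std: "total_degree (standard_expo t) = d" "param (monomial (standard_expo t)) = monomial t"
      if "t \<in> Poly_Mapping.keys g" for t
    proof -
      have t: "expo t P12 + expo t P13 + expo t P14 = d" "expo t P12 + expo t P23 + expo t P24 = d" "expo t P34 = 0"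
        using g that by (auto simp: graded_def tridegree_def)
      then show "total_degree (standard_expo t) = d"
        by (simp add: total_degree_def sum_plucker standard_expo_def)
      have "expo (param_expo (standard_expo t)) \<alpha> = expo t \<alpha>" for \<alpha>
        using t by (cases \<alpha>) (auto simp: param_expo_def standard_expo_def min_def)
      then have "param_expo (standard_expo t) = t" by (rule poly_mapping_eqI)
      moreover have "expo (standard_expo t) P34 = 0" by (simp add: standard_expo_def)
      ultimately show "param (monomial (standard_expo t)) = monomial t" by (simp add: param_monomial)
    qed
    have "straighten g \<in> homogeneous_part d"
      unfolding straighten_def lin_def homogeneous_part_eq_graded
      by (intro graded_sum total_degree.graded_mult_Const graded_monomial std)
    moreover have "param (straighten g) = g"
      unfolding straighten_def lin_def
      by (simp add: param.sum param.mult param_Const std flip: poly_expand)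
    ultimately show "g \<in> param ` homogeneous_part d" by force
  qed
qed

section \<open>Projective changes of coordinates acting on Pluecker space\<close>

definition change :: "complex^4^4 \<Rightarrow> plucker_poly \<Rightarrow> plucker_poly" where
  "change N = subst Const (\<lambda>\<alpha>. \<Sum>\<beta>\<in>UNIV. Const (wedge2 N $ \<alpha> $ \<beta>) * Var \<beta>)"

lemma ring_morphism_change: "ring_morphism (change N)"
  unfolding change_def by (intro ring_morphism_subst Const.ring_morphism_axioms)

interpretation change: ring_morphism "change N" for N by (rule ring_morphism_change)

lemma change_Var: "change N (Var \<alpha>) = (\<Sum>\<beta>\<in>UNIV. Const (wedge2 N $ \<alpha> $ \<beta>) * Var \<beta>)"
  and change_Const: "change N (Const c) = Const c"
  by (simp_all add: change_def subst_Var[OF Const.ring_morphism_axioms] subst_Const[OF Const.ring_morphism_axioms])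

lemma change_homogeneous:
  assumes "f \<in> homogeneous_part d"
  shows "change N f \<in> homogeneous_part d"
proof -
  have "change N f = (\<Sum>t\<in>Poly_Mapping.keys f. Const (Poly_Mapping.lookup f t) * (\<Prod>\<alpha>\<in>UNIV. change N (Var \<alpha>) ^ expo t \<alpha>))"
    by (subst poly_expand) (simp add: monomial_eq_prod_Var change.sum change.mult change.prod change.power change_Const)
  moreover have "(\<Prod>\<alpha>\<in>UNIV. change N (Var \<alpha>) ^ expo t \<alpha>) \<in> graded total_degree (total_degree t)" for t
  proof -
    have "change N (Var \<alpha>) \<in> graded total_degree 1" for \<alpha>
      unfolding change_Var by (intro graded_sum total_degree.graded_mult_Const Var_homogeneous)
    from total_degree_power[OF this] have "change N (Var \<alpha>) ^ expo t \<alpha> \<in> graded total_degree (expo t \<alpha>)" for \<alpha>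
      by simp
    then have "(\<Prod>\<alpha>\<in>UNIV. change N (Var \<alpha>) ^ expo t \<alpha>) \<in> graded total_degree (sum (expo t) UNIV)"
      by (rule total_degree_prod)
    moreover have "sum (expo t) UNIV = total_degree t" by (simp add: total_degree_def)
    ultimately show ?thesis by (simp only:)
  qed
  moreover have "total_degree t = d" if "t \<in> Poly_Mapping.keys f" for t
    using assms that by (simp add: homogeneous_part_eq_graded graded_def)
  ultimately show ?thesis
    unfolding homogeneous_part_eq_graded
    by (simp only:) (intro graded_sum total_degree.graded_mult_Const, metis)
qed

lemma matrix_mult_entry: "(A ** B) $ i $ j = (\<Sum>k\<in>UNIV. A $ i $ k * B $ k $ j)"
  by (simp add: matrix_matrix_mult_def)

text \<open>The Cauchy-Binet formula for 2 x 2 minors.\<close>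

lemma wedge2_mult: "wedge2 (M ** N) = wedge2 M ** wedge2 N"
  by (simp add: vec_eq_iff wedge2_def matrix_matrix_mult_def sum_plucker sum_4 algebra_simps)

lemma wedge2_transpose: "wedge2 (transpose N) = transpose (wedge2 N)"
  by (simp add: vec_eq_iff wedge2_def transpose_def mult.commute)

lemma wedge2_mat_1: "wedge2 (mat 1) = mat 1"
proof -
  have "wedge2 (mat 1) $ \<alpha> $ \<beta> = mat 1 $ \<alpha> $ \<beta>" for \<alpha> \<beta>
    by (cases \<alpha>; cases \<beta>) (simp_all add: wedge2_def mat_def)
  then show ?thesis by (simp add: vec_eq_iff)
qed

text \<open>\<open>change N f\<close> is \<open>f\<close> composed with the linear map
  \<open>wedge2 N\<close>, hence the reversed order of the factors.\<close>

lemma change_change: "change M (change N f) = change (N ** M) f"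
proof (rule ring_morphism_plucker_poly_eqI[where f = "\<lambda>f. change M (change N f)"])
  show "ring_morphism (\<lambda>f. change M (change N f))"
    by (rule ring_morphism_comp[OF ring_morphism_change ring_morphism_change])
  show "ring_morphism (change (N ** M))" by (rule ring_morphism_change)
  show "change M (change N (Const c)) = change (N ** M) (Const c)" for c
    by (simp add: change_Const)
  show "change M (change N (Var \<alpha>)) = change (N ** M) (Var \<alpha>)" for \<alpha>
  proof -
    have "change M (change N (Var \<alpha>)) = (\<Sum>\<beta>\<in>UNIV. Const (wedge2 N $ \<alpha> $ \<beta>) * (\<Sum>\<gamma>\<in>UNIV. Const (wedge2 M $ \<beta> $ \<gamma>) * Var \<gamma>))"
      unfolding change_Var[of N] change.sum change.mult change_Const change_Var[of M] ..
    also have "\<dots> = (\<Sum>\<beta>\<in>UNIV. \<Sum>\<gamma>\<in>UNIV. Const (wedge2 N $ \<alpha> $ \<beta> * wedge2 M $ \<beta> $ \<gamma>) * Var \<gamma>)"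
      by (simp only: sum_distrib_left Const.mult mult.assoc)
    also have "\<dots> = (\<Sum>\<gamma>\<in>UNIV. \<Sum>\<beta>\<in>UNIV. Const (wedge2 N $ \<alpha> $ \<beta> * wedge2 M $ \<beta> $ \<gamma>) * Var \<gamma>)"
      by (rule sum.swap)
    also have "\<dots> = (\<Sum>\<gamma>\<in>UNIV. Const (wedge2 (N ** M) $ \<alpha> $ \<gamma>) * Var \<gamma>)"
      by (simp only: wedge2_mult matrix_mult_entry Const.sum sum_distrib_right)
    finally show ?thesis unfolding change_Var[of "N ** M"] .
  qed
qed

lemma change_mat_1: "change (mat 1) f = f"
proof (rule ring_morphism_plucker_poly_eqI[OF ring_morphism_change ring_morphism_id])
  show "change (mat 1) (Var \<alpha>) = Var \<alpha>" for \<alpha>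
  proof -
    have "(\<Sum>\<beta>\<in>UNIV. Const (mat 1 $ \<alpha> $ \<beta>) * Var \<beta>) = (\<Sum>\<beta>\<in>UNIV. if \<alpha> = \<beta> then Var \<beta> else 0)"
      by (rule sum.cong) (simp_all add: mat_def Const.zero Const.one)
    then show ?thesis unfolding change_Var wedge2_mat_1 by simp
  qed
qed (rule change_Const)

lemma sum_swap4:
  fixes f :: "plucker \<Rightarrow> plucker \<Rightarrow> plucker \<Rightarrow> plucker \<Rightarrow> plucker_poly"
  shows "(\<Sum>\<alpha>\<in>UNIV. \<Sum>\<beta>\<in>UNIV. \<Sum>\<gamma>\<in>UNIV. \<Sum>\<delta>\<in>UNIV. f \<alpha> \<beta> \<gamma> \<delta>)
    = (\<Sum>\<gamma>\<in>UNIV. \<Sum>\<delta>\<in>UNIV. \<Sum>\<beta>\<in>UNIV. \<Sum>\<alpha>\<in>UNIV. f \<alpha> \<beta> \<gamma> \<delta>)"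
proof -
  have "(\<Sum>\<alpha>\<in>UNIV. \<Sum>\<beta>\<in>UNIV. \<Sum>\<gamma>\<in>UNIV. \<Sum>\<delta>\<in>UNIV. f \<alpha> \<beta> \<gamma> \<delta>)
      = (\<Sum>\<alpha>\<in>UNIV. \<Sum>\<gamma>\<in>UNIV. \<Sum>\<beta>\<in>UNIV. \<Sum>\<delta>\<in>UNIV. f \<alpha> \<beta> \<gamma> \<delta>)"
    by (rule sum.cong[OF refl], rule sum.swap)
  also have "\<dots> = (\<Sum>\<gamma>\<in>UNIV. \<Sum>\<alpha>\<in>UNIV. \<Sum>\<beta>\<in>UNIV. \<Sum>\<delta>\<in>UNIV. f \<alpha> \<beta> \<gamma> \<delta>)"
    by (rule sum.swap)
  also have "\<dots> = (\<Sum>\<gamma>\<in>UNIV. \<Sum>\<alpha>\<in>UNIV. \<Sum>\<delta>\<in>UNIV. \<Sum>\<beta>\<in>UNIV. f \<alpha> \<beta> \<gamma> \<delta>)"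
    by (rule sum.cong[OF refl], rule sum.cong[OF refl], rule sum.swap)
  also have "\<dots> = (\<Sum>\<gamma>\<in>UNIV. \<Sum>\<delta>\<in>UNIV. \<Sum>\<alpha>\<in>UNIV. \<Sum>\<beta>\<in>UNIV. f \<alpha> \<beta> \<gamma> \<delta>)"
    by (rule sum.cong[OF refl], rule sum.swap)
  also have "\<dots> = (\<Sum>\<gamma>\<in>UNIV. \<Sum>\<delta>\<in>UNIV. \<Sum>\<beta>\<in>UNIV. \<Sum>\<alpha>\<in>UNIV. f \<alpha> \<beta> \<gamma> \<delta>)"
    by (rule sum.cong[OF refl], rule sum.cong[OF refl], rule sum.swap)
  finally show ?thesis .
qed

text \<open>Congruence of \<open>Q\<close> by \<open>N\<close> becomes congruence of
  \<open>wedge2 Q\<close> by \<open>wedge2 N\<close>, since \<open>wedge2\<close> respects products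
  and transposes.\<close>

lemma change_tangency_form: "change N (tangency_form Q) = tangency_form (transpose N ** Q ** N)"
proof -
  define W where "W = wedge2 N"
  define Z where "Z = wedge2 Q"
  have expand: "a * (\<Sum>\<gamma>\<in>UNIV. f \<gamma>) * (\<Sum>\<delta>\<in>UNIV. g \<delta>) = (\<Sum>\<gamma>\<in>UNIV. \<Sum>\<delta>\<in>UNIV. a * f \<gamma> * g \<delta>)"
    for a and f g :: "plucker \<Rightarrow> plucker_poly"
    unfolding sum_distrib_left[of a] sum_product ..
  have "change N (tangency_form Q) = (\<Sum>\<alpha>\<in>UNIV. \<Sum>\<beta>\<in>UNIV. Const (Z $ \<alpha> $ \<beta>) *
      (\<Sum>\<gamma>\<in>UNIV. Const (W $ \<alpha> $ \<gamma>) * Var \<gamma>) * (\<Sum>\<delta>\<in>UNIV. Const (W $ \<beta> $ \<delta>) * Var \<delta>))"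
    unfolding tangency_form_def change.sum change.mult change_Const change_Var W_def Z_def ..
  also have "\<dots> = (\<Sum>\<alpha>\<in>UNIV. \<Sum>\<beta>\<in>UNIV. \<Sum>\<gamma>\<in>UNIV. \<Sum>\<delta>\<in>UNIV. Const (W $ \<alpha> $ \<gamma> * Z $ \<alpha> $ \<beta> * W $ \<beta> $ \<delta>) * Var \<gamma> * Var \<delta>)"
    unfolding expand by (intro sum.cong refl) (simp only: Const.mult ac_simps)
  also have "\<dots> = (\<Sum>\<gamma>\<in>UNIV. \<Sum>\<delta>\<in>UNIV. \<Sum>\<beta>\<in>UNIV. \<Sum>\<alpha>\<in>UNIV. Const (W $ \<alpha> $ \<gamma> * Z $ \<alpha> $ \<beta> * W $ \<beta> $ \<delta>) * Var \<gamma> * Var \<delta>)"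
    by (rule sum_swap4)
  also have "\<dots> = (\<Sum>\<gamma>\<in>UNIV. \<Sum>\<delta>\<in>UNIV. Const ((transpose W ** Z ** W) $ \<gamma> $ \<delta>) * Var \<gamma> * Var \<delta>)"
    unfolding transpose_def
    by (simp only: vec_lambda_beta matrix_mult_entry Const.sum sum_distrib_right)
  also have "\<dots> = tangency_form (transpose N ** Q ** N)"
    unfolding tangency_form_def wedge2_mult wedge2_transpose W_def Z_def ..
  finally show ?thesis .
qed

text \<open>The wedge product of two bivectors, which is the polar form of the Pluecker quadric; on
  two lines it vanishes exactly when they meet.\<close>

definition line_pairing :: "(plucker \<Rightarrow> 'a) \<Rightarrow> (plucker \<Rightarrow> 'a) \<Rightarrow> 'a::comm_ring_1" where
  "line_pairing p q = p P12 * q P34 - p P13 * q P24 + p P14 * q P23 + p P23 * q P14 - p P24 * q P13 + p P34 * q P12"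

text \<open>By Laplace expansion along the first two columns this is the determinant of
  \<open>N\<close>.\<close>

definition wedge_det :: "complex^4^4 \<Rightarrow> complex" where
  "wedge_det N = line_pairing (\<lambda>\<alpha>. wedge2 N $ \<alpha> $ P12) (\<lambda>\<alpha>. wedge2 N $ \<alpha> $ P34)"

text \<open>Laplace expansion again: pairs with a repeated column give 0, and complementary pairs
  give the determinant up to sign.\<close>

lemma line_pairing_columns:
  "line_pairing (\<lambda>\<alpha>. wedge2 N $ \<alpha> $ \<beta>) (\<lambda>\<alpha>. wedge2 N $ \<alpha> $ \<gamma>) =
    wedge_det N * line_pairing (\<lambda>\<alpha>. if \<alpha> = \<beta> then 1 else 0) (\<lambda>\<alpha>. if \<alpha> = \<gamma> then 1 else 0)"
  unfolding wedge_det_def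
  by (cases \<beta>; cases \<gamma>) (simp_all add: line_pairing_def wedge2_def algebra_simps)

lemma line_pairing_sum_right:
  "line_pairing p (\<lambda>\<alpha>. \<Sum>\<gamma>\<in>UNIV. f \<alpha> \<gamma> * y \<gamma>) = (\<Sum>\<gamma>\<in>UNIV. line_pairing p (\<lambda>\<alpha>. f \<alpha> \<gamma>) * y \<gamma>)"
  unfolding line_pairing_def
  by (simp only: distrib_right left_diff_distrib sum.distrib sum_subtractf mult.assoc sum_distrib_left)

lemma line_pairing_commute: "line_pairing p q = line_pairing q p"
  unfolding line_pairing_def by (simp add: ac_simps)

lemma line_pairing_Const: "line_pairing (\<lambda>\<alpha>. Const (p \<alpha>)) (\<lambda>\<alpha>. Const (q \<alpha>)) = Const (line_pairing p q)"
  unfolding line_pairing_def by (simp only: Const.hom_simps)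

abbreviation unit_at :: "plucker \<Rightarrow> plucker \<Rightarrow> 'a::comm_ring_1" where
  "unit_at \<beta> \<equiv> (\<lambda>\<alpha>. if \<alpha> = \<beta> then 1 else 0)"

lemma line_pairing_unit_at:
  "line_pairing (unit_at P12) y = y P34" "line_pairing (unit_at P13) y = - y P24" "line_pairing (unit_at P14) y = y P23"
  "line_pairing (unit_at P23) y = y P14" "line_pairing (unit_at P24) y = - y P13" "line_pairing (unit_at P34) y = y P12"
  by (simp_all add: line_pairing_def)

text \<open>Expanding the second argument in the columns of \<open>wedge2 N\<close> reduces this to
  \<open>line_pairing_columns\<close>: the induced map preserves the pairing up to the
  determinant.\<close>

lemma change_line_pairing:
  "line_pairing (\<lambda>\<alpha>. Const (wedge2 N $ \<alpha> $ \<beta>)) (\<lambda>\<alpha>. change N (Var \<alpha>)) =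
    Const (wedge_det N) * line_pairing (unit_at \<beta>) Var"
proof -
  have "line_pairing (\<lambda>\<alpha>. Const (wedge2 N $ \<alpha> $ \<beta>)) (\<lambda>\<alpha>. change N (Var \<alpha>)) =
    (\<Sum>\<gamma>\<in>UNIV. Const (wedge_det N * line_pairing (unit_at \<beta>) (unit_at \<gamma>)) * Var \<gamma>)"
    unfolding change_Var line_pairing_sum_right line_pairing_Const line_pairing_columns ..
  also have "\<dots> = Const (wedge_det N) * (\<Sum>\<gamma>\<in>UNIV. Const (line_pairing (unit_at \<beta>) (unit_at \<gamma>)) * Var \<gamma>)"
    by (simp only: Const.mult mult.assoc sum_distrib_left)
  also have "(\<Sum>\<gamma>\<in>UNIV. Const (line_pairing (unit_at \<beta>) (unit_at \<gamma>)) * Var \<gamma>) = line_pairing (unit_at \<beta>) Var"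
    by (cases \<beta>) (simp_all add: line_pairing_def sum_plucker Const.zero Const.one Const.uminus)
  finally show ?thesis .
qed

lemma change_meeting_form:
  "change N (meeting_form (\<chi> \<alpha>. wedge2 N $ \<alpha> $ P12)) = Const (wedge_det N) * Var P34"
proof -
  have "change N (meeting_form (\<chi> \<alpha>. wedge2 N $ \<alpha> $ P12))
      = line_pairing (\<lambda>\<alpha>. Const (wedge2 N $ \<alpha> $ P12)) (\<lambda>\<alpha>. change N (Var \<alpha>))"
    unfolding meeting_form_def line_pairing_def by (simp only: change.hom_simps change_Const vec_lambda_beta)
  moreover have "line_pairing (unit_at P12) Var = Var P34" by (simp add: line_pairing_def)
  ultimately show ?thesis unfolding change_line_pairing by (simp only:)
qed

text \<open>Twice the relation is the pairing of the vector of variables with itself, so the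
  behaviour of the pairing carries over; the factor 2 is divided out at the end.\<close>

lemma change_plucker_relation: "change N plucker_relation = Const (wedge_det N) * plucker_relation"
proof -
  have double: "x * y - z * t + p * q + (x * y - z * t + p * q) = x * y - z * t + p * q + q * p - t * z + y * x"
    for x y z t p q :: plucker_poly
    unfolding mult.commute[of q p] mult.commute[of t z] mult.commute[of y x] by (simp only: diff_conv_add_uminus add.assoc add.commute add.left_commute)
  have pr: "plucker_relation + plucker_relation = line_pairing Var Var"
    unfolding plucker_relation_def line_pairing_def by (rule double)
  have "change N plucker_relation + change N plucker_relation = line_pairing (\<lambda>\<alpha>. change N (Var \<alpha>)) (\<lambda>\<alpha>. change N (Var \<alpha>))"
    unfolding plucker_relation_def line_pairing_def change.add change.diff change.mult by (rule double)
  also have "\<dots> = line_pairing (\<lambda>\<alpha>. change N (Var \<alpha>)) (\<lambda>\<alpha>. \<Sum>\<beta>\<in>UNIV. Const (wedge2 N $ \<alpha> $ \<beta>) * Var \<beta>)"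
    by (simp only: change_Var)
  also have "\<dots> = (\<Sum>\<beta>\<in>UNIV. line_pairing (\<lambda>\<alpha>. Const (wedge2 N $ \<alpha> $ \<beta>)) (\<lambda>\<alpha>. change N (Var \<alpha>)) * Var \<beta>)"
    unfolding line_pairing_sum_right by (subst line_pairing_commute) (rule refl)
  also have "\<dots> = Const (wedge_det N) * (\<Sum>\<beta>\<in>UNIV. line_pairing (unit_at \<beta>) Var * Var \<beta>)"
    unfolding change_line_pairing by (simp only: mult.assoc sum_distrib_left)
  also have "(\<Sum>\<beta>\<in>UNIV. line_pairing (unit_at \<beta>) Var * Var \<beta>) = line_pairing Var Var"
    unfolding sum_plucker line_pairing_unit_at unfolding line_pairing_def
    by (simp only: mult_minus_left mult_minus_right diff_conv_add_uminus mult.commute add.assoc add.commute add.left_commute)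
  finally have two: "change N plucker_relation + change N plucker_relation = Const (wedge_det N) * (plucker_relation + plucker_relation)"
    unfolding pr .
  have half: "x = Const (1 / 2) * (x + x)" for x
  proof -
    have "Const (1 / 2) * (x + x) = Const (1 / 2 + 1 / 2) * x"
      by (simp only: Const.add distrib_left distrib_right)
    moreover have "Const (1 / 2 + 1 / 2) = 1" by (simp add: Const.one)
    ultimately show ?thesis by (simp only: mult_1)
  qed
  have "change N plucker_relation = Const (1 / 2) * (Const (wedge_det N) * (plucker_relation + plucker_relation))"
    unfolding two[symmetric] by (rule half)
  also have "\<dots> = Const (wedge_det N) * (Const (1 / 2) * (plucker_relation + plucker_relation))"
    by (rule mult.left_commute)
  finally show ?thesis unfolding half[symmetric] .
qed

text \<open>\<open>G\<close> has the shape of a sphere's matrix in an orthonormal frame: the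
  \<open>gi\<close> are the coordinates of the centre relative to the base point, and
  \<open>g\<close> is the power of the base point with respect to the sphere.\<close>

lemma tangency_form_gram:
  fixes g1 g2 g3 g :: complex
  defines "G \<equiv> vector [vector [g, - g1, - g2, - g3], vector [- g1, 1, 0, 0], vector [- g2, 0, 1, 0], vector [- g3, 0, 0, 1]] :: complex^4^4"
  shows "tangency_form G =
    Const (g - g1 * g1) * (Var P12 * Var P12) + Const (g - g2 * g2) * (Var P13 * Var P13) + Const (g - g3 * g3) * (Var P14 * Var P14)
    + Var P23 * Var P23 + Var P24 * Var P24 + Var P34 * Var P34
    + (Const (- (2 * g1 * g2)) * (Var P12 * Var P13) + Const (- (2 * g1 * g3)) * (Var P12 * Var P14) + Const (- (2 * g2 * g3)) * (Var P13 * Var P14))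
    + (Const (2 * g2) * (Var P12 * Var P23) + Const (2 * g3) * (Var P12 * Var P24) + Const (- (2 * g1)) * (Var P13 * Var P23)
      + Const (2 * g3) * (Var P13 * Var P34) + Const (- (2 * g1)) * (Var P14 * Var P24) + Const (- (2 * g2)) * (Var P14 * Var P34))"
proof -
  define m where "m \<alpha> \<beta> = wedge2 G $ \<alpha> $ \<beta>" for \<alpha> \<beta>
  have m: "m P12 P12 = g - g1 * g1" "m P13 P13 = g - g2 * g2" "m P14 P14 = g - g3 * g3" "m P23 P23 = 1" "m P24 P24 = 1" "m P34 P34 = 1"
    "m P12 P13 = - (g1 * g2)" "m P13 P12 = - (g1 * g2)" "m P12 P14 = - (g1 * g3)" "m P14 P12 = - (g1 * g3)"
    "m P13 P14 = - (g2 * g3)" "m P14 P13 = - (g2 * g3)"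
    "m P12 P23 = g2" "m P23 P12 = g2" "m P12 P24 = g3" "m P24 P12 = g3" "m P12 P34 = 0" "m P34 P12 = 0"
    "m P13 P23 = - g1" "m P23 P13 = - g1" "m P13 P24 = 0" "m P24 P13 = 0" "m P13 P34 = g3" "m P34 P13 = g3"
    "m P14 P23 = 0" "m P23 P14 = 0" "m P14 P24 = - g1" "m P24 P14 = - g1" "m P14 P34 = - g2" "m P34 P14 = - g2"
    "m P23 P24 = 0" "m P24 P23 = 0" "m P23 P34 = 0" "m P34 P23 = 0" "m P24 P34 = 0" "m P34 P24 = 0"
    by (simp_all add: m_def wedge2_def G_def)
  have "tangency_form G = (\<Sum>\<alpha>\<in>UNIV. \<Sum>\<beta>\<in>UNIV. Const (m \<alpha> \<beta>) * Var \<alpha> * Var \<beta>)"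
    unfolding tangency_form_def m_def ..
  also have "to_nested \<dots> = to_nested (
    Const (g - g1 * g1) * (Var P12 * Var P12) + Const (g - g2 * g2) * (Var P13 * Var P13) + Const (g - g3 * g3) * (Var P14 * Var P14)
    + Var P23 * Var P23 + Var P24 * Var P24 + Var P34 * Var P34
    + (Const (- (2 * g1 * g2)) * (Var P12 * Var P13) + Const (- (2 * g1 * g3)) * (Var P12 * Var P14) + Const (- (2 * g2 * g3)) * (Var P13 * Var P14))
    + (Const (2 * g2) * (Var P12 * Var P23) + Const (2 * g3) * (Var P12 * Var P24) + Const (- (2 * g1)) * (Var P13 * Var P23)
      + Const (2 * g3) * (Var P13 * Var P34) + Const (- (2 * g1)) * (Var P14 * Var P24) + Const (- (2 * g2)) * (Var P14 * Var P34)))"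
    unfolding sum_plucker m Const.hom_simps to_nested.hom_simps
    by algebra
  finally show ?thesis by (metis from_nested_to_nested)
qed

lemma param_tangency_form:
  "param (tangency_form (vector
     [vector [g1\<^sup>2 + g2\<^sup>2 + g3\<^sup>2 - r2, - g1, - g2, - g3],
      vector [- g1, 1, 0, 0], vector [- g2, 0, 1, 0], vector [- g3, 0, 0, 1]])) = sphere_form g1 g2 g3 r2"
    (is "?l = ?r")
proof -
  have "to_nested ?l = to_nested ?r"
    unfolding tangency_form_gram sphere_form_def Let_def param.hom_simps param_Var param_Const segre.simps
      Const.hom_simps to_nested.hom_simps
    by algebra
  then show ?thesis by (metis from_nested_to_nested)
qed

lemma meeting_form_scale: "meeting_form (\<chi> \<alpha>. t * p \<alpha>) = Const t * meeting_form (\<chi> \<alpha>. p \<alpha>)"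
  unfolding meeting_form_def by (simp only: vec_lambda_beta Const.mult ring_distribs mult.assoc)

lemma param_plucker_relation: "param plucker_relation = 0"
proof -
  have "param plucker_relation = Var P12 * 0 - Var P13 * Var P23 * (Var P14 * Var P24) + Var P13 * Var P24 * (Var P14 * Var P23)"
    unfolding plucker_relation_def param.hom_simps param_Var segre.simps ..
  also have "Var P13 * Var P24 * (Var P14 * Var P23) = Var P13 * Var P23 * (Var P14 * Var P24)"
    by (simp only: mult.assoc mult.commute mult.left_commute)
  finally show ?thesis by simp
qed

lemma plucker_relation_nonzero: "plucker_relation \<noteq> 0"
proof
  let ?p = "\<lambda>\<alpha>. if \<alpha> = P12 \<or> \<alpha> = P34 then 1 else (0::complex)"
  interpret ev: ring_morphism "subst (\<lambda>c. c) ?p" by (intro ring_morphism_subst ring_morphism_id)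
  assume "plucker_relation = 0"
  then have "subst (\<lambda>c. c) ?p plucker_relation = 0" by (simp add: ev.zero)
  then show False
    unfolding plucker_relation_def ev.hom_simps subst_Var[OF ring_morphism_id] by simp
qed

section \<open>Orthonormal frames along the line\<close>

lemma map_matrix_mult:
  "map_matrix complex_of_real (A ** B) = map_matrix complex_of_real A ** map_matrix complex_of_real B"
  by (simp add: vec_eq_iff map_matrix_def matrix_mult_entry)

text \<open>The standard basis is moved by an orthogonal transformation that takes the first axis to
  the direction of \<open>v\<close>; orthonormality and the Parseval identity are inherited.\<close>

lemma orthonormal_frame:
  fixes v :: "real^3"
  assumes "v \<noteq> 0"
  obtains e1 e2 e3 :: "real^3" where "v = norm v *\<^sub>R e1"
    "e1 \<bullet> e1 = 1" "e2 \<bullet> e2 = 1" "e3 \<bullet> e3 = 1" "e1 \<bullet> e2 = 0" "e1 \<bullet> e3 = 0" "e2 \<bullet> e3 = 0"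
    "\<forall>x. x \<bullet> x = (x \<bullet> e1)\<^sup>2 + (x \<bullet> e2)\<^sup>2 + (x \<bullet> e3)\<^sup>2"
proof -
  have "norm (v /\<^sub>R norm v) = 1" using assms by simp
  then obtain f :: "real^3 \<Rightarrow> real^3" where f: "orthogonal_transformation f" "f (axis 1 1) = v /\<^sub>R norm v"
    by (metis norm_axis_1 orthogonal_transformation_exists_1)
  have inner: "f x \<bullet> f y = x \<bullet> y" for x y using f(1) by (simp add: orthogonal_transformation_def)
  have parseval: "x \<bullet> x = (x \<bullet> f (axis 1 1))\<^sup>2 + (x \<bullet> f (axis 2 1))\<^sup>2 + (x \<bullet> f (axis 3 1))\<^sup>2" for x
  proof -
    obtain z where z: "x = f z" using orthogonal_transformation_surj[OF f(1)] by (metis surjD)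
    have ax: "z \<bullet> axis i 1 = z $ i" for i by (simp add: inner_axis)
    have "z \<bullet> z = (z $ 1)\<^sup>2 + (z $ 2)\<^sup>2 + (z $ 3)\<^sup>2" by (simp add: inner_vec_def sum_3 power2_eq_square)
    then show ?thesis unfolding z inner ax .
  qed
  have i: "f (axis i 1) \<bullet> f (axis j 1) = (if i = j then 1 else 0)" for i j
    unfolding inner by (simp add: inner_axis_axis)
  show thesis
  proof (rule that[of _ "f (axis 2 1)" "f (axis 3 1)"])
    show "v = norm v *\<^sub>R f (axis 1 1)" unfolding f(2) using assms by simp
    show "\<forall>x. x \<bullet> x = (x \<bullet> f (axis 1 1))\<^sup>2 + (x \<bullet> f (axis 2 1))\<^sup>2 + (x \<bullet> f (axis 3 1))\<^sup>2"
      using parseval by (rule allI)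
  qed (simp_all add: i)
qed

text \<open>The columns are homogeneous coordinates of the point \<open>a\<close> and of the points
  at infinity in the directions \<open>e1\<close>, \<open>e2\<close>, \<open>e3\<close>.\<close>

definition frame_matrix :: "real^3 \<Rightarrow> real^3 \<Rightarrow> real^3 \<Rightarrow> real^3 \<Rightarrow> real^4^4" where
  "frame_matrix a e1 e2 e3 = vector
     [vector [a$1, e1$1, e2$1, e3$1],
      vector [a$2, e1$2, e2$2, e3$2],
      vector [a$3, e1$3, e2$3, e3$3],
      vector [1, 0, 0, 0]]"

lemma frame_matrix_inverse:
  assumes e: "e1 \<bullet> e1 = 1" "e2 \<bullet> e2 = 1" "e3 \<bullet> e3 = 1" "e1 \<bullet> e2 = 0" "e1 \<bullet> e3 = 0" "e2 \<bullet> e3 = 0"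
  obtains M where "M ** frame_matrix a e1 e2 e3 = mat 1" "frame_matrix a e1 e2 e3 ** M = mat 1"
proof -
  \<comment> \<open>The first row keeps the homogenising coordinate; the others take inner products
    of \<open>x - a\<close> with the frame.\<close>
  define M :: "real^4^4" where "M = vector
     [vector [0, 0, 0, 1],
      vector [e1$1, e1$2, e1$3, - (e1 \<bullet> a)],
      vector [e2$1, e2$2, e2$3, - (e2 \<bullet> a)],
      vector [e3$1, e3$2, e3$3, - (e3 \<bullet> a)]]"
  have "M ** frame_matrix a e1 e2 e3 = mat 1"
    using e unfolding vec_eq_iff forall_4 matrix_mult_entry sum_4 mat_def M_def frame_matrix_def
    by (simp add: inner_vec_def sum_3 mult.commute)
  moreover from this have "frame_matrix a e1 e2 e3 ** M = mat 1" by (simp add: matrix_left_right_inverse)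
  ultimately show thesis by (rule that)
qed

text \<open>The entries are the values of the sphere's bilinear form on the columns of the frame
  matrix. Parseval expresses the squared distance from \<open>a\<close> to the centre by the frame
  coordinates.\<close>

lemma sphere_gram_matrix:
  fixes a c e1 e2 e3 :: "real^3" and r :: real
  assumes e: "e1 \<bullet> e1 = 1" "e2 \<bullet> e2 = 1" "e3 \<bullet> e3 = 1" "e1 \<bullet> e2 = 0" "e1 \<bullet> e3 = 0" "e2 \<bullet> e3 = 0"
    and parseval: "\<And>x. x \<bullet> x = (x \<bullet> e1)\<^sup>2 + (x \<bullet> e2)\<^sup>2 + (x \<bullet> e3)\<^sup>2"
  defines "N \<equiv> map_matrix complex_of_real (frame_matrix a e1 e2 e3)"
    and "g1 \<equiv> complex_of_real ((c - a) \<bullet> e1)" and "g2 \<equiv> complex_of_real ((c - a) \<bullet> e2)"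
    and "g3 \<equiv> complex_of_real ((c - a) \<bullet> e3)"
  shows "transpose N ** sphere_matrix c r ** N = vector
     [vector [g1\<^sup>2 + g2\<^sup>2 + g3\<^sup>2 - complex_of_real (r\<^sup>2), - g1, - g2, - g3],
      vector [- g1, 1, 0, 0], vector [- g2, 0, 1, 0], vector [- g3, 0, 0, 1]]"
proof -
  define F where "F = frame_matrix a e1 e2 e3"
  define Q :: "real^4^4" where "Q = vector
     [vector [      1,       0,       0,               - (c$1)],
      vector [      0,       1,       0,               - (c$2)],
      vector [      0,       0,       1,               - (c$3)],
      vector [- (c$1), - (c$2), - (c$3), (norm c)\<^sup>2 - r\<^sup>2]]"
  define G :: "real^4^4" where "G = vector
     [vector [(c - a) \<bullet> (c - a) - r\<^sup>2, - ((c - a) \<bullet> e1), - ((c - a) \<bullet> e2), - ((c - a) \<bullet> e3)],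
      vector [- ((c - a) \<bullet> e1), e1 \<bullet> e1, e1 \<bullet> e2, e1 \<bullet> e3],
      vector [- ((c - a) \<bullet> e2), e1 \<bullet> e2, e2 \<bullet> e2, e2 \<bullet> e3],
      vector [- ((c - a) \<bullet> e3), e1 \<bullet> e3, e2 \<bullet> e3, e3 \<bullet> e3]]"
  have "transpose F ** Q ** F = G"
    unfolding vec_eq_iff forall_4 matrix_mult_entry sum_4 transpose_def F_def frame_matrix_def Q_def G_def
    by (simp add: inner_vec_def sum_3 power2_norm_eq_inner algebra_simps)
  then have "map_matrix complex_of_real (transpose F) ** map_matrix complex_of_real Q ** map_matrix complex_of_real F
      = map_matrix complex_of_real G"
    by (simp only: map_matrix_mult[symmetric])
  moreover have "map_matrix complex_of_real (transpose F) = transpose N"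
    by (simp add: vec_eq_iff map_matrix_def transpose_def N_def F_def)
  moreover have "map_matrix complex_of_real G = vector
     [vector [g1\<^sup>2 + g2\<^sup>2 + g3\<^sup>2 - complex_of_real (r\<^sup>2), - g1, - g2, - g3],
      vector [- g1, 1, 0, 0], vector [- g2, 0, 1, 0], vector [- g3, 0, 0, 1]]"
    unfolding vec_eq_iff forall_4 G_def parseval[of "c - a"] e
    by (simp add: map_matrix_def g1_def g2_def g3_def)
  ultimately show ?thesis by (simp only: sphere_matrix_def Q_def[symmetric] N_def F_def)
qed

abbreviation line_form :: "real^3 \<Rightarrow> real^3 \<Rightarrow> plucker_poly" where
  "line_form a b \<equiv> meeting_form (plucker_vector (homogenize a) (homogenize b))"

text \<open>Since the wedge product is alternating, the line has Pluecker vector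
  \<open>t (a \<and> e1)\<close>, and \<open>a\<close>, \<open>e1\<close> give the first two columns
  of the frame matrix.\<close>

lemma line_form_frame:
  assumes "b = a + t *\<^sub>R e1"
  shows "line_form a b = Const (complex_of_real t)
    * meeting_form (\<chi> \<alpha>. wedge2 (map_matrix complex_of_real (frame_matrix a e1 e2 e3)) $ \<alpha> $ P12)"
proof -
  have "plucker_vector (homogenize a) (homogenize b) $ \<alpha>
      = complex_of_real t * (wedge2 (map_matrix complex_of_real (frame_matrix a e1 e2 e3)) $ \<alpha> $ P12)" for \<alpha>
    by (cases \<alpha>; simp add: plucker_vector_def homogenize_def assms wedge2_def map_matrix_def frame_matrix_def; simp add: algebra_simps)
  then have "plucker_vector (homogenize a) (homogenize b)
      = (\<chi> \<alpha>. complex_of_real t * (wedge2 (map_matrix complex_of_real (frame_matrix a e1 e2 e3)) $ \<alpha> $ P12))"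
    by (simp add: vec_eq_iff)
  then show ?thesis by (simp only: meeting_form_scale)
qed

text \<open>\<phi> is the change to the frame followed by \<open>param\<close>. In the frame the
  hyperplane form is a nonzero multiple of \<open>Var P34\<close>, which is the case treated above.
  The map \<open>y\<close> takes a centre to its frame coordinates.\<close>

lemma line_parametrisation:
  fixes a b :: "real^3"
  assumes "a \<noteq> b"
  obtains \<phi> :: "plucker_poly \<Rightarrow> plucker_poly" and y :: "real^3 \<Rightarrow> real^3" where
    "ring_morphism \<phi>" "\<And>c. \<phi> (Const c) = Const c" "\<And>d. \<phi> ` homogeneous_part d = balanced d"
    "\<phi> plucker_relation = 0" "\<phi> (line_form a b) = 0"
    "\<And>f. \<phi> f = 0 \<Longrightarrow> f \<in> ideal.span {plucker_relation, line_form a b}"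
    "inj y"
    "\<And>c r. \<phi> (tangency_form (sphere_matrix c r)) = sphere_form (complex_of_real (y c $ 1))
       (complex_of_real (y c $ 2)) (complex_of_real (y c $ 3)) (complex_of_real (r\<^sup>2))"
proof -
  have ba: "b - a \<noteq> 0" using assms by simp
  obtain e1 e2 e3 where e0: "b - a = norm (b - a) *\<^sub>R e1"
    and e: "e1 \<bullet> e1 = 1" "e2 \<bullet> e2 = 1" "e3 \<bullet> e3 = 1" "e1 \<bullet> e2 = 0" "e1 \<bullet> e3 = 0" "e2 \<bullet> e3 = 0"
    and parseval: "\<forall>x. x \<bullet> x = (x \<bullet> e1)\<^sup>2 + (x \<bullet> e2)\<^sup>2 + (x \<bullet> e3)\<^sup>2"
    by (rule orthonormal_frame[OF ba])
  define N where "N = map_matrix complex_of_real (frame_matrix a e1 e2 e3)"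
  obtain MR where MR: "MR ** frame_matrix a e1 e2 e3 = mat 1" "frame_matrix a e1 e2 e3 ** MR = mat 1"
    by (rule frame_matrix_inverse[OF e])
  define M where "M = map_matrix complex_of_real MR"
  have map1: "map_matrix complex_of_real (mat 1) = mat 1"
    by (simp add: vec_eq_iff map_matrix_def mat_def)
  have MN: "M ** N = mat 1" "N ** M = mat 1"
    unfolding M_def N_def map_matrix_mult[symmetric] MR by (rule map1)+
  have inv: "change M (change N f) = f" "change N (change M f) = f" for f
    by (simp_all only: change_change MN change_mat_1)
  define k where "k = wedge_det N"
  define t where "t = complex_of_real (norm (b - a))"
  have t: "t \<noteq> 0" using assms by (simp add: t_def)
  \<comment> \<open>The change of coordinates is invertible, so it cannot annihilate the Pluecker
    relation, which it multiplies by \<open>k\<close>.\<close>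
  have k: "k \<noteq> 0"
  proof
    assume "k = 0"
    then have "change N plucker_relation = 0"
      unfolding change_plucker_relation k_def by (simp add: Const.zero)
    then have "plucker_relation = 0" by (metis inv(1) change.zero)
    then show False using plucker_relation_nonzero by simp
  qed
  define \<Lambda> where "\<Lambda> = line_form a b"
  have "b = a + norm (b - a) *\<^sub>R e1" by (metis add_diff_cancel_left' add_diff_eq e0)
  from line_form_frame[OF this, of e2 e3]
  have \<Lambda>: "\<Lambda> = Const t * meeting_form (\<chi> \<alpha>. wedge2 N $ \<alpha> $ P12)" unfolding t_def N_def \<Lambda>_def .
  have N\<Lambda>: "change N \<Lambda> = Const (t * k) * Var P34"
    unfolding \<Lambda> change.mult change_Const change_meeting_form k_def by (simp only: Const.mult mult.assoc)
  have "\<Lambda> = change M (Const (t * k) * Var P34)" unfolding N\<Lambda>[symmetric] inv ..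
  then have "Const (1 / (t * k)) * \<Lambda> = Const (1 / (t * k) * (t * k)) * change M (Var P34)"
    by (simp only: change.mult change_Const Const.mult mult.assoc)
  then have M34: "change M (Var P34) = Const (1 / (t * k)) * \<Lambda>"
    using t k by (simp add: Const.one)
  define \<phi> where "\<phi> f = param (change N f)" for f
  interpret \<phi>: ring_morphism \<phi>
    unfolding \<phi>_def by (rule ring_morphism_comp[OF ring_morphism_change ring_morphism_param])
  have hom: "change N ` homogeneous_part d = homogeneous_part d" for d
  proof
    show "homogeneous_part d \<subseteq> change N ` homogeneous_part d"
      using change_homogeneous[of _ d M] inv(2) by (metis image_eqI subsetI)
  qed (use change_homogeneous in blast)
  define y :: "real^3 \<Rightarrow> real^3" where "y c = vector [(c - a) \<bullet> e1, (c - a) \<bullet> e2, (c - a) \<bullet> e3]" for c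
  show thesis
  proof (rule that[of \<phi> y])
    show "ring_morphism \<phi>" by (rule \<phi>.ring_morphism_axioms)
    show "\<phi> (Const c) = Const c" for c by (simp add: \<phi>_def change_Const param_Const)
    show "\<phi> ` homogeneous_part d = balanced d" for d
      unfolding \<phi>_def image_image[of param "change N", symmetric] hom by (rule param_homogeneous_part)
    show "\<phi> plucker_relation = 0"
      unfolding \<phi>_def change_plucker_relation param.mult param_plucker_relation by simp
    show "\<phi> (line_form a b) = 0"
      unfolding \<phi>_def \<Lambda>_def[symmetric] N\<Lambda> param.mult param_Var by simp
    show "f \<in> ideal.span {plucker_relation, line_form a b}" if "\<phi> f = 0" for f
    proof -
      \<comment> \<open>The kernel is known in the frame; its two generators are carried back by the
        inverse change.\<close>
      have "change N f \<in> ideal.span {plucker_relation, Var P34}"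
        using that unfolding \<phi>_def by (rule param_kernel)
      then obtain p q where pq: "change N f = p * plucker_relation + q * Var P34"
        unfolding ideal.span_insert ideal.span_empty by (auto simp: algebra_simps)
      have "f = change M (change N f)" by (simp only: inv)
      also have "\<dots> = change M p * (Const (wedge_det M) * plucker_relation) + change M q * (Const (1 / (t * k)) * \<Lambda>)"
        unfolding pq change.hom_simps change_plucker_relation M34 ..
      finally show ?thesis
        unfolding \<Lambda>_def[symmetric] by (simp only:) (intro ideal.span_add ideal.span_scale ideal.span_base, simp_all)
    qed
    show "inj y"
    proof (rule injI)
      fix c c' assume "y c = y c'"
      then have "y c $ i = y c' $ i" for i by simp
      from this[of 1] this[of 2] this[of 3]
      have "(c - c') \<bullet> e1 = 0" "(c - c') \<bullet> e2 = 0" "(c - c') \<bullet> e3 = 0"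
        by (simp_all add: y_def inner_diff_left)
      then have "(c - c') \<bullet> (c - c') = 0" unfolding parseval[rule_format, of "c - c'"] by simp
      then show "c = c'" by simp
    qed
    show "\<phi> (tangency_form (sphere_matrix c r)) = sphere_form (complex_of_real (y c $ 1))
       (complex_of_real (y c $ 2)) (complex_of_real (y c $ 3)) (complex_of_real (r\<^sup>2))" for c r
      unfolding \<phi>_def change_tangency_form N_def sphere_gram_matrix[OF e parseval[rule_format]] param_tangency_form
      by (simp add: y_def)
  qed
qed

section \<open>Saturation and Hilbert function\<close>

text \<open>The form has a zero with \<open>w = 1\<close>: at \<sigma> = v = 0 and \<tau> = 1 it is
  the quadratic \<open>u\<^sup>2 + 2 g2 u + \<rho>\<close>, which has a complex root.\<close>

lemma sphere_form_not_dvd_power: "\<not> sphere_form g1 g2 g3 r dvd Var P12 ^ n"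
proof
  assume "sphere_form g1 g2 g3 r dvd Var P12 ^ n"
  then obtain q where q: "Var P12 ^ n = sphere_form g1 g2 g3 r * q" by (rule dvdE)
  define \<rho> where "\<rho> = g2\<^sup>2 + g3\<^sup>2 - r"
  define u where "u = csqrt (g2\<^sup>2 - \<rho>) - g2"
  have root: "u\<^sup>2 + 2 * g2 * u + \<rho> = 0"
    using power2_csqrt[of "g2\<^sup>2 - \<rho>"] by (simp add: u_def power2_eq_square algebra_simps)
  define p where "p \<alpha> = (case \<alpha> of P12 \<Rightarrow> 1 | P14 \<Rightarrow> 1 | P23 \<Rightarrow> u | _ \<Rightarrow> 0)" for \<alpha>
  interpret ev: ring_morphism "subst (\<lambda>c. c) p" by (intro ring_morphism_subst ring_morphism_id)
  have "subst (\<lambda>c. c) p (sphere_form g1 g2 g3 r) = 0"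
    using root by (simp add: value_sphere_form p_def \<rho>_def mult.assoc)
  then have "subst (\<lambda>c. c) p (Var P12 ^ n) = 0" unfolding q ev.mult by simp
  then show False by (simp add: ev.power subst_Var[OF ring_morphism_id] p_def)
qed

text \<open>In every term of the binomial expansion with exponent \<open>m + n\<close>, either
  \<open>l\<close> occurs at least \<open>m\<close> times or \<open>l'\<close> at least
  \<open>n\<close> times.\<close>

lemma power_mult_in_ideal_add:
  assumes "l ^ m * f \<in> ideal.span G" "l' ^ n * f \<in> ideal.span G"
  shows "\<exists>k. (l + l') ^ k * f \<in> ideal.span G"
proof
  have "(l + l') ^ (m + n) * f = (\<Sum>k\<le>m + n. of_nat (m + n choose k) * l ^ k * l' ^ (m + n - k) * f)"
    by (simp only: binomial_ring sum_distrib_right)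
  also have "\<dots> \<in> ideal.span G"
  proof (rule ideal.span_sum)
    fix k assume "k \<in> {..m + n}"
    show "of_nat (m + n choose k) * l ^ k * l' ^ (m + n - k) * f \<in> ideal.span G"
    proof (cases "m \<le> k")
      case True
      then have "l ^ k = l ^ (k - m) * l ^ m" by (simp flip: power_add)
      then have "of_nat (m + n choose k) * l ^ k * l' ^ (m + n - k) * f
          = (of_nat (m + n choose k) * l ^ (k - m) * l' ^ (m + n - k)) * (l ^ m * f)"
        by (simp only: mult.assoc mult.commute mult.left_commute)
      then show ?thesis using assms(1) by (simp only: ideal.span_scale)
    next
      case False
      then have "m + n - k = (m - k) + n" by simp
      then have "of_nat (m + n choose k) * l ^ k * l' ^ (m + n - k) * f
          = (of_nat (m + n choose k) * l ^ k * l' ^ (m - k)) * (l' ^ n * f)"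
        by (simp only: power_add mult.assoc mult.commute mult.left_commute)
      then show ?thesis using assms(2) by (simp only: ideal.span_scale)
    qed
  qed
  finally show "(l + l') ^ (m + n) * f \<in> ideal.span G" .
qed

lemma linear_form_expand:
  assumes "l \<in> homogeneous_part 1"
  obtains c where "l = (\<Sum>\<alpha>\<in>UNIV. Const (c \<alpha>) * Var \<alpha>)"
proof -
  have "\<exists>\<alpha>. t = Poly_Mapping.single \<alpha> 1" if "t \<in> Poly_Mapping.keys l" for t
  proof -
    have "(\<Sum>\<alpha>\<in>UNIV. expo t \<alpha>) = 1" using assms that by (simp add: homogeneous_part_def)
    then obtain \<alpha> where \<alpha>: "expo t \<alpha> = 1" "\<forall>\<beta>. \<beta> \<noteq> \<alpha> \<longrightarrow> expo t \<beta> = 0"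
      using sum_eq_1_iff[of UNIV "expo t"] by auto
    then have "t = Poly_Mapping.single \<alpha> 1"
      by (intro poly_mapping_eqI) (auto simp: lookup_single when_def)
    then show ?thesis ..
  qed
  then have sub: "Poly_Mapping.keys l \<subseteq> (\<lambda>\<alpha>. Poly_Mapping.single \<alpha> 1) ` UNIV" by auto
  have inj: "inj (\<lambda>\<alpha>::plucker. Poly_Mapping.single \<alpha> (1::nat))"
    by (rule injI) (metis keys_single singleton_inject one_neq_zero)
  have "l = (\<Sum>t\<in>(\<lambda>\<alpha>. Poly_Mapping.single \<alpha> 1) ` UNIV. Const (Poly_Mapping.lookup l t) * monomial t)"
  proof -
    have "(\<Sum>t\<in>Poly_Mapping.keys l. Const (Poly_Mapping.lookup l t) * monomial t)
        = (\<Sum>t\<in>(\<lambda>\<alpha>. Poly_Mapping.single \<alpha> 1) ` UNIV. Const (Poly_Mapping.lookup l t) * monomial t)"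
      by (rule sum.mono_neutral_left) (use sub in \<open>auto simp: in_keys_iff Const.zero\<close>)
    then show ?thesis using poly_expand[of l] by simp
  qed
  also have "\<dots> = (\<Sum>\<alpha>\<in>UNIV. Const (Poly_Mapping.lookup l (Poly_Mapping.single \<alpha> 1)) * Var \<alpha>)"
    using inj by (simp add: sum.reindex Var_def)
  finally show thesis by (rule that)
qed

text \<open>Saturation is defined through the variables, but the parameters \<open>w\<close> and
  \<open>\<sigma> v\<close> come from linear forms adapted to the frame.\<close>

lemma saturation_linear_form:
  assumes f: "f \<in> saturation (ideal.span G)" and l: "l \<in> homogeneous_part 1"
  shows "\<exists>n. l ^ n * f \<in> ideal.span G"
proof -
  obtain c where c: "l = (\<Sum>\<alpha>\<in>UNIV. Const (c \<alpha>) * Var \<alpha>)" using l by (rule linear_form_expand)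
  have "\<exists>n. (\<Sum>\<alpha>\<in>A. Const (c \<alpha>) * Var \<alpha>) ^ n * f \<in> ideal.span G" if "finite A" for A
    using that
  proof (induction A rule: finite_induct)
    case empty
    have "0 ^ 1 * f \<in> ideal.span G" by (simp add: ideal.span_zero)
    then show ?case by (metis sum.empty)
  next
    case (insert \<alpha> A)
    obtain n where "Var \<alpha> ^ n * f \<in> ideal.span G" using f unfolding saturation_def by blast
    then have "(Const (c \<alpha>) * Var \<alpha>) ^ n * f \<in> ideal.span G"
      by (simp only: power_mult_distrib mult.assoc ideal.span_scale)
    then have "\<exists>k. (Const (c \<alpha>) * Var \<alpha> + (\<Sum>\<alpha>\<in>A. Const (c \<alpha>) * Var \<alpha>)) ^ k * f \<in> ideal.span G"
      using insert.IH power_mult_in_ideal_add by blast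
    then show ?case using insert.hyps by simp
  qed
  then show ?thesis unfolding c by simp
qed

lemma ideal_subset_saturation: "ideal.span G \<subseteq> saturation (ideal.span G)"
proof
  fix f assume "f \<in> ideal.span G"
  then have "Var \<alpha> ^ 0 * f \<in> ideal.span G" for \<alpha> by simp
  then show "f \<in> saturation (ideal.span G)" unfolding saturation_def by blast
qed

lemma pencilI: "a \<in> balanced d \<Longrightarrow> b \<in> balanced d \<Longrightarrow> S1 * a + S2 * b \<in> pencil S1 S2 d"
  unfolding pencil_def by blast

lemma subspace_pencil: "poly_vs.subspace (pencil S1 S2 d)"
proof (rule poly_vs.subspaceI)
  show "0 \<in> pencil S1 S2 d" using pencilI[OF graded_zero graded_zero, where d = d] by simp
next
  fix x y assume "x \<in> pencil S1 S2 d" "y \<in> pencil S1 S2 d"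
  then obtain a b a' b' where x: "x = S1 * a + S2 * b" "a \<in> balanced d" "b \<in> balanced d"
    and y: "y = S1 * a' + S2 * b'" "a' \<in> balanced d" "b' \<in> balanced d" unfolding pencil_def by auto
  have "x + y = S1 * (a + a') + S2 * (b + b')" unfolding x y by (simp only: distrib_left add.assoc add.commute add.left_commute)
  then show "x + y \<in> pencil S1 S2 d" using pencilI graded_add x y by metis
next
  fix c x assume "x \<in> pencil S1 S2 d"
  then obtain a b where x: "x = S1 * a + S2 * b" "a \<in> balanced d" "b \<in> balanced d" unfolding pencil_def by auto
  have "Const c * x = S1 * (Const c * a) + S2 * (Const c * b)" unfolding x by (simp only: distrib_left mult.left_commute)
  then show "Const c * x \<in> pencil S1 S2 d" using pencilI tridegree.graded_mult_Const x by metis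
qed

text \<open>The map \<open>\<phi>\<close> substitutes a parametrisation of the lines that satisfy \<open>\<Lambda> = 0\<close>.\<close>

locale parametrised_tangents =
  fixes \<phi> :: "plucker_poly \<Rightarrow> plucker_poly" and \<Lambda> T1 T2 S1 S2 :: plucker_poly and g1 g2 g3 r h1 h2 h3 s :: complex
  assumes morphism: "ring_morphism \<phi>"
    and \<phi>_Const: "\<And>c. \<phi> (Const c) = Const c"
    and \<phi>_image: "\<And>d. \<phi> ` homogeneous_part d = balanced d"
    and \<phi>_relations: "\<phi> plucker_relation = 0" "\<phi> \<Lambda> = 0"
    and \<phi>_kernel: "\<And>f. \<phi> f = 0 \<Longrightarrow> f \<in> ideal.span {plucker_relation, \<Lambda>}"
    and \<phi>_forms: "\<phi> T1 = S1" "\<phi> T2 = S2"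
    and S: "S1 = sphere_form g1 g2 g3 r" "S2 = sphere_form h1 h2 h3 s" "r \<noteq> 0" "s \<noteq> 0"
    and T_homogeneous: "T1 \<in> homogeneous_part 2" "T2 \<in> homogeneous_part 2"
begin

sublocale \<phi>: ring_morphism \<phi> by (rule morphism)

abbreviation generators :: "plucker_poly set" where
  "generators \<equiv> {plucker_relation, \<Lambda>, T1, T2}"

lemma \<phi>_ideal:
  assumes "f \<in> ideal.span generators"
  obtains a b where "\<phi> f = S1 * a + S2 * b"
proof -
  from assms have "\<exists>a b. \<phi> f = S1 * a + S2 * b"
  proof (induction rule: ideal.span_induct_alt)
    case base
    have "\<phi> 0 = S1 * 0 + S2 * 0" by (simp add: \<phi>.zero)
    then show ?case by blast
  next
    case (step c x f)
    then obtain a b where ab: "\<phi> f = S1 * a + S2 * b" by blast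
    have "\<phi> x = 0 \<or> \<phi> x = S1 \<or> \<phi> x = S2" using step(1) \<phi>_relations \<phi>_forms by auto
    then consider "\<phi> (c * x + f) = S1 * a + S2 * b" | "\<phi> (c * x + f) = S1 * (\<phi> c + a) + S2 * b"
      | "\<phi> (c * x + f) = S1 * a + S2 * (\<phi> c + b)"
      by (auto simp: \<phi>.add \<phi>.mult ab distrib_left mult.commute add.assoc add.left_commute)
    then show ?case by cases blast+
  qed
  then show thesis using that by blast
qed

lemma \<phi>_saturation:
  assumes f: "f \<in> saturation (ideal.span generators)"
  obtains n a1 b1 a2 b2 where "Var P12 ^ n * \<phi> f = S1 * a1 + S2 * b1"
    "(Var P13 * Var P24) ^ n * \<phi> f = S1 * a2 + S2 * b2"
proof -
  \<comment> \<open>Stated for all large exponents so that one exponent serves both parameter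
    forms.\<close>
  have lin: "\<exists>n. \<forall>m\<ge>n. \<exists>a b. x ^ m * \<phi> f = S1 * a + S2 * b" if x: "x \<in> balanced 1" for x
  proof -
    obtain l where l: "l \<in> homogeneous_part 1" "\<phi> l = x" using x unfolding \<phi>_image[symmetric] by blast
    obtain n where n: "l ^ n * f \<in> ideal.span generators" using saturation_linear_form[OF f l(1)] by blast
    have "\<exists>a b. x ^ m * \<phi> f = S1 * a + S2 * b" if "n \<le> m" for m
    proof -
      have "l ^ (m - n) * (l ^ n * f) \<in> ideal.span generators" using n by (rule ideal.span_scale)
      then obtain a b where "\<phi> (l ^ (m - n) * (l ^ n * f)) = S1 * a + S2 * b" by (rule \<phi>_ideal)
      moreover have "\<phi> (l ^ (m - n) * (l ^ n * f)) = x ^ m * \<phi> f"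
        using \<open>n \<le> m\<close> by (simp add: \<phi>.mult \<phi>.power l(2) mult.assoc[symmetric] flip: power_add)
      ultimately show ?thesis by metis
    qed
    then show ?thesis by blast
  qed
  have "Var P12 \<in> balanced 1" "Var P13 * Var P24 \<in> balanced 1"
    by (simp_all add: graded_def Var_def mult_single tridegree_def lookup_single lookup_add)
  then obtain n n' where n: "\<forall>m\<ge>n. \<exists>a b. Var P12 ^ m * \<phi> f = S1 * a + S2 * b"
    and n': "\<forall>m\<ge>n'. \<exists>a b. (Var P13 * Var P24) ^ m * \<phi> f = S1 * a + S2 * b"
    using lin by meson
  then show thesis using that[of "max n n'"] by (meson max.cobounded1 max.cobounded2)
qed

lemma S_balanced: "S1 \<in> balanced 2" "S2 \<in> balanced 2"
  unfolding S by (rule sphere_form_balanced)+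

text \<open>One direction is saturatedness in the parameters followed by projection to one degree.
  For the other, the coefficients are lifted along \<phi>, and the error lies in its kernel, hence
  in the ideal.\<close>

lemma saturation_pencil:
  assumes "S1 \<noteq> S2" and f: "f \<in> homogeneous_part (d + 2)"
  shows "f \<in> saturation (ideal.span generators) \<longleftrightarrow> \<phi> f \<in> pencil S1 S2 d"
proof
  assume "f \<in> saturation (ideal.span generators)"
  then obtain n a1 b1 a2 b2 where "Var P12 ^ n * \<phi> f = S1 * a1 + S2 * b1"
    "(Var P13 * Var P24) ^ n * \<phi> f = S1 * a2 + S2 * b2" by (rule \<phi>_saturation)
  then obtain a b where ab: "\<phi> f = S1 * a + S2 * b"
    using sphere_forms_saturated[OF S(1,2) assms(1) S(4)] by blast
  \<comment> \<open>\<open>a\<close> and \<open>b\<close> need not be homogeneous; only their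
    components of degree \<open>d\<close> matter in degree \<open>d + 2\<close>.\<close>
  let ?R = "\<lambda>d. restrict_keys (\<lambda>t. tridegree t = (d, d, 0))"
  have "\<phi> f \<in> balanced (d + 2)" using f \<phi>_image by blast
  then have "\<phi> f = ?R (2 + d) (\<phi> f)" by (simp add: restrict_graded_id add.commute)
  also have "\<dots> = ?R (2 + d) (S1 * a) + ?R (2 + d) (S2 * b)" unfolding ab by (rule restrict_keys_add)
  also have "?R (2 + d) (S1 * a) = S1 * ?R d a"
    using tridegree.restrict_graded_mult[OF S_balanced(1), of "(d, d, 0)" a] by simp
  also have "?R (2 + d) (S2 * b) = S2 * ?R d b"
    using tridegree.restrict_graded_mult[OF S_balanced(2), of "(d, d, 0)" b] by simp
  finally show "\<phi> f \<in> pencil S1 S2 d" using pencilI[OF restrict_graded restrict_graded] by metis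
next
  assume "\<phi> f \<in> pencil S1 S2 d"
  then obtain a b where "\<phi> f = S1 * \<phi> a + S2 * \<phi> b"
    unfolding pencil_def \<phi>_image[symmetric] by auto
  then have "\<phi> (f - (a * T1 + b * T2)) = 0"
    by (simp add: \<phi>.diff \<phi>.add \<phi>.mult \<phi>_forms mult.commute)
  then have "f - (a * T1 + b * T2) \<in> ideal.span {plucker_relation, \<Lambda>}" by (rule \<phi>_kernel)
  then have "f - (a * T1 + b * T2) \<in> ideal.span generators"
    using ideal.span_mono[of "{plucker_relation, \<Lambda>}" generators] by blast
  moreover have "a * T1 + b * T2 \<in> ideal.span generators"
    by (intro ideal.span_add ideal.span_scale ideal.span_base) simp_all
  ultimately have "f - (a * T1 + b * T2) + (a * T1 + b * T2) \<in> ideal.span generators" by (rule ideal.span_add)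
  then have "f \<in> ideal.span generators" by simp
  then show "f \<in> saturation (ideal.span generators)" using ideal_subset_saturation by blast
qed

lemma \<phi>_linear: "Vector_Spaces.linear (\<lambda>c f. Const c * f) (\<lambda>c f. Const c * f) \<phi>"
  unfolding Vector_Spaces.linear_iff using poly_vs.vector_space_axioms
  by (auto simp: \<phi>.add \<phi>.mult \<phi>_Const)

text \<open>The kernel of \<phi> in this degree lies in the ideal, so it adds the same
  \<open>K\<close> to both dimensions and cancels. What remains is the count for the pencil in the
  balanced polynomials.\<close>

lemma hilbert_function_tangents:
  assumes "S1 \<noteq> S2"
  shows "hilbert_function (saturation (ideal.span generators)) (d + 4) = 8 * d + 28"
proof -
  let ?H = "homogeneous_part (d + 4)" and ?X = "saturation (ideal.span generators)"
  let ?F = "monomial ` {t. total_degree t = d + 4}"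
  define K where "K = poly_vs.dim {x \<in> ?H. \<phi> x = 0}"
  have span: "?H \<subseteq> poly_vs.span ?F" unfolding homogeneous_part_eq_graded by (rule graded_subset_span)
  have fin: "finite ?F" using finite_total_degree by simp
  have H: "poly_vs.subspace ?H" unfolding homogeneous_part_eq_graded by (rule subspace_graded)
  have mem: "f \<in> ?X \<longleftrightarrow> \<phi> f \<in> pencil S1 S2 (d + 2)" if "f \<in> ?H" for f
  proof -
    have "d + 2 + 2 = d + 4" by simp
    from saturation_pencil[OF assms, of f "d + 2", unfolded this] that show ?thesis by blast
  qed
  have X: "poly_vs.subspace (?X \<inter> ?H)"
  proof -
    have eq: "?X \<inter> ?H = {f \<in> ?H. \<phi> f \<in> pencil S1 S2 (d + 2)}" using mem by blast
    show ?thesis unfolding eq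
      using poly_vs.subspace_0[OF H] poly_vs.subspace_add[OF H] poly_vs.subspace_scale[OF H]
        poly_vs.subspace_0[OF subspace_pencil] poly_vs.subspace_add[OF subspace_pencil] poly_vs.subspace_scale[OF subspace_pencil]
      by (intro poly_vs.subspaceI) (auto simp: \<phi>.zero \<phi>.add \<phi>.mult \<phi>_Const)
  qed
  have "\<phi> ` (?X \<inter> ?H) = pencil S1 S2 (d + 2)"
  proof
    show "\<phi> ` (?X \<inter> ?H) \<subseteq> pencil S1 S2 (d + 2)" using mem by blast
    show "pencil S1 S2 (d + 2) \<subseteq> \<phi> ` (?X \<inter> ?H)"
    proof
      fix g assume g: "g \<in> pencil S1 S2 (d + 2)"
      then obtain a b where ab: "g = S1 * a + S2 * b" "a \<in> balanced (d + 2)" "b \<in> balanced (d + 2)"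
        unfolding pencil_def by blast
      have "2 + (d + 2) = d + 4" by simp
      then have "S1 * a \<in> balanced (d + 4)" "S2 * b \<in> balanced (d + 4)"
        using balanced_mult[OF S_balanced(1) ab(2)] balanced_mult[OF S_balanced(2) ab(3)] by (simp_all only:)
      then have "g \<in> balanced (d + 4)" unfolding ab(1) by (rule graded_add)
      then obtain f where "f \<in> ?H" "g = \<phi> f" using \<phi>_image by blast
      then show "g \<in> \<phi> ` (?X \<inter> ?H)" using mem g by blast
    qed
  qed
  moreover have "{x \<in> ?X \<inter> ?H. \<phi> x = 0} = {x \<in> ?H. \<phi> x = 0}"
    using mem poly_vs.subspace_0[OF subspace_pencil] by auto
  ultimately have "poly_vs.dim (?X \<inter> ?H) = poly_vs.dim (pencil S1 S2 (d + 2)) + K"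
    using poly_vs.rank_nullity[OF \<phi>_linear X _ fin] span unfolding K_def by (simp only: le_infI2)
  moreover have "poly_vs.dim ?H = balanced_dim (d + 4) + K"
    using poly_vs.rank_nullity[OF \<phi>_linear H span fin] unfolding K_def \<phi>_image dim_balanced .
  ultimately show ?thesis
    using dim_balanced_mod_pencil[OF S(1,2) assms S(4), of d] unfolding hilbert_function_def by simp
qed

lemma tangents_curve_of_degree_8:
  assumes "S1 \<noteq> S2"
  shows "is_curve_of_degree (saturation (ideal.span generators)) 8"
proof -
  \<comment> \<open>The value \<open>8 * e + 28\<close> at \<open>e + 4\<close> is that of 8 d -
    4.\<close>
  have "is_hilbert_polynomial (saturation (ideal.span generators)) [:- 4, 8:]"
    unfolding is_hilbert_polynomial_def
  proof (rule eventually_sequentiallyI)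
    fix d :: nat assume "4 \<le> d"
    then obtain e where "d = e + 4" by (metis add.commute le_Suc_ex)
    then show "real (hilbert_function (saturation (ideal.span generators)) d) = poly [:- 4, 8:] (real d)"
      using hilbert_function_tangents[OF assms, of e] by simp
  qed
  then show ?thesis
    unfolding is_curve_of_degree_def has_dim_and_degree_def by (intro exI[of _ "[:- 4, 8:]"]) simp
qed

text \<open>Serves to rule out a rival pair of equal spheres. The form is prime and divides no power
  of \<open>w\<close>, so it must divide the other factor.\<close>

lemma saturation_single_form:
  assumes "S1 = S2" "f \<in> saturation (ideal.span generators)"
  shows "S1 dvd \<phi> f"
proof -
  obtain n a b where n: "Var P12 ^ n * \<phi> f = S1 * a + S2 * b" using \<phi>_saturation[OF assms(2)] by blast
  have "Var P12 ^ n * \<phi> f = S1 * (a + b)" unfolding n assms(1)[symmetric] by (simp only: distrib_left)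
  then have "S1 dvd Var P12 ^ n * \<phi> f" by (metis dvd_triv_left)
  then show ?thesis using sphere_form_dvd_mult[OF S(3)] sphere_form_not_dvd_power unfolding S(1) by blast
qed

end

section \<open>Common real tangents\<close>

text \<open>A line that is not perpendicular to the radius at \<open>p\<close> would meet the sphere
  in a second point; perpendicularity makes \<open>p\<close> the point of \<open>L\<close> nearest
  to the centre.\<close>

lemma tangent_to_sphere_distance:
  assumes "tangent_to_sphere L (sphere c r)" "r > 0"
  obtains p where "p \<in> L" "dist c p = r" "\<And>q. q \<in> L \<Longrightarrow> r \<le> dist c q"
proof -
  obtain p where L: "is_line L" and p: "L \<inter> sphere c r = {p}"
    using assms(1) unfolding tangent_to_sphere_def by blast
  have aff: "affine L" using L unfolding is_line_def by simp
  have pL: "p \<in> L" and pr: "dist c p = r" using p by auto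
  have "r \<le> dist c q" if q: "q \<in> L" for q
  proof -
    define v where "v = q - p"
    define s where "s = v \<bullet> (p - c)"
    have "s = 0"
    proof (rule ccontr)
      assume s: "s \<noteq> 0"
      then have v: "v \<bullet> v \<noteq> 0" by (auto simp: s_def)
      \<comment> \<open>The nonzero root of the quadratic equation for the points
        \<open>p + t *\<^sub>R v\<close> on the sphere.\<close>
      define t where "t = - 2 * s / (v \<bullet> v)"
      define x where "x = p + t *\<^sub>R v"
      have "x = (1 - t) *\<^sub>R p + t *\<^sub>R q" by (simp add: x_def v_def algebra_simps)
      then have "x \<in> L" using aff pL q unfolding affine_alt by simp
      have "(x - c) \<bullet> (x - c) = (p - c) \<bullet> (p - c) + t * (2 * s + t * (v \<bullet> v))"
        by (simp add: x_def s_def inner_diff_left inner_diff_right inner_add_left inner_add_right inner_commute algebra_simps)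
      also have "2 * s + t * (v \<bullet> v) = 0" using v by (simp add: t_def)
      finally have "norm (x - c) = norm (p - c)" by (simp add: norm_eq_sqrt_inner)
      then have "x \<in> L \<inter> sphere c r" using \<open>x \<in> L\<close> pr by (simp add: dist_norm norm_minus_commute)
      then have "x = p" using p by blast
      then show False using s v by (auto simp: x_def t_def)
    qed
    then have "(q - c) \<bullet> (q - c) = (p - c) \<bullet> (p - c) + v \<bullet> v"
      by (simp add: s_def v_def inner_diff_left inner_diff_right inner_commute algebra_simps)
    then have "norm (p - c) \<le> norm (q - c)" by (simp add: norm_eq_sqrt_inner)
    then show ?thesis using pr by (simp add: dist_norm norm_minus_commute)
  qed
  then show thesis using that pL pr by blast
qed

text \<open>Both radii equal the distance from \<open>c\<close> to \<open>L\<close>.\<close>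

lemma concentric_spheres_no_common_tangent:
  assumes "r1 > 0" "r2 > 0" "tangent_to_sphere L (sphere c r1)" "tangent_to_sphere L (sphere c r2)"
  shows "r1 = r2"
proof -
  obtain p where p: "p \<in> L" "dist c p = r1" "\<And>q. q \<in> L \<Longrightarrow> r1 \<le> dist c q"
    using assms(3,1) by (rule tangent_to_sphere_distance) blast
  obtain q where q: "q \<in> L" "dist c q = r2" "\<And>p. p \<in> L \<Longrightarrow> r2 \<le> dist c p"
    using assms(4,2) by (rule tangent_to_sphere_distance) blast
  show ?thesis using p(3)[OF q(1)] q(3)[OF p(1)] p(2) q(2) by simp
qed

theorem theorem9:
  fixes a b c1 c2 :: "real^3" and r1 r2 :: real
  assumes "a \<noteq> b"
    and "r1 > 0" and "r2 > 0"
    and "sphere c1 r1 \<noteq> sphere c2 r2"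
    and "infinite {L. tangent_to_sphere L (sphere c1 r1) \<and> tangent_to_sphere L (sphere c2 r2)}"
  shows "is_curve_of_degree (tangent_scheme a b c1 r1 c2 r2) 8 \<and>
    (\<forall>c1' r1' c2' r2'. r1' > 0 \<and> r2' > 0 \<and>
       tangent_scheme a b c1' r1' c2' r2' = tangent_scheme a b c1 r1 c2 r2 \<longrightarrow>
       {sphere c1' r1', sphere c2' r2'} = {sphere c1 r1, sphere c2 r2})"
proof -
  have centres: "c1 \<noteq> c2"
  proof
    assume c: "c1 = c2"
    then have "r1 \<noteq> r2" using assms(4) by auto
    then have "{L. tangent_to_sphere L (sphere c1 r1) \<and> tangent_to_sphere L (sphere c2 r2)} = {}"
      using concentric_spheres_no_common_tangent[OF assms(2,3)] unfolding c by blast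
    then show False using assms(5) by (metis finite.emptyI)
  qed
  obtain \<phi> :: "plucker_poly \<Rightarrow> plucker_poly" and y :: "real^3 \<Rightarrow> real^3" where
    \<phi>: "ring_morphism \<phi>" "\<And>c. \<phi> (Const c) = Const c" "\<And>d. \<phi> ` homogeneous_part d = balanced d"
    "\<phi> plucker_relation = 0" "\<phi> (line_form a b) = 0"
    "\<And>f. \<phi> f = 0 \<Longrightarrow> f \<in> ideal.span {plucker_relation, line_form a b}"
    and y: "inj y"
    and form: "\<And>c r. \<phi> (tangency_form (sphere_matrix c r)) = sphere_form (complex_of_real (y c $ 1))
       (complex_of_real (y c $ 2)) (complex_of_real (y c $ 3)) (complex_of_real (r\<^sup>2))"
    using line_parametrisation[OF assms(1)] by metis
  define T where "T c r = tangency_form (sphere_matrix c r)" for c r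
  define S where "S c r = sphere_form (complex_of_real (y c $ 1)) (complex_of_real (y c $ 2))
    (complex_of_real (y c $ 3)) (complex_of_real (r\<^sup>2))" for c r
  have y_eq: "c = c'" if "y c $ 1 = y c' $ 1" "y c $ 2 = y c' $ 2" "y c $ 3 = y c' $ 3" for c c'
  proof -
    have "y c = y c'" using that by (simp add: vec_eq_iff forall_3)
    then show ?thesis using y by (simp add: inj_eq)
  qed
  have tangents: "parametrised_tangents \<phi> (line_form a b) (T c r) (T c' r') (S c r) (S c' r')
     (complex_of_real (y c $ 1)) (complex_of_real (y c $ 2)) (complex_of_real (y c $ 3)) (complex_of_real (r\<^sup>2))
     (complex_of_real (y c' $ 1)) (complex_of_real (y c' $ 2)) (complex_of_real (y c' $ 3)) (complex_of_real (r'\<^sup>2))"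
    if "r > 0" "r' > 0" for c r c' r'
    by (rule parametrised_tangents.intro) (use that in \<open>simp_all add: \<phi> form S_def T_def tangency_form_homogeneous\<close>)
  have scheme: "tangent_scheme a b c r c' r' = saturation (ideal.span {plucker_relation, line_form a b, T c r, T c' r'})"
    for c r c' r'
    unfolding tangent_scheme_def subscheme_def ideal_generated_eq_span T_def ..
  have S_inj: "c = c' \<and> r = r'" if "S c r = S c' r'" "r > 0" "r' > 0" for c c' r r'
    using that y_eq unfolding S_def sphere_form_eq_iff of_real_eq_iff by (simp add: power2_eq_iff_nonneg)
  let ?X = "tangent_scheme a b c1 r1 c2 r2"
  have S12: "S c1 r1 \<noteq> S c2 r2" using S_inj assms(2,3) centres by blast
  interpret P: parametrised_tangents \<phi> "line_form a b" "T c1 r1" "T c2 r2" "S c1 r1" "S c2 r2"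
     "complex_of_real (y c1 $ 1)" "complex_of_real (y c1 $ 2)" "complex_of_real (y c1 $ 3)" "complex_of_real (r1\<^sup>2)"
     "complex_of_real (y c2 $ 1)" "complex_of_real (y c2 $ 2)" "complex_of_real (y c2 $ 3)" "complex_of_real (r2\<^sup>2)"
    using assms(2,3) by (rule tangents)
  have curve: "is_curve_of_degree ?X 8"
    unfolding scheme by (rule P.tangents_curve_of_degree_8[OF S12])
  have member: "T c r \<in> tangent_scheme a b c r c' r'" "T c' r' \<in> tangent_scheme a b c r c' r'" for c r c' r'
    unfolding scheme by (rule subsetD[OF ideal_subset_saturation ideal.span_base], simp)+
  have known: "c = c1 \<and> r = r1 \<or> c = c2 \<and> r = r2" if T: "T c r \<in> ?X" and r: "r > 0" for c r
  proof -
    \<comment> \<open>A tangency form has the same degree as the generators, so its coefficients in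
      the pencil are constants.\<close>
    have "T c r \<in> homogeneous_part (0 + 2)"
      unfolding T_def add_0 by (rule tangency_form_homogeneous)
    then have "S c r \<in> pencil (S c1 r1) (S c2 r2) 0"
      using P.saturation_pencil[OF S12] T form unfolding scheme T_def S_def by simp
    then obtain p q where pq: "S c r = S c1 r1 * p + S c2 r2 * q" "p \<in> balanced 0" "q \<in> balanced 0"
      unfolding pencil_def by blast
    obtain u v where "p = Const u" "q = Const v" using pq(2,3) balanced_0_Const by metis
    then have "S c r = Const u * S c1 r1 + Const v * S c2 r2" using pq(1) by (simp only: mult.commute)
    from sphere_form_combination(2)[OF this[unfolded S_def], unfolded of_real_eq_iff]
    consider "y c $ 1 = y c1 $ 1" "y c $ 2 = y c1 $ 2" "y c $ 3 = y c1 $ 3" "r\<^sup>2 = r1\<^sup>2"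
      | "y c $ 1 = y c2 $ 1" "y c $ 2 = y c2 $ 2" "y c $ 3 = y c2 $ 3" "r\<^sup>2 = r2\<^sup>2"
      | "y c1 $ 1 = y c2 $ 1" "y c1 $ 2 = y c2 $ 2" "y c1 $ 3 = y c2 $ 3"
      by blast
    then show ?thesis
    proof cases
      case 1
      then show ?thesis using y_eq[of c c1] r assms(2) by (simp add: power2_eq_iff_nonneg)
    next
      case 2
      then show ?thesis using y_eq[of c c2] r assms(3) by (simp add: power2_eq_iff_nonneg)
    next
      case 3
      then show ?thesis using y_eq[of c1 c2] centres by simp
    qed
  qed
  have "{sphere c1' r1', sphere c2' r2'} = {sphere c1 r1, sphere c2 r2}"
    if r: "r1' > 0" "r2' > 0" and X: "tangent_scheme a b c1' r1' c2' r2' = ?X" for c1' r1' c2' r2'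
  proof -
    \<comment> \<open>For equal spheres, every tangency form in the scheme would parametrise to a
      multiple of one sphere form, hence to that form itself; but the scheme contains two with
      different images.\<close>
    have distinct: "\<not> (c1' = c2' \<and> r1' = r2')"
    proof
      assume eq: "c1' = c2' \<and> r1' = r2'"
      interpret P': parametrised_tangents \<phi> "line_form a b" "T c1' r1'" "T c2' r2'" "S c1' r1'" "S c2' r2'"
        "complex_of_real (y c1' $ 1)" "complex_of_real (y c1' $ 2)" "complex_of_real (y c1' $ 3)" "complex_of_real (r1'\<^sup>2)"
        "complex_of_real (y c2' $ 1)" "complex_of_real (y c2' $ 2)" "complex_of_real (y c2' $ 3)" "complex_of_real (r2'\<^sup>2)"
        using r by (rule tangents)
      have "S c1' r1' = S c r" if "T c r \<in> ?X" for c r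
      proof -
        have "T c r \<in> tangent_scheme a b c1' r1' c2' r2'" using that unfolding X .
        then have "S c1' r1' dvd \<phi> (T c r)"
          unfolding scheme by (rule P'.saturation_single_form[rotated]) (simp add: eq)
        then show ?thesis unfolding T_def form S_def by (rule sphere_form_dvd_sphere_form)
      qed
      then show False using member(1)[of c1 r1 c2 r2] member(2)[of c2 r2 c1 r1] S12 by metis
    qed
    have "c1' = c1 \<and> r1' = r1 \<or> c1' = c2 \<and> r1' = r2" "c2' = c1 \<and> r2' = r1 \<or> c2' = c2 \<and> r2' = r2"
      using known member(1)[of c1' r1' c2' r2', unfolded X] member(2)[of c2' r2' c1' r1', unfolded X] r by blast+
    then show ?thesis using distinct by auto
  qed
  with curve show ?thesis by blast
qed

end
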